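(* Let $\mathscr G$ be an ample groupoid, $R$ a unital ring, $H$ a discrete group with identity $e$, and $c\colon\mathscr G\to H$ a continuous cocycle. Then $R\mathscr G$ is graded von Neumann regular (with respect to the $H$-grading induced by $c$) if and only if the following conditions hold, where $\mathscr G_e=c^{-1}(e)$: (1) $R$ is von Neumann regular; (2) $\mathscr G_e$ is approximately quasi-compact; (3) the order of each finite subgroup of an isotropy group of $\mathscr G_e$ is invertible in $R$.
   Context: A ring $A$ (not necessarily unital) is von Neumann regular if for every $a\in A$ there is $b\in A$ with $aba=a$. An $H$-graded ring $\Lambda=\bigoplus_{h\in H}\Lambda_h$ is graded von Neumann regular if for every homogeneous $x\in\Lambda$ there is $y\in\Lambda$ with $xyx=x$. A space is quasi-compact if every open cover has a finite subcover; compact means quasi-compact and Hausdorff. A topological groupoid is a nonempty groupoid $\mathscr G$ with a locally compact topology (every point has a compact Hausdorff neighborhood) such that composition and inversion are continuous; $\mathscr G$ need not be Hausdorff, but the unit space $\mathscr G^{(0)}$ is assumed Hausdorff. With source and range maps $\boldsymbol s,\boldsymbol r$, $\mathscr G$ is étale if $\boldsymbol r$ is a local homeomorphism, and ample if it is étale and $\mathscr G^{(0)}$ is locally compact Hausdorff with a basis of compact open sets. An ample groupoid is approximately quasi-compact if it is a directed union of quasi-compact open subgroupoids. The isotropy group at a unit $x$ is the group of arrows with source and range $x$. A bisection is an open set $U\subseteq\mathscr G$ such that $\boldsymbol r|_U$, $\boldsymbol s|_U$ are homeomorphisms onto open subsets of $\mathscr G^{(0)}$. $R\mathscr G$ is the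 left $R$-submodule of $R^{\mathscr G}$ spanned by the characteristic functions $1_U$ of compact open bisections $U$, with product $f*g(\gamma)=\sum_{\alpha\beta=\gamma}f(\alpha)g(\beta)$. A cocycle is a map $c\colon\mathscr G\to H$ with $c(\gamma\eta)=c(\gamma)c(\eta)$ for all composable $\gamma,\eta$. A continuous cocycle induces the $H$-grading in which the component $(R\mathscr G)_h$ is the $R$-span of the $1_U$ with $U$ a compact open bisection contained in $c^{-1}(h)$. The set $\mathscr G_e=c^{-1}(e)$ is a clopen (ample) subgroupoid of $\mathscr G$. *)

theory Defs
  imports "HOL-Analysis.Analysis" "HOL-Algebra.Coset"
begin

text \<open>
  A groupoid is presented by its arrows, which form the underlying set of a topology; a unit is
  identified with its identity arrow, so that source and range map arrows to arrows. The product
  \<open>gmult G \<alpha> \<beta>\<close> is meaningful only if \<open>gsrc G \<alpha> = grng G \<beta>\<close>. All operations are unconstrained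
  outside the set of arrows.
\<close>

record 'g top_groupoid =
  gtop :: "'g topology"
  gsrc :: "'g \<Rightarrow> 'g"
  grng :: "'g \<Rightarrow> 'g"
  gmult :: "'g \<Rightarrow> 'g \<Rightarrow> 'g"
  ginv :: "'g \<Rightarrow> 'g"

definition arrows :: "'g top_groupoid \<Rightarrow> 'g set" where
  "arrows G = topspace (gtop G)"

definition gunits :: "'g top_groupoid \<Rightarrow> 'g set" where
  "gunits G = {x \<in> arrows G. gsrc G x = x}"

definition unit_space :: "'g top_groupoid \<Rightarrow> 'g topology" where
  "unit_space G = subtopology (gtop G) (gunits G)"

definition composable :: "'g top_groupoid \<Rightarrow> ('g \<times> 'g) set" where
  "composable G = {(\<alpha>, \<beta>). \<alpha> \<in> arrows G \<and> \<beta> \<in> arrows G \<and> gsrc G \<alpha> = grng G \<beta>}"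

locale groupoid =
  fixes G :: "'g top_groupoid"
  assumes src_closed: "\<alpha> \<in> arrows G \<Longrightarrow> gsrc G \<alpha> \<in> arrows G"
    and rng_closed: "\<alpha> \<in> arrows G \<Longrightarrow> grng G \<alpha> \<in> arrows G"
    and src_src: "\<alpha> \<in> arrows G \<Longrightarrow> gsrc G (gsrc G \<alpha>) = gsrc G \<alpha>"
    and rng_src: "\<alpha> \<in> arrows G \<Longrightarrow> grng G (gsrc G \<alpha>) = gsrc G \<alpha>"
    and src_rng: "\<alpha> \<in> arrows G \<Longrightarrow> gsrc G (grng G \<alpha>) = grng G \<alpha>"
    and rng_rng: "\<alpha> \<in> arrows G \<Longrightarrow> grng G (grng G \<alpha>) = grng G \<alpha>"
    and mult_closed: "(\<alpha>, \<beta>) \<in> composable G \<Longrightarrow> gmult G \<alpha> \<beta> \<in> arrows G"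
    and src_mult: "(\<alpha>, \<beta>) \<in> composable G \<Longrightarrow> gsrc G (gmult G \<alpha> \<beta>) = gsrc G \<beta>"
    and rng_mult: "(\<alpha>, \<beta>) \<in> composable G \<Longrightarrow> grng G (gmult G \<alpha> \<beta>) = grng G \<alpha>"
    and mult_assoc: "(\<alpha>, \<beta>) \<in> composable G \<Longrightarrow> (\<beta>, \<gamma>) \<in> composable G \<Longrightarrow>
          gmult G (gmult G \<alpha> \<beta>) \<gamma> = gmult G \<alpha> (gmult G \<beta> \<gamma>)"
    and mult_src: "\<alpha> \<in> arrows G \<Longrightarrow> gmult G \<alpha> (gsrc G \<alpha>) = \<alpha>"
    and rng_mult_self: "\<alpha> \<in> arrows G \<Longrightarrow> gmult G (grng G \<alpha>) \<alpha> = \<alpha>"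
    and inv_closed: "\<alpha> \<in> arrows G \<Longrightarrow> ginv G \<alpha> \<in> arrows G"
    and src_inv: "\<alpha> \<in> arrows G \<Longrightarrow> gsrc G (ginv G \<alpha>) = grng G \<alpha>"
    and rng_inv: "\<alpha> \<in> arrows G \<Longrightarrow> grng G (ginv G \<alpha>) = gsrc G \<alpha>"
    and mult_inv: "\<alpha> \<in> arrows G \<Longrightarrow> gmult G \<alpha> (ginv G \<alpha>) = grng G \<alpha>"
    and inv_mult: "\<alpha> \<in> arrows G \<Longrightarrow> gmult G (ginv G \<alpha>) \<alpha> = gsrc G \<alpha>"

text \<open>
  The library's \<^const>\<open>compactin\<close> is quasi-compactness: it does not include the Hausdorff property.
\<close>

definition compact_Hausdorff_in :: "'a topology \<Rightarrow> 'a set \<Rightarrow> bool" where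
  "compact_Hausdorff_in X K \<longleftrightarrow> compactin X K \<and> Hausdorff_space (subtopology X K)"

locale topological_groupoid = groupoid +
  assumes nonempty: "arrows G \<noteq> {}"
    and locally_compact: "\<gamma> \<in> arrows G \<Longrightarrow>
          \<exists>U K. openin (gtop G) U \<and> \<gamma> \<in> U \<and> U \<subseteq> K \<and> compact_Hausdorff_in (gtop G) K"
    and continuous_mult:
          "continuous_map (subtopology (prod_topology (gtop G) (gtop G)) (composable G)) (gtop G)
             (\<lambda>(\<alpha>, \<beta>). gmult G \<alpha> \<beta>)"
    and continuous_inv: "continuous_map (gtop G) (gtop G) (ginv G)"
    and Hausdorff_units: "Hausdorff_space (unit_space G)"

definition homeo_onto_open_on :: "'a topology \<Rightarrow> 'b topology \<Rightarrow> 'a set \<Rightarrow> ('a \<Rightarrow> 'b) \<Rightarrow> bool" where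
  "homeo_onto_open_on X Y U f \<longleftrightarrow> embedding_map (subtopology X U) Y f \<and> openin Y (f ` U)"

definition local_homeomorphism :: "'a topology \<Rightarrow> 'b topology \<Rightarrow> ('a \<Rightarrow> 'b) \<Rightarrow> bool" where
  "local_homeomorphism X Y f \<longleftrightarrow>
     (\<forall>x \<in> topspace X. \<exists>U. openin X U \<and> x \<in> U \<and> homeo_onto_open_on X Y U f)"

locale etale_groupoid = topological_groupoid +
  assumes etale: "local_homeomorphism (gtop G) (unit_space G) (grng G)"

definition has_compact_open_basis :: "'a topology \<Rightarrow> bool" where
  "has_compact_open_basis X \<longleftrightarrow>
     (\<exists>\<B>. (\<forall>B \<in> \<B>. openin X B \<and> compact_Hausdorff_in X B) \<and>
          (\<forall>U. openin X U \<longrightarrow> (\<exists>\<U>. \<U> \<subseteq> \<B> \<and> U = \<Union>\<U>)))"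

locale ample_groupoid = etale_groupoid +
  assumes units_locally_compact: "locally_compact_space (unit_space G)"
    and units_compact_open_basis: "has_compact_open_basis (unit_space G)"

definition restrict_groupoid :: "'g top_groupoid \<Rightarrow> 'g set \<Rightarrow> 'g top_groupoid" where
  "restrict_groupoid G S = G\<lparr>gtop := subtopology (gtop G) S\<rparr>"

text \<open>Subgroupoids are not required to contain all units.\<close>

definition subgroupoid :: "'g set \<Rightarrow> 'g top_groupoid \<Rightarrow> bool" where
  "subgroupoid S G \<longleftrightarrow> S \<noteq> {} \<and> S \<subseteq> arrows G \<and>
     (\<forall>\<alpha> \<in> S. ginv G \<alpha> \<in> S) \<and>
     (\<forall>\<alpha> \<in> S. \<forall>\<beta> \<in> S. (\<alpha>, \<beta>) \<in> composable G \<longrightarrow> gmult G \<alpha> \<beta> \<in> S)"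

definition approximately_quasi_compact :: "'g top_groupoid \<Rightarrow> bool" where
  "approximately_quasi_compact G \<longleftrightarrow>
     (\<exists>\<F>. \<F> \<noteq> {} \<and>
          (\<forall>S \<in> \<F>. subgroupoid S G \<and> openin (gtop G) S \<and> compactin (gtop G) S) \<and>
          (\<forall>S \<in> \<F>. \<forall>T \<in> \<F>. \<exists>W \<in> \<F>. S \<union> T \<subseteq> W) \<and>
          \<Union>\<F> = arrows G)"

definition isotropy_group :: "'g top_groupoid \<Rightarrow> 'g \<Rightarrow> 'g monoid" where
  "isotropy_group G x =
     \<lparr>carrier = {\<gamma> \<in> arrows G. gsrc G \<gamma> = x \<and> grng G \<gamma> = x}, monoid.mult = gmult G, one = x\<rparr>"

definition bisection :: "'g top_groupoid \<Rightarrow> 'g set \<Rightarrow> bool" where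
  "bisection G U \<longleftrightarrow> openin (gtop G) U \<and>
     homeo_onto_open_on (gtop G) (unit_space G) U (grng G) \<and>
     homeo_onto_open_on (gtop G) (unit_space G) U (gsrc G)"

definition compact_open_bisections :: "'g top_groupoid \<Rightarrow> 'g set set" where
  "compact_open_bisections G = {U. bisection G U \<and> compact_Hausdorff_in (gtop G) U}"

text \<open>
  The coefficient ring need not be commutative, so the library's \<^const>\<open>module.span\<close> does not apply.
\<close>

definition left_span :: "('g \<Rightarrow> 'r::ring_1) set \<Rightarrow> ('g \<Rightarrow> 'r) set" where
  "left_span B = {(\<lambda>\<gamma>. \<Sum>b\<in>F. a b * b \<gamma>) |F a. finite F \<and> F \<subseteq> B}"

text \<open>
  A function on the arrows is represented by its extension by zero to the whole type.
\<close>

definition groupoid_algebra :: "'g top_groupoid \<Rightarrow> ('g \<Rightarrow> 'r::ring_1) set" where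
  "groupoid_algebra G = left_span (indicator ` compact_open_bisections G)"

text \<open>
  The sum is restricted to the supports because it would otherwise in general be indexed by an
  infinite set, over which \<^const>\<open>sum\<close> is zero by convention. For \<open>f\<close> and \<open>g\<close> in the groupoid
  algebra the restricted index set is finite.
\<close>

definition convolution ::
    "'g top_groupoid \<Rightarrow> ('g \<Rightarrow> 'r::ring_1) \<Rightarrow> ('g \<Rightarrow> 'r) \<Rightarrow> ('g \<Rightarrow> 'r)" where
  "convolution G f g \<gamma> =
     (\<Sum>(\<alpha>, \<beta>) \<in> {(\<alpha>, \<beta>) \<in> composable G. gmult G \<alpha> \<beta> = \<gamma> \<and> f \<alpha> \<noteq> 0 \<and> g \<beta> \<noteq> 0}. f \<alpha> * g \<beta>)"

definition continuous_cocycle ::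
    "'g top_groupoid \<Rightarrow> ('h, 'm) monoid_scheme \<Rightarrow> ('g \<Rightarrow> 'h) \<Rightarrow> bool" where
  "continuous_cocycle G H c \<longleftrightarrow>
     continuous_map (gtop G) (discrete_topology (carrier H)) c \<and>
     (\<forall>(\<gamma>, \<eta>) \<in> composable G. c (gmult G \<gamma> \<eta>) = c \<gamma> \<otimes>\<^bsub>H\<^esub> c \<eta>)"

definition cocycle_fibre :: "'g top_groupoid \<Rightarrow> ('g \<Rightarrow> 'h) \<Rightarrow> 'h \<Rightarrow> 'g set" where
  "cocycle_fibre G c h = {\<gamma> \<in> arrows G. c \<gamma> = h}"

definition kernel_groupoid ::
    "'g top_groupoid \<Rightarrow> ('h, 'm) monoid_scheme \<Rightarrow> ('g \<Rightarrow> 'h) \<Rightarrow> 'g top_groupoid" where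
  "kernel_groupoid G H c = restrict_groupoid G (cocycle_fibre G c \<one>\<^bsub>H\<^esub>)"

definition algebra_component ::
    "'g top_groupoid \<Rightarrow> ('g \<Rightarrow> 'h) \<Rightarrow> 'h \<Rightarrow> ('g \<Rightarrow> 'r::ring_1) set" where
  "algebra_component G c h =
     left_span (indicator ` {U \<in> compact_open_bisections G. U \<subseteq> cocycle_fibre G c h})"

text \<open>
  A ring without unit is given by its elements and its multiplication, a grading by the index set
  \<open>I\<close> and the homogeneous components \<open>C h\<close>.
\<close>

definition von_neumann_regular :: "'a set \<Rightarrow> ('a \<Rightarrow> 'a \<Rightarrow> 'a) \<Rightarrow> bool" where
  "von_neumann_regular A m \<longleftrightarrow> (\<forall>a \<in> A. \<exists>b \<in> A. m (m a b) a = a)"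

definition graded_von_neumann_regular ::
    "'a set \<Rightarrow> ('a \<Rightarrow> 'a \<Rightarrow> 'a) \<Rightarrow> 'h set \<Rightarrow> ('h \<Rightarrow> 'a set) \<Rightarrow> bool" where
  "graded_von_neumann_regular A m I C \<longleftrightarrow>
     (\<forall>h \<in> I. \<forall>x \<in> C h. \<exists>y \<in> A. m (m x y) x = x)"

definition invertible_element :: "'r::ring_1 \<Rightarrow> bool" where
  "invertible_element a \<longleftrightarrow> (\<exists>b. a * b = 1 \<and> b * a = 1)"

end

theory Submission
  imports Defs "HOL-Library.Function_Algebras"
begin

text \<open>
  Products with inverses of bisections show that the graded algebra is graded regular if and only if
  its component of degree \<open>e\<close>, the algebra of the kernel groupoid, is regular. This reduces
  the statement to the trivial grading.

  If the algebra of an ample groupoid is regular, then finitely many elements of the augmentation left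
  ideal have a common right unit there. For the elements \<open>1\<^sub>U - 1\<^sub>V\<close>, with \<open>U\<close> in a finite set of
  compact open bisections and \<open>V\<close> the range of \<open>U\<close>, this yields a function \<open>h\<close> of augmentation 1
  that is invariant under the subgroupoid generated by these bisections. As \<open>h\<close> has fibrewise finite
  support of bounded size, this subgroupoid has bounded fibres and is therefore quasi-compact; and
  summing \<open>h\<close> over the orbits of a finite isotropy group inverts the order of that group.

  Conversely one may assume the groupoid to be quasi-compact. Its orbits are finite, and over one
  orbit a quasi-inverse is obtained by averaging a quasi-inverse matrix over \<open>R\<close>. Elements of the
  algebra that vanish over an orbit vanish over an invariant compact open neighbourhood of it, so that
  the quasi-inverses over finitely many such neighbourhoods can be glued.
\<close>

section \<open>Von Neumann regular rings\<close>

text \<open>The groupoid need not be Hausdorff: the support of an element of the algebra need not be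
  open, compact sets of arrows need not be closed, and cutting an element down to an open set may
  leave the algebra. Only the unit space is Hausdorff. Localisation therefore goes through sources
  and ranges: over clopen invariant sets of units, or by comparing bisections that share an arrow.
  As the algebra has no unit in general, common right units of finitely many elements take its
  place.

  The bound behind quasi-compactness is uniform: if m bisections cover the support of
  \<open>h\<close>, each source fibre of the support has at most m points. Translation embeds the
  source fibres of the generated subgroupoid into such fibres. The words with a fixed source thus
  form an increasing chain in a set with at most m elements, and a chain that stalls once stays put;
  so words of bounded length exhaust the subgroupoid.

  The kernel groupoid and quasi-compact open subgroupoids of it are treated by the same lemmas. For
  this reason ampleness is first replaced by a short list of properties that open subgroupoids
  inherit.\<close>

locale nonunital_ring =
  fixes A :: "'a::ab_group_add set" and m :: "'a \<Rightarrow> 'a \<Rightarrow> 'a" (infixl "\<star>" 70)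
  assumes zero_closed: "0 \<in> A"
    and diff_closed: "x \<in> A \<Longrightarrow> y \<in> A \<Longrightarrow> x - y \<in> A"
    and mult_closed: "x \<in> A \<Longrightarrow> y \<in> A \<Longrightarrow> x \<star> y \<in> A"
    and mult_assoc: "x \<in> A \<Longrightarrow> y \<in> A \<Longrightarrow> z \<in> A \<Longrightarrow> x \<star> y \<star> z = x \<star> (y \<star> z)"
    and diff_mult: "x \<in> A \<Longrightarrow> y \<in> A \<Longrightarrow> z \<in> A \<Longrightarrow> (x - y) \<star> z = x \<star> z - y \<star> z"
    and mult_diff: "x \<in> A \<Longrightarrow> y \<in> A \<Longrightarrow> z \<in> A \<Longrightarrow> x \<star> (y - z) = x \<star> y - x \<star> z"
begin

text \<open>In a unital overring, \<open>x \<star> e = x\<close> reads x(1 - e) = 0. If this holds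
  on \<open>F\<close> and \<epsilon> is a right unit of u = a(1 - e), then the element e' with 1 -
  e' = (1 - e)(1 - \<epsilon>) serves for \<open>a\<close> as well. Regularity provides \<epsilon> =
  bu, which lies in the left ideal because u does.\<close>

lemma left_ideal_common_right_unit:
  assumes regular: "von_neumann_regular A m"
    and L: "L \<subseteq> A" "0 \<in> L" "\<And>x y. x \<in> L \<Longrightarrow> y \<in> L \<Longrightarrow> x - y \<in> L"
      "\<And>x y. x \<in> A \<Longrightarrow> y \<in> L \<Longrightarrow> x \<star> y \<in> L"
    and "finite F" "F \<subseteq> L"
  shows "\<exists>e\<in>L. \<forall>a\<in>F. a \<star> e = a"
  using \<open>finite F\<close> \<open>F \<subseteq> L\<close>
proof (induction F)
  case empty
  then show ?case using L by blast
next
  case (insert a F)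
  then obtain e where e: "e \<in> L" "\<And>x. x \<in> F \<Longrightarrow> x \<star> e = x" by auto
  have a: "a \<in> L" "a \<in> A" and eA: "e \<in> A" using insert.prems L e by auto
  define u where "u = a - a \<star> e"
  have u: "u \<in> L" "u \<in> A" unfolding u_def using a e L by auto
  then obtain b where b: "b \<in> A" "u \<star> b \<star> u = u"
    using regular unfolding von_neumann_regular_def by blast
  define \<epsilon> where "\<epsilon> = b \<star> u"
  have \<epsilon>: "\<epsilon> \<in> L" "\<epsilon> \<in> A" "u \<star> \<epsilon> = u" unfolding \<epsilon>_def
    using b u L mult_assoc[of u b u] by (auto simp: mult_closed)
  define e' where "e' = e - (e \<star> \<epsilon> - \<epsilon>)"
  have e': "e' \<in> L" unfolding e'_def using \<epsilon> e eA L by auto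
  have expand: "x \<star> e' = x \<star> e - (x \<star> e \<star> \<epsilon> - x \<star> \<epsilon>)" if "x \<in> A" for x
    using that \<epsilon> eA by (simp add: e'_def mult_diff mult_closed diff_closed mult_assoc)
  have "x \<star> e' = x" if "x \<in> F" for x
    using that expand[of x] e(2)[OF that] insert.prems L by auto
  moreover have "a \<star> e' = a"
  proof -
    have "u \<star> \<epsilon> = a \<star> \<epsilon> - a \<star> e \<star> \<epsilon>"
      unfolding u_def using a eA \<epsilon> by (simp add: diff_mult mult_closed)
    then have "a \<star> e' = a \<star> e + u" using expand[OF a(2)] \<epsilon>(3) by simp
    then show ?thesis by (simp add: u_def)
  qed
  ultimately show ?case using e' by blast
qed

end

section \<open>Matrices over a von Neumann regular ring\<close>

definition left_linear_functional :: "(('i \<Rightarrow> 'r::ring_1) \<Rightarrow> 'r) \<Rightarrow> bool" where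
  "left_linear_functional w \<longleftrightarrow>
     (\<forall>x y. w (x + y) = w x + w y) \<and> (\<forall>r x. w (\<lambda>i. r * x i) = r * w x)"

lemma left_linear_functional_diff:
  assumes "left_linear_functional w"
  shows "w (x - y) = w x - w y"
proof -
  have "w ((x - y) + y) = w (x - y) + w y"
    using assms unfolding left_linear_functional_def by blast
  then show ?thesis by (simp add: algebra_simps)
qed

lemma left_linear_functional_zero:
  assumes "left_linear_functional w"
  shows "w 0 = 0"
  using left_linear_functional_diff[OF assms, of 0 0] by simp

lemma left_linear_functional_sum:
  assumes "left_linear_functional w" "finite X"
  shows "w (\<lambda>j. \<Sum>i\<in>X. x i * y i j) = (\<Sum>i\<in>X. x i * w (y i))"
  using assms(2)
proof (induction X)
  case empty
  have "(\<lambda>j. \<Sum>i\<in>{}. x i * y i j) = 0" by auto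
  then show ?case using left_linear_functional_zero[OF assms(1)] by simp
next
  case (insert a X)
  have "(\<lambda>j. \<Sum>i\<in>insert a X. x i * y i j) = (\<lambda>j. x a * y a j) + (\<lambda>j. \<Sum>i\<in>X. x i * y i j)"
    using insert.hyps by auto
  then show ?case using insert assms(1) unfolding left_linear_functional_def by simp
qed

text \<open>The case of a single row \<open>u\<close>: \<open>w\<close> stands for right
  multiplication by a column that is a quasi-inverse of \<open>u\<close> on \<open>X\<close>.
  Entries are added one at a time.\<close>

lemma regular_vector:
  fixes u :: "'i \<Rightarrow> 'r::ring_1"
  assumes regular: "von_neumann_regular (UNIV :: 'r set) (*)" and "finite X"
  shows "\<exists>w. left_linear_functional w \<and> (\<forall>i\<in>X. w u * u i = u i)"
  using \<open>finite X\<close>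
proof (induction X)
  case empty
  have "left_linear_functional (\<lambda>x::'i \<Rightarrow> 'r. 0)"
    by (simp add: left_linear_functional_def)
  then show ?case by blast
next
  case (insert j X)
  then obtain w where w: "left_linear_functional w" "\<forall>i\<in>X. w u * u i = u i" by blast
  define a where "a = u j - w u * u j"
  obtain b where b: "a * b * a = a"
    using regular unfolding von_neumann_regular_def by blast
  \<comment> \<open>The correction is chosen so that 1 - w' u = (1 - a b)(1 - w u). The second
    factor kills the entries in \<open>X\<close> and turns \<open>u j\<close> into \<open>a\<close>,
    which the first factor kills.\<close>
  define w' where "w' = (\<lambda>x. w x + (x j - w x * u j) * b * (1 - w u))"
  have "left_linear_functional w'"
    using w(1) unfolding left_linear_functional_def w'_def by (auto simp: algebra_simps)
  moreover have "w' u * u i = u i" if "i \<in> X" for i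
    using w(2) that by (simp add: w'_def a_def[symmetric] distrib_right mult.assoc left_diff_distrib)
  moreover have "w' u * u j = u j"
  proof -
    have "w' u * u j = w u * u j + a * b * a"
      by (simp add: w'_def a_def distrib_right mult.assoc left_diff_distrib)
    then show ?thesis by (simp only: b) (simp add: a_def)
  qed
  ultimately show ?case by blast
qed

text \<open>
  In matrix terms: the matrix with rows \<open>v k\<close> is von Neumann regular. The functionals \<open>N i\<close> are the
  columns of a quasi-inverse.
\<close>

lemma regular_vectors:
  fixes v :: "'k \<Rightarrow> 'i \<Rightarrow> 'r::ring_1"
  assumes regular: "von_neumann_regular (UNIV :: 'r set) (*)" and "finite X" "finite K"
  shows "\<exists>N. (\<forall>k\<in>K. left_linear_functional (N k)) \<and>
    (\<forall>k\<in>K. \<forall>i\<in>X. (\<Sum>l\<in>K. N l (v k) * v l i) = v k i)"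
  using \<open>finite K\<close>
proof (induction K)
  case empty
  then show ?case by simp
next
  case (insert h K)
  then obtain N where N: "\<forall>k\<in>K. left_linear_functional (N k)"
    and Nv: "\<forall>k\<in>K. \<forall>i\<in>X. (\<Sum>l\<in>K. N l (v k) * v l i) = v k i" by blast
  \<comment> \<open>\<open>P\<close> multiplies a row by the quasi-inverse found so far and then by
    the matrix. Outside \<open>X\<close> it is the identity, so that \<open>P (v k) = v k\<close>
    holds as an equation of functions for \<open>k\<close> in \<open>K\<close>.\<close>
  define P where "P x = (\<lambda>i. if i \<in> X then \<Sum>l\<in>K. N l x * v l i else x i)" for x
  define u where "u = v h - P (v h)"
  obtain w where w: "left_linear_functional w" "\<forall>i\<in>X. w u * u i = u i"
    using regular_vector[OF regular \<open>finite X\<close>] by blast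
  define q where "q x = w (x - P x)" for x
  have P_add: "P (x + y) = P x + P y" and P_scale: "P (\<lambda>i. r * x i) = (\<lambda>i. r * P x i)" for x y r
    using N unfolding left_linear_functional_def P_def
    by (auto simp: fun_eq_iff distrib_right sum.distrib sum_distrib_left mult.assoc)
  have q: "left_linear_functional q"
  proof -
    have "x + y - P (x + y) = (x - P x) + (y - P y)" for x y
      by (simp add: P_add)
    moreover have "(\<lambda>i. r * x i) - P (\<lambda>i. r * x i) = (\<lambda>i. r * (x - P x) i)" for r x
      by (auto simp: P_scale right_diff_distrib)
    ultimately show ?thesis
      using w(1) unfolding left_linear_functional_def q_def by metis
  qed
  \<comment> \<open>The new row turns \<open>P x\<close> into \<open>P x + q x * u\<close> on
    \<open>X\<close>. This fixes \<open>v h\<close>, because \<open>w u * u i = u i\<close> there,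
    and leaves the old rows fixed, because \<open>q\<close> vanishes on them.\<close>
  define N' where "N' = (\<lambda>l x. if l = h then q x else N l x - q x * N l (v h))"
  have "left_linear_functional (N' l)" if "l \<in> insert h K" for l
    using that N q unfolding left_linear_functional_def N'_def by (auto simp: algebra_simps)
  moreover have "(\<Sum>l\<in>insert h K. N' l (v k) * v l i) = v k i" if "k \<in> insert h K" "i \<in> X" for k i
  proof -
    have "(\<Sum>l\<in>insert h K. N' l (v k) * v l i)
        = q (v k) * v h i + (\<Sum>l\<in>K. (N l (v k) - q (v k) * N l (v h)) * v l i)"
      using insert.hyps by (auto simp: N'_def intro!: sum.cong)
    also have "\<dots> = P (v k) i + q (v k) * u i"
      using \<open>i \<in> X\<close>
      by (simp add: P_def u_def left_diff_distrib right_diff_distrib sum_subtractf sum_distrib_left mult.assoc)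
    also have "\<dots> = v k i"
    proof (cases "k = h")
      case True
      then show ?thesis using w(2) \<open>i \<in> X\<close> by (simp add: q_def u_def[symmetric]) (simp add: u_def)
    next
      case False
      then have "k \<in> K" using that by simp
      then have "P (v k) = v k" using Nv by (auto simp: P_def)
      then show ?thesis by (simp add: q_def left_linear_functional_zero[OF w(1)])
    qed
    finally show ?thesis .
  qed
  ultimately show ?case by blast
qed

section \<open>Groupoids with a basis of compact open bisections\<close>

context groupoid
begin

abbreviation arrow_set ("\<G>") where "\<G> \<equiv> arrows G"
abbreviation arrow_topology ("\<T>") where "\<T> \<equiv> gtop G"
abbreviation source ("\<s>") where "\<s> \<equiv> gsrc G"
abbreviation multiplication ("\<m>") where "\<m> \<equiv> gmult G"
abbreviation inversion ("\<i>") where "\<i> \<equiv> ginv G"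
abbreviation range_map ("\<r>") where "\<r> \<equiv> grng G"
abbreviation bisections ("\<B>") where "\<B> \<equiv> compact_open_bisections G"
abbreviation unit_set ("\<X>") where "\<X> \<equiv> gunits G"
abbreviation conv where "conv \<equiv> convolution G"
abbreviation alg where "alg \<equiv> groupoid_algebra G"

lemmas arrow_simps [simp] =
  src_closed rng_closed src_src rng_src src_rng rng_rng mult_src rng_mult_self
  inv_closed src_inv rng_inv mult_inv inv_mult

lemma mult_arrow [simp]:
  assumes "\<alpha> \<in> \<G>" "\<beta> \<in> \<G>" "\<s> \<alpha> = \<r> \<beta>"
  shows "\<m> \<alpha> \<beta> \<in> \<G>" "\<s> (\<m> \<alpha> \<beta>) = \<s> \<beta>"
    "\<r> (\<m> \<alpha> \<beta>) = \<r> \<alpha>"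
  using assms mult_closed src_mult rng_mult unfolding composable_def by auto

lemma arrow_assoc:
  assumes "\<alpha> \<in> \<G>" "\<beta> \<in> \<G>" "\<gamma> \<in> \<G>"
    "\<s> \<alpha> = \<r> \<beta>" "\<s> \<beta> = \<r> \<gamma>"
  shows "\<m> (\<m> \<alpha> \<beta>) \<gamma> = \<m> \<alpha> (\<m> \<beta> \<gamma>)"
  using assms mult_assoc unfolding composable_def by auto

lemma unitsD [simp]:
  assumes "x \<in> \<X>"
  shows "x \<in> \<G>" "\<s> x = x" "\<r> x = x"
proof -
  show *: "x \<in> \<G>" "\<s> x = x" using assms by (auto simp: gunits_def)
  show "\<r> x = x" using rng_src[OF *(1)] *(2) by simp
qed

lemma units_subset: "\<X> \<subseteq> \<G>"
  by auto

lemma src_unit [simp]: "\<alpha> \<in> \<G> \<Longrightarrow> \<s> \<alpha> \<in> \<X>"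
  and rng_unit [simp]: "\<alpha> \<in> \<G> \<Longrightarrow> \<r> \<alpha> \<in> \<X>"
  unfolding gunits_def by simp_all

lemma units_eq_rng_image: "\<X> = \<r> ` \<G>"
proof (intro equalityI subsetI)
  fix x assume "x \<in> \<X>"
  then show "x \<in> \<r> ` \<G>" using image_eqI[of x "\<r>" x] by simp
qed auto

lemma inv_mult_cancel [simp]:
  assumes "\<alpha> \<in> \<G>" "\<beta> \<in> \<G>" "\<s> \<alpha> = \<r> \<beta>"
  shows "\<m> (\<i> \<alpha>) (\<m> \<alpha> \<beta>) = \<beta>"
  using assms by (simp add: arrow_assoc[symmetric])

lemma mult_inv_cancel [simp]:
  assumes "\<alpha> \<in> \<G>" "\<beta> \<in> \<G>" "\<r> \<alpha> = \<r> \<beta>"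
  shows "\<m> \<alpha> (\<m> (\<i> \<alpha>) \<beta>) = \<beta>"
  using assms by (simp add: arrow_assoc[symmetric])

lemma mult_cancel_right [simp]:
  assumes "\<alpha> \<in> \<G>" "\<beta> \<in> \<G>" "\<s> \<alpha> = \<r> \<beta>"
  shows "\<m> (\<m> \<alpha> \<beta>) (\<i> \<beta>) = \<alpha>"
proof -
  have "\<m> (\<m> \<alpha> \<beta>) (\<i> \<beta>) = \<m> \<alpha> (\<s> \<alpha>)"
    using assms by (simp add: arrow_assoc)
  then show ?thesis using assms(1) by simp
qed

lemma mult_inv_cancel_right [simp]:
  assumes "\<alpha> \<in> \<G>" "\<beta> \<in> \<G>" "\<s> \<alpha> = \<s> \<beta>"
  shows "\<m> (\<m> \<alpha> (\<i> \<beta>)) \<beta> = \<alpha>"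
proof -
  have "\<m> (\<m> \<alpha> (\<i> \<beta>)) \<beta> = \<m> \<alpha> (\<s> \<alpha>)"
    using assms by (simp add: arrow_assoc)
  then show ?thesis using assms(1) by simp
qed

lemma inv_unique:
  assumes "\<alpha> \<in> \<G>" "\<beta> \<in> \<G>" "\<s> \<alpha> = \<r> \<beta>" "\<m> \<alpha> \<beta> = \<r> \<alpha>"
  shows "\<i> \<alpha> = \<beta>"
proof -
  have "\<beta> = \<m> (\<i> \<alpha>) (\<m> \<alpha> \<beta>)"
    using inv_mult_cancel[OF assms(1-3)] by simp
  also have "\<dots> = \<m> (\<i> \<alpha>) (\<s> (\<i> \<alpha>))" unfolding assms(4) using assms(1) by simp
  also have "\<dots> = \<i> \<alpha>" using assms(1) inv_closed mult_src by blast
  finally show ?thesis by simp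
qed

lemma inv_inv [simp]: "\<alpha> \<in> \<G> \<Longrightarrow> \<i> (\<i> \<alpha>) = \<alpha>"
  by (rule inv_unique) auto

lemma inv_unit [simp]: "x \<in> \<X> \<Longrightarrow> \<i> x = x"
  using inv_unique[of x x] mult_src[of x] by simp

lemma inv_mult_rev:
  assumes "\<alpha> \<in> \<G>" "\<beta> \<in> \<G>" "\<s> \<alpha> = \<r> \<beta>"
  shows "\<i> (\<m> \<alpha> \<beta>) = \<m> (\<i> \<beta>) (\<i> \<alpha>)"
proof (rule inv_unique)
  have "\<m> \<beta> (\<m> (\<i> \<beta>) (\<i> \<alpha>)) = \<i> \<alpha>" using assms by simp
  then show "\<m> (\<m> \<alpha> \<beta>) (\<m> (\<i> \<beta>) (\<i> \<alpha>)) = \<r> (\<m> \<alpha> \<beta>)"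
    using assms by (simp add: arrow_assoc)
qed (use assms in auto)

end

section \<open>Topological properties that pass to open subgroupoids\<close>

locale continuous_groupoid = groupoid +
  assumes arrows_nonempty: "arrows G \<noteq> {}"
    and cont_mult: "continuous_map (subtopology (prod_topology (gtop G) (gtop G)) (composable G)) (gtop G)
             (\<lambda>(\<alpha>, \<beta>). gmult G \<alpha> \<beta>)"
    and cont_inv: "continuous_map (gtop G) (gtop G) (ginv G)"
    and Hausdorff_unit_space: "Hausdorff_space (unit_space G)"

sublocale topological_groupoid \<subseteq> continuous_groupoid
  using nonempty continuous_mult continuous_inv Hausdorff_units by unfold_locales

context continuous_groupoid
begin

lemma continuous_map_gmult:
  assumes "continuous_map X \<T> f" "continuous_map X \<T> g"
    "\<And>x. x \<in> topspace X \<Longrightarrow> (f x, g x) \<in> composable G"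
  shows "continuous_map X \<T> (\<lambda>x. \<m> (f x) (g x))"
proof -
  have "continuous_map X (subtopology (prod_topology \<T> \<T>) (composable G)) (\<lambda>x. (f x, g x))"
    using assms by (simp add: continuous_map_in_subtopology continuous_map_paired image_subset_iff)
  from continuous_map_compose[OF this cont_mult] show ?thesis by (simp add: comp_def)
qed

lemma continuous_map_rng: "continuous_map \<T> \<T> (\<r>)"
proof (rule continuous_map_eq)
  show "continuous_map \<T> \<T> (\<lambda>\<gamma>. \<m> \<gamma> (\<i> \<gamma>))"
    by (rule continuous_map_gmult) (auto simp: cont_inv composable_def arrows_def[symmetric])
qed (auto simp: arrows_def[symmetric])

lemma continuous_map_src: "continuous_map \<T> \<T> (\<s>)"
proof (rule continuous_map_eq)
  show "continuous_map \<T> \<T> (\<lambda>\<gamma>. \<m> (\<i> \<gamma>) \<gamma>)"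
    by (rule continuous_map_gmult) (auto simp: cont_inv composable_def arrows_def[symmetric])
qed (auto simp: arrows_def[symmetric])

lemma openin_subset_arrows: "openin \<T> W \<Longrightarrow> W \<subseteq> \<G>"
  unfolding arrows_def by (rule openin_subset)

lemma openin_rng_vimage: "openin \<T> W \<Longrightarrow> openin \<T> {\<gamma> \<in> \<G>. \<r> \<gamma> \<in> W}"
  unfolding arrows_def by (rule openin_continuous_map_preimage[OF continuous_map_rng])

lemma openin_src_vimage: "openin \<T> W \<Longrightarrow> openin \<T> {\<gamma> \<in> \<G>. \<s> \<gamma> \<in> W}"
  unfolding arrows_def by (rule openin_continuous_map_preimage[OF continuous_map_src])

lemma openin_inv_vimage: "openin \<T> W \<Longrightarrow> openin \<T> {\<gamma> \<in> \<G>. \<i> \<gamma> \<in> W}"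
  unfolding arrows_def by (rule openin_continuous_map_preimage[OF cont_inv])

lemma inv_image_eq: "W \<subseteq> \<G> \<Longrightarrow> \<i> ` W = {\<gamma> \<in> \<G>. \<i> \<gamma> \<in> W}"
  by (auto simp: image_iff) (metis inv_inv)

lemma openin_inv_image: "openin \<T> W \<Longrightarrow> openin \<T> (\<i> ` W)"
  using openin_inv_vimage inv_image_eq openin_subset_arrows by metis

lemma src_image_inv: "W \<subseteq> \<G> \<Longrightarrow> \<s> ` W = \<r> ` \<i> ` W"
  by (force simp: image_iff)

lemma topspace_unit_space [simp]: "topspace (unit_space G) = \<X>"
  using units_subset by (auto simp: unit_space_def arrows_def)

end

text \<open>The consequences of ampleness on which the later arguments rest. Injectivity can stand
  for a homeomorphism onto an open set, because range and source are continuous and open; in this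
  form the properties restrict directly to open subgroupoids.\<close>

locale bisection_groupoid = continuous_groupoid +
  assumes open_rng: "openin (gtop G) W \<Longrightarrow> openin (gtop G) (grng G ` W)"
    and bisection_basis: "openin (gtop G) W \<Longrightarrow> \<gamma> \<in> W \<Longrightarrow>
      \<exists>U. openin (gtop G) U \<and> compactin (gtop G) U \<and> \<gamma> \<in> U \<and> U \<subseteq> W \<and>
        inj_on (grng G) U \<and> inj_on (gsrc G) U"

section \<open>A basis of compact open bisections in an ample groupoid\<close>

context ample_groupoid
begin

lemma rng_injective_nhd:
  assumes "\<gamma> \<in> \<G>"
  obtains U where "openin \<T> U" "\<gamma> \<in> U"
    "homeomorphic_map (subtopology \<T> U) (subtopology (unit_space G) (\<r> ` U)) (\<r>)"
    "openin (unit_space G) (\<r> ` U)" "inj_on (\<r>) U"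
proof -
  obtain U where U: "openin \<T> U" "\<gamma> \<in> U" "homeo_onto_open_on \<T> (unit_space G) U (\<r>)"
    using etale assms unfolding local_homeomorphism_def arrows_def by blast
  have "topspace (subtopology \<T> U) = U"
    using openin_subset[OF U(1)] by auto
  then show ?thesis
    using U that homeomorphic_imp_injective_map
    unfolding homeo_onto_open_on_def embedding_map_def by metis
qed

text \<open>If the range map is injective on a neighbourhood \<open>U\<close> of a unit, then an
  arrow \<gamma> of \<open>U\<close> with \<open>\<r> \<gamma>\<close> also in \<open>U\<close>
  equals \<open>\<r> \<gamma>\<close>, as both have the same range.\<close>

lemma openin_units: "openin \<T> (\<X>)"
proof (subst openin_subopen, intro ballI)
  fix x assume x: "x \<in> \<X>"
  obtain U where U: "openin \<T> U" "x \<in> U" "inj_on (\<r>) U"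
    using rng_injective_nhd[of x] x by auto
  let ?T = "U \<inter> {\<gamma> \<in> \<G>. \<r> \<gamma> \<in> U}"
  have "openin \<T> ?T" using openin_rng_vimage U by blast
  moreover have "x \<in> ?T" using x U by auto
  moreover have "\<gamma> \<in> \<X>" if "\<gamma> \<in> ?T" for \<gamma>
  proof -
    have "\<r> \<gamma> = \<gamma>"
      using that inj_onD[OF U(3), of "\<r> \<gamma>" \<gamma>] by simp
    then show ?thesis using that rng_unit[of \<gamma>] by auto
  qed
  ultimately show "\<exists>T. openin \<T> T \<and> x \<in> T \<and> T \<subseteq> \<X>" by blast
qed

lemma openin_unit_space_iff: "openin (unit_space G) S \<longleftrightarrow> openin \<T> S \<and> S \<subseteq> \<X>"
  unfolding unit_space_def using openin_units by (simp add: openin_open_subtopology)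

lemma openin_rng_image:
  assumes "openin \<T> W"
  shows "openin \<T> (\<r> ` W)"
proof (subst openin_subopen, intro ballI)
  fix x assume "x \<in> \<r> ` W"
  then obtain \<gamma> where \<gamma>: "\<gamma> \<in> W" "x = \<r> \<gamma>" by blast
  obtain U where U: "openin \<T> U" "\<gamma> \<in> U"
    "homeomorphic_map (subtopology \<T> U) (subtopology (unit_space G) (\<r> ` U)) (\<r>)"
    "openin (unit_space G) (\<r> ` U)"
    using rng_injective_nhd[of \<gamma>] \<gamma> openin_subset_arrows[OF assms] by blast
  have "openin (subtopology \<T> U) (U \<inter> W)"
    using assms U(1) by (simp add: openin_open_subtopology openin_Int)
  then have "openin (subtopology (unit_space G) (\<r> ` U)) (\<r> ` (U \<inter> W))"
    using homeomorphic_imp_open_map[OF U(3)] unfolding open_map_def by blast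
  then have "openin \<T> (\<r> ` (U \<inter> W))"
    using U(4) openin_trans_full openin_unit_space_iff by blast
  then show "\<exists>T. openin \<T> T \<and> x \<in> T \<and> T \<subseteq> \<r> ` W"
    using \<gamma> U(2) by blast
qed

text \<open>Both maps are first made injective, the source map by inverting a neighbourhood of
  \<open>\<i> \<gamma>\<close>. Compactness is then imposed in the unit space: the part
  \<open>U'\<close> over a compact open set \<open>B\<close> is homeomorphic to \<open>B\<close>
  under the range map.\<close>

lemma compact_open_bisection_basis:
  assumes W: "openin \<T> W" "\<gamma> \<in> W"
  shows "\<exists>U. openin \<T> U \<and> compactin \<T> U \<and> \<gamma> \<in> U \<and> U \<subseteq> W \<and>
        inj_on (\<r>) U \<and> inj_on (\<s>) U"
proof -
  have \<gamma>: "\<gamma> \<in> \<G>" using W openin_subset_arrows by blast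
  obtain U where U: "openin \<T> U" "\<gamma> \<in> U"
    "homeomorphic_map (subtopology \<T> U) (subtopology (unit_space G) (\<r> ` U)) (\<r>)"
    "inj_on (\<r>) U"
    using rng_injective_nhd[of \<gamma>] \<gamma> by blast
  obtain V where V: "openin \<T> V" "\<i> \<gamma> \<in> V" "inj_on (\<r>) V"
    using rng_injective_nhd[of "\<i> \<gamma>"] \<gamma> by (metis inv_closed)
  define T where "T = U \<inter> \<i> ` V \<inter> W"
  have \<gamma>_T: "\<gamma> \<in> T" using U V W \<gamma> unfolding T_def by (metis IntI image_eqI inv_inv)
  have T: "openin \<T> T" using U V W openin_inv_image unfolding T_def by blast
  have V_arrows: "V \<subseteq> \<G>" using V openin_subset_arrows by blast
  have "inj_on (\<s>) (\<i> ` V)"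
    using V(3) V_arrows unfolding inj_on_def by (auto simp: subset_iff)
  then have inj_src: "inj_on (\<s>) T" unfolding T_def by (rule inj_on_subset) blast
  have "openin (unit_space G) (\<r> ` T)"
    using openin_rng_image[OF T] openin_unit_space_iff openin_subset_arrows[OF T] by auto
  then obtain B where B: "\<r> \<gamma> \<in> B" "openin (unit_space G) B" "compactin (unit_space G) B"
      "B \<subseteq> \<r> ` T"
    using units_compact_open_basis \<gamma>_T
    unfolding has_compact_open_basis_def compact_Hausdorff_in_def
    by (smt (verit, best) UnionE Union_upper image_eqI subset_eq)
  define U' where "U' = {\<gamma> \<in> T. \<r> \<gamma> \<in> B}"
  have rU': "\<r> ` U' = B" using B(4) unfolding U'_def by auto
  have "U' = T \<inter> {\<gamma> \<in> \<G>. \<r> \<gamma> \<in> B}"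
    using openin_subset_arrows[OF T] unfolding U'_def by auto
  then have "openin \<T> U'"
    using T openin_rng_vimage B(2) openin_unit_space_iff by auto
  moreover have "compactin \<T> U'"
  proof -
    have "U' \<subseteq> U" unfolding U'_def T_def by auto
    moreover have "compactin (subtopology (unit_space G) (\<r> ` U)) (\<r> ` U')"
      using rU' B(3) \<open>U' \<subseteq> U\<close> by (auto simp: compactin_subtopology)
    ultimately have "compactin (subtopology \<T> U) U'"
      using homeomorphic_map_compactness_eq[OF U(3)] openin_subset[OF U(1)] by auto
    then show ?thesis by (simp add: compactin_subtopology)
  qed
  moreover have "\<gamma> \<in> U'" "U' \<subseteq> W" using \<gamma>_T B(1) unfolding U'_def T_def by auto
  moreover have "inj_on (\<r>) U'" "inj_on (\<s>) U'"
    using U(4) inj_src unfolding U'_def T_def by (auto intro: inj_on_subset)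
  ultimately show ?thesis by blast
qed

end

sublocale ample_groupoid \<subseteq> bisection_groupoid
  using openin_rng_image compact_open_bisection_basis by unfold_locales

section \<open>The Hausdorff unit space and compact open bisections\<close>

context bisection_groupoid
begin

lemma open_src: "openin \<T> W \<Longrightarrow> openin \<T> (\<s> ` W)"
  using src_image_inv open_rng openin_inv_image openin_subset_arrows by metis

lemma open_units: "openin \<T> (\<X>)"
proof -
  have "openin \<T> (\<G>)" unfolding arrows_def by blast
  then show ?thesis using open_rng units_eq_rng_image by metis
qed

lemma open_unit_space_iff: "openin (unit_space G) S \<longleftrightarrow> openin \<T> S \<and> S \<subseteq> \<X>"
  unfolding unit_space_def using open_units by (simp add: openin_open_subtopology)

lemma compactin_unit_space_iff: "compactin (unit_space G) S \<longleftrightarrow> compactin \<T> S \<and> S \<subseteq> \<X>"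
  unfolding unit_space_def by (simp add: compactin_subtopology)

text \<open>Compact sets need not be closed among all arrows, but they are closed in the Hausdorff
  unit space.\<close>

lemma open_units_minus_compact:
  assumes "compactin \<T> C" "C \<subseteq> \<X>"
  shows "openin \<T> (\<X> - C)"
proof -
  have "closedin (unit_space G) C"
    using assms compactin_unit_space_iff Hausdorff_unit_space compactin_imp_closedin by blast
  then show ?thesis
    unfolding closedin_def by (simp add: open_unit_space_iff)
qed

lemma open_bisection_embedding:
  assumes U: "openin \<T> U" and f: "continuous_map \<T> \<T> f" "inj_on f U"
    "\<And>W. openin \<T> W \<Longrightarrow> openin \<T> (f ` W)" "f ` U \<subseteq> \<X>"
  shows "homeo_onto_open_on \<T> (unit_space G) U f"
  unfolding homeo_onto_open_on_def
proof
  have top: "topspace (subtopology \<T> U) = U" using openin_subset[OF U] by auto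
  show "embedding_map (subtopology \<T> U) (unit_space G) f"
  proof (rule injective_open_imp_embedding_map)
    show "continuous_map (subtopology \<T> U) (unit_space G) f"
      unfolding unit_space_def continuous_map_in_subtopology
      using f top by (auto simp: continuous_map_from_subtopology)
    show "open_map (subtopology \<T> U) (unit_space G) f"
      unfolding open_map_def using U f
      by (auto simp: openin_open_subtopology open_unit_space_iff)
    show "inj_on f (topspace (subtopology \<T> U))" using f(2) top by simp
  qed
  show "openin (unit_space G) (f ` U)" using U f by (simp add: open_unit_space_iff)
qed

text \<open>Open continuous injections are embeddings. The Hausdorff property comes for free, since
  \<open>U\<close> is homeomorphic to a subspace of the unit space.\<close>

lemma compact_open_bisections_iff:
  "U \<in> \<B> \<longleftrightarrow>
     openin \<T> U \<and> compactin \<T> U \<and> inj_on (\<r>) U \<and> inj_on (\<s>) U"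
  (is "?lhs \<longleftrightarrow> ?rhs")
proof
  assume ?lhs
  then have U: "openin \<T> U" "compactin \<T> U"
      "embedding_map (subtopology \<T> U) (unit_space G) (\<r>)"
      "embedding_map (subtopology \<T> U) (unit_space G) (\<s>)"
    by (auto simp: compact_open_bisections_def bisection_def compact_Hausdorff_in_def homeo_onto_open_on_def)
  have "topspace (subtopology \<T> U) = U" using openin_subset[OF U(1)] by auto
  then show ?rhs using U homeomorphic_imp_injective_map unfolding embedding_map_def by metis
next
  assume R: ?rhs
  then have U: "U \<subseteq> \<G>" using openin_subset_arrows by blast
  have rng: "homeo_onto_open_on \<T> (unit_space G) U (\<r>)"
    using R U by (intro open_bisection_embedding) (auto simp: continuous_map_rng open_rng)
  moreover have "homeo_onto_open_on \<T> (unit_space G) U (\<s>)"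
    using R U by (intro open_bisection_embedding) (auto simp: continuous_map_src open_src)
  moreover have "Hausdorff_space (subtopology \<T> U)"
    using rng Hausdorff_unit_space homeomorphic_Hausdorff_space embedding_map_imp_homeomorphic_space
      Hausdorff_space_subtopology unfolding homeo_onto_open_on_def by metis
  ultimately show ?lhs
    using R by (simp add: compact_open_bisections_def bisection_def compact_Hausdorff_in_def)
qed

end

section \<open>Inverses, products and finite unions of compact open bisections\<close>

definition product_set :: "'g top_groupoid \<Rightarrow> 'g set \<Rightarrow> 'g set \<Rightarrow> 'g set" where
  "product_set G U V = {gmult G \<alpha> \<beta> |\<alpha> \<beta>. \<alpha> \<in> U \<and> \<beta> \<in> V \<and> (\<alpha>, \<beta>) \<in> composable G}"

lemma (in groupoid) mem_product_set_iff:
  assumes "U \<subseteq> arrows G" "V \<subseteq> arrows G"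
  shows "\<gamma> \<in> product_set G U V \<longleftrightarrow>
    \<gamma> \<in> arrows G \<and> (\<exists>\<alpha>\<in>U. grng G \<alpha> = grng G \<gamma> \<and> gmult G (ginv G \<alpha>) \<gamma> \<in> V)"
proof
  assume "\<gamma> \<in> product_set G U V"
  then obtain \<alpha> \<beta> where "\<alpha> \<in> U" "\<beta> \<in> V" "gsrc G \<alpha> = grng G \<beta>" "\<gamma> = gmult G \<alpha> \<beta>"
    by (auto simp: product_set_def composable_def)
  moreover have "\<alpha> \<in> arrows G" "\<beta> \<in> arrows G" using calculation assms by auto
  ultimately show "\<gamma> \<in> arrows G \<and> (\<exists>\<alpha>\<in>U. grng G \<alpha> = grng G \<gamma> \<and> gmult G (ginv G \<alpha>) \<gamma> \<in> V)"
    by auto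
next
  assume R: "\<gamma> \<in> arrows G \<and> (\<exists>\<alpha>\<in>U. grng G \<alpha> = grng G \<gamma> \<and> gmult G (ginv G \<alpha>) \<gamma> \<in> V)"
  then obtain \<alpha> where \<alpha>: "\<alpha> \<in> U" "grng G \<alpha> = grng G \<gamma>" "gmult G (ginv G \<alpha>) \<gamma> \<in> V" by blast
  have "\<alpha> \<in> arrows G" using \<alpha> assms by auto
  then have "\<gamma> = gmult G \<alpha> (gmult G (ginv G \<alpha>) \<gamma>)" "(\<alpha>, gmult G (ginv G \<alpha>) \<gamma>) \<in> composable G"
    using \<alpha> R by (auto simp: composable_def)
  then show "\<gamma> \<in> product_set G U V" unfolding product_set_def using \<alpha> by blast
qed

context bisection_groupoid
begin

lemma bisections_basis:
  assumes "openin \<T> W" "\<gamma> \<in> W"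
  obtains U where "U \<in> \<B>" "\<gamma> \<in> U" "U \<subseteq> W"
  using bisection_basis[OF assms] compact_open_bisections_iff by blast

lemma bisectionsD:
  assumes "U \<in> \<B>"
  shows "openin \<T> U" "compactin \<T> U" "inj_on (\<r>) U" "inj_on (\<s>) U"
    "U \<subseteq> \<G>"
  using assms openin_subset_arrows unfolding compact_open_bisections_iff by auto

lemma bisections_Int_clopen:
  assumes "U \<in> \<B>" "openin \<T> D" "openin \<T> (\<G> - D)"
  shows "U \<inter> D \<in> \<B>"
proof -
  have "closedin \<T> D"
    using assms(2,3) openin_subset unfolding closedin_def arrows_def by blast
  then have "compactin \<T> (U \<inter> D)"
    using closed_Int_compactin[of "gtop G" D U] bisectionsD(2)[OF assms(1)] by (simp add: Int_commute)
  then show ?thesis using assms(2) bisectionsD[OF assms(1)]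
    by (auto simp: compact_open_bisections_iff intro: inj_on_subset)
qed

lemma bisections_units:
  assumes "openin \<T> N" "compactin \<T> N" "N \<subseteq> \<X>"
  shows "N \<in> \<B>"
  using assms unitsD(2,3) unfolding compact_open_bisections_iff inj_on_def
  by (simp add: subset_iff)

lemma bisections_rng:
  assumes "U \<in> \<B>"
  shows "\<r> ` U \<in> \<B>" "\<r> ` U \<subseteq> \<X>"
proof -
  show 1: "\<r> ` U \<subseteq> \<X>" using bisectionsD(5)[OF assms] by auto
  show "\<r> ` U \<in> \<B>"
    using bisectionsD[OF assms] open_rng image_compactin[OF _ continuous_map_rng] 1
    by (intro bisections_units) auto
qed

lemma bisections_src:
  assumes "U \<in> \<B>"
  shows "\<s> ` U \<in> \<B>" "\<s> ` U \<subseteq> \<X>"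
proof -
  show 1: "\<s> ` U \<subseteq> \<X>" using bisectionsD(5)[OF assms] by auto
  show "\<s> ` U \<in> \<B>"
    using bisectionsD[OF assms] open_src image_compactin[OF _ continuous_map_src] 1
    by (intro bisections_units) auto
qed

lemma bisections_inv:
  assumes "U \<in> \<B>"
  shows "\<i> ` U \<in> \<B>"
proof -
  note U = bisectionsD[OF assms]
  have "inj_on (\<r>) (\<i> ` U)" "inj_on (\<s>) (\<i> ` U)"
    using U(3-5) by (auto simp: inj_on_def subset_iff)
  then show ?thesis
    using U openin_inv_image image_compactin[OF _ cont_inv]
    by (auto simp: compact_open_bisections_iff)
qed

text \<open>This may fail for compact sets of arrows in a groupoid that is not Hausdorff; among
  units one of the two sets is closed.\<close>

lemma compact_Int_units:
  assumes "compactin \<T> C" "C \<subseteq> \<X>" "compactin \<T> D" "D \<subseteq> \<X>"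
  shows "compactin \<T> (C \<inter> D)"
proof -
  have "closedin (unit_space G) C"
    using assms compactin_unit_space_iff Hausdorff_unit_space compactin_imp_closedin by blast
  then show ?thesis
    using closed_Int_compactin[of "unit_space G" C D] assms compactin_unit_space_iff by blast
qed

lemma continuous_map_section:
  assumes U: "openin \<T> U" "inj_on f U"
    and f: "\<And>W. openin \<T> W \<Longrightarrow> openin \<T> (f ` W)"
  shows "continuous_map (subtopology \<T> (f ` U)) \<T> (the_inv_into U f)"
proof -
  have top: "topspace (subtopology \<T> (f ` U)) = f ` U"
    using openin_subset[OF f[OF U(1)]] by auto
  have U': "U \<subseteq> topspace \<T>" using openin_subset[OF U(1)] .
  show ?thesis
    unfolding continuous_map_def top
  proof (intro conjI allI impI)
    show "the_inv_into U f \<in> f ` U \<rightarrow> topspace \<T>"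
      using U U' the_inv_into_into[OF U(2)] by blast
    fix W assume W: "openin \<T> W"
    have "{x \<in> f ` U. the_inv_into U f x \<in> W} = f ` (U \<inter> W)"
      using U(2) by (auto simp: the_inv_into_f_f)
    moreover have "openin \<T> (f ` (U \<inter> W))" "openin \<T> (f ` U)"
      using W U(1) f by (blast intro: openin_Int)+
    ultimately show "openin (subtopology \<T> (f ` U)) {x \<in> f ` U. the_inv_into U f x \<in> W}"
      by (simp add: openin_open_subtopology image_mono)
  qed
qed

text \<open>With \<rho> inverse to the range map on \<open>U\<close>, the product consists of the
  \<gamma> over the range of \<open>U\<close> for which
  \<open>\<m> (\<i> (\<rho> (\<r> \<gamma>))) \<gamma>\<close> lies in \<open>V\<close>, which is an
  open condition. It is compact as a continuous image of the compact set \<open>W\<close> of units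
  at which sources of \<open>U\<close> meet ranges of \<open>V\<close>.\<close>

lemma bisections_mult:
  assumes UV: "U \<in> \<B>" "V \<in> \<B>"
  shows "product_set G U V \<in> \<B>"
proof -
  note U = bisectionsD[OF UV(1)] and V = bisectionsD[OF UV(2)]
  have mem: "\<gamma> \<in> product_set G U V \<longleftrightarrow>
    \<gamma> \<in> \<G> \<and> (\<exists>\<alpha>\<in>U. \<r> \<alpha> = \<r> \<gamma> \<and> \<m> (\<i> \<alpha>) \<gamma> \<in> V)" for \<gamma>
    using mem_product_set_iff U V by blast
  have mem': "\<gamma> \<in> product_set G U V \<longleftrightarrow> (\<exists>\<alpha>\<in>U. \<exists>\<beta>\<in>V. \<s> \<alpha> = \<r> \<beta> \<and> \<gamma> = \<m> \<alpha> \<beta>)" for \<gamma>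
    using U(5) V(5) unfolding product_set_def composable_def by blast
  define \<rho> where "\<rho> = the_inv_into U (\<r>)"
  define D where "D = {\<gamma> \<in> \<G>. \<r> \<gamma> \<in> \<r> ` U}"
  have D: "openin \<T> D" unfolding D_def using U(1) openin_rng_vimage open_rng by blast
  have topD: "topspace (subtopology \<T> D) = D" using openin_subset[OF D] by auto
  have \<rho>: "\<rho> (\<r> \<alpha>) = \<alpha>" if "\<alpha> \<in> U" for \<alpha>
    unfolding \<rho>_def using the_inv_into_f_f[OF U(3)] that by blast
  have cont_\<rho>: "continuous_map (subtopology \<T> D) \<T> (\<lambda>\<gamma>. \<rho> (\<r> \<gamma>))"
  proof -
    have "continuous_map (subtopology \<T> D) (subtopology \<T> (\<r> ` U)) (\<r>)"
      unfolding continuous_map_in_subtopology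
      using continuous_map_rng continuous_map_from_subtopology topD by (auto simp: D_def)
    from continuous_map_compose[OF this continuous_map_section[OF U(1,3) open_rng]]
    show ?thesis unfolding \<rho>_def comp_def .
  qed
  have \<rho>D: "\<rho> (\<r> \<gamma>) \<in> U \<and> \<r> (\<rho> (\<r> \<gamma>)) = \<r> \<gamma>" if "\<gamma> \<in> D" for \<gamma>
    using that \<rho> unfolding D_def by auto
  have cont: "continuous_map (subtopology \<T> D) \<T> (\<lambda>\<gamma>. \<m> (\<i> (\<rho> (\<r> \<gamma>))) \<gamma>)"
  proof (rule continuous_map_gmult)
    show "continuous_map (subtopology \<T> D) \<T> (\<lambda>\<gamma>. \<i> (\<rho> (\<r> \<gamma>)))"
      using continuous_map_compose[OF cont_\<rho> cont_inv] unfolding comp_def .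
    show "continuous_map (subtopology \<T> D) \<T> (\<lambda>\<gamma>. \<gamma>)"
      by (rule continuous_map_from_subtopology) simp
    show "(\<i> (\<rho> (\<r> \<gamma>)), \<gamma>) \<in> composable G" if "\<gamma> \<in> topspace (subtopology \<T> D)" for \<gamma>
    proof -
      have "\<gamma> \<in> D" using that topD by simp
      then show ?thesis using \<rho>D[of \<gamma>] U(5) D_def unfolding composable_def by auto
    qed
  qed
  have "product_set G U V = {\<gamma> \<in> D. \<m> (\<i> (\<rho> (\<r> \<gamma>))) \<gamma> \<in> V}"
  proof (intro Set.set_eqI iffI)
    fix \<gamma> assume "\<gamma> \<in> product_set G U V"
    then obtain \<alpha> where \<alpha>: "\<gamma> \<in> \<G>" "\<alpha> \<in> U" "\<r> \<alpha> = \<r> \<gamma>" "\<m> (\<i> \<alpha>) \<gamma> \<in> V"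
      using mem by blast
    then have "\<rho> (\<r> \<gamma>) = \<alpha>" "\<r> \<gamma> \<in> \<r> ` U" using \<rho>[of \<alpha>] by (auto simp flip: \<alpha>(3))
    then show "\<gamma> \<in> {\<gamma> \<in> D. \<m> (\<i> (\<rho> (\<r> \<gamma>))) \<gamma> \<in> V}"
      using \<alpha> unfolding D_def by simp
  next
    fix \<gamma> assume "\<gamma> \<in> {\<gamma> \<in> D. \<m> (\<i> (\<rho> (\<r> \<gamma>))) \<gamma> \<in> V}"
    then show "\<gamma> \<in> product_set G U V" using \<rho>D[of \<gamma>] mem D_def by auto
  qed
  then have "openin (subtopology \<T> D) (product_set G U V)"
    using openin_continuous_map_preimage[OF cont V(1)] unfolding topD by simp
  then have open_UV: "openin \<T> (product_set G U V)"
    using D by (simp add: openin_open_subtopology)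
  define W where "W = \<s> ` U \<inter> \<r> ` V"
  have W_comp: "compactin \<T> W" unfolding W_def
    using compact_Int_units bisectionsD(2) bisections_rng[OF UV(2)] bisections_src[OF UV(1)] by blast
  define \<sigma> where "\<sigma> = the_inv_into U (\<s>)"
  define \<tau> where "\<tau> = the_inv_into V (\<r>)"
  have W_top: "topspace (subtopology \<T> W) = W" using compactin_subset_topspace[OF W_comp] by auto
  have \<sigma>: "\<sigma> (\<s> \<alpha>) = \<alpha>" if "\<alpha> \<in> U" for \<alpha>
    unfolding \<sigma>_def using the_inv_into_f_f[OF U(4)] that by blast
  have \<tau>: "\<tau> (\<r> \<alpha>) = \<alpha>" if "\<alpha> \<in> V" for \<alpha>
    unfolding \<tau>_def using the_inv_into_f_f[OF V(3)] that by blast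
  have "continuous_map (subtopology \<T> W) \<T> (\<lambda>x. \<m> (\<sigma> x) (\<tau> x))"
  proof (rule continuous_map_gmult)
    show "continuous_map (subtopology \<T> W) \<T> \<sigma>"
      using continuous_map_from_subtopology_mono[OF continuous_map_section[OF U(1,4) open_src]]
      unfolding \<sigma>_def W_def by blast
    show "continuous_map (subtopology \<T> W) \<T> \<tau>"
      using continuous_map_from_subtopology_mono[OF continuous_map_section[OF V(1,3) open_rng]]
      unfolding \<tau>_def W_def by blast
    show "(\<sigma> x, \<tau> x) \<in> composable G" if "x \<in> topspace (subtopology \<T> W)" for x
    proof -
      have "x \<in> W" using that W_top by simp
      then obtain \<alpha> \<beta> where "\<alpha> \<in> U" "x = \<s> \<alpha>" "\<beta> \<in> V" "x = \<r> \<beta>" unfolding W_def by auto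
      then show ?thesis using \<sigma>[of \<alpha>] \<tau>[of \<beta>] U(5) V(5) unfolding composable_def by auto
    qed
  qed
  moreover have "(\<lambda>x. \<m> (\<sigma> x) (\<tau> x)) ` W = product_set G U V"
  proof (intro Set.set_eqI iffI)
    fix \<gamma> assume "\<gamma> \<in> (\<lambda>x. \<m> (\<sigma> x) (\<tau> x)) ` W"
    then obtain \<alpha> \<beta> where *: "\<alpha> \<in> U" "\<beta> \<in> V" "\<s> \<alpha> = \<r> \<beta>"
      "\<gamma> = \<m> (\<sigma> (\<s> \<alpha>)) (\<tau> (\<s> \<alpha>))"
      unfolding W_def by auto
    have "\<gamma> = \<m> \<alpha> \<beta>" using *(4) \<sigma>[OF *(1)] \<tau>[OF *(2)] *(3) by simp
    then show "\<gamma> \<in> product_set G U V" using mem' * by blast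
  next
    fix \<gamma> assume "\<gamma> \<in> product_set G U V"
    then obtain \<alpha> \<beta> where *: "\<alpha> \<in> U" "\<beta> \<in> V" "\<s> \<alpha> = \<r> \<beta>" "\<gamma> = \<m> \<alpha> \<beta>"
      using mem' by blast
    have "\<s> \<alpha> \<in> W" unfolding W_def using imageI[OF *(1)] imageI[OF *(2)] *(3) by (metis IntI)
    moreover have "\<gamma> = \<m> (\<sigma> (\<s> \<alpha>)) (\<tau> (\<s> \<alpha>))"
      using * \<sigma>[OF *(1)] \<tau>[OF *(2)] by simp
    ultimately show "\<gamma> \<in> (\<lambda>x. \<m> (\<sigma> x) (\<tau> x)) ` W" by blast
  qed
  ultimately have comp_UV: "compactin \<T> (product_set G U V)"
    using image_compactin[of "subtopology \<T> W" W] W_comp by (metis compactin_subtopology order_refl)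
  have arr: "\<alpha> \<in> \<G>" if "\<alpha> \<in> U \<or> \<alpha> \<in> V" for \<alpha> using that U(5) V(5) by blast
  have eq: "\<alpha> = \<alpha>' \<and> \<beta> = \<beta>'"
    if "\<alpha> \<in> U" "\<beta> \<in> V" "\<s> \<alpha> = \<r> \<beta>" "\<alpha>' \<in> U" "\<beta>' \<in> V" "\<s> \<alpha>' = \<r> \<beta>'"
      "\<r> \<alpha> = \<r> \<alpha>' \<or> \<s> \<beta> = \<s> \<beta>'" for \<alpha> \<beta> \<alpha>' \<beta>'
  proof (cases "\<r> \<alpha> = \<r> \<alpha>'")
    case True
    then have "\<alpha> = \<alpha>'" using inj_onD[OF U(3)] that(1,4) by blast
    then show ?thesis using inj_onD[OF V(3), of \<beta> \<beta>'] that by simp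
  next
    case False
    then have "\<beta> = \<beta>'" using inj_onD[OF V(4)] that(2,5,7) by blast
    then show ?thesis using inj_onD[OF U(4), of \<alpha> \<alpha>'] that by simp
  qed
  have "\<gamma> = \<delta>" if \<gamma>\<delta>: "\<gamma> \<in> product_set G U V" "\<delta> \<in> product_set G U V"
    "\<r> \<gamma> = \<r> \<delta> \<or> \<s> \<gamma> = \<s> \<delta>" for \<gamma> \<delta>
  proof -
    obtain \<alpha> \<beta> where *: "\<alpha> \<in> U" "\<beta> \<in> V" "\<s> \<alpha> = \<r> \<beta>" "\<gamma> = \<m> \<alpha> \<beta>"
      using \<gamma>\<delta>(1) mem' by blast
    obtain \<alpha>' \<beta>' where **: "\<alpha>' \<in> U" "\<beta>' \<in> V" "\<s> \<alpha>' = \<r> \<beta>'" "\<delta> = \<m> \<alpha>' \<beta>'"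
      using \<gamma>\<delta>(2) mem' by blast
    have a: "\<alpha> \<in> \<G>" "\<beta> \<in> \<G>" "\<alpha>' \<in> \<G>" "\<beta>' \<in> \<G>" using * ** arr by blast+
    have "\<r> \<alpha> = \<r> \<alpha>' \<or> \<s> \<beta> = \<s> \<beta>'"
      using \<gamma>\<delta>(3) a *(3) **(3) unfolding *(4) **(4) by simp
    then show ?thesis using eq[OF *(1-3) **(1-3)] *(4) **(4) by simp
  qed
  then have "inj_on (\<r>) (product_set G U V)" "inj_on (\<s>) (product_set G U V)"
    unfolding inj_on_def by blast+
  then show ?thesis using open_UV comp_UV by (simp add: compact_open_bisections_iff)
qed

lemma compact_cover_bisections:
  assumes "compactin \<T> C"
  obtains \<U> where "finite \<U>" "\<U> \<subseteq> \<B>" "C \<subseteq> \<Union>\<U>"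
proof -
  have "\<forall>U\<in>\<B>. openin \<T> U" using bisectionsD by blast
  moreover have "C \<subseteq> \<Union>(\<B>)"
  proof
    fix \<gamma> assume "\<gamma> \<in> C"
    then have "\<gamma> \<in> topspace \<T>" using compactin_subset_topspace[OF assms] by blast
    then show "\<gamma> \<in> \<Union>(\<B>)" using bisections_basis[OF openin_topspace] by blast
  qed
  ultimately obtain \<U> where "finite \<U>" "\<U> \<subseteq> \<B>" "C \<subseteq> \<Union>\<U>"
    using assms unfolding compactin_def by meson
  then show ?thesis using that by blast
qed

lemma compact_Union_bisections:
  assumes "finite \<U>" "\<U> \<subseteq> \<B>"
  shows "compactin \<T> (\<Union>\<U>)" "openin \<T> (\<Union>\<U>)"
proof -
  show "compactin \<T> (\<Union>\<U>)"
    using assms(2) bisectionsD(2) by (intro compactin_Union[OF assms(1)]) blast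
  show "openin \<T> (\<Union>\<U>)" using assms(2) bisectionsD(1) by (intro openin_Union) blast
qed

end

section \<open>Open subgroupoids\<close>

lemma restrict_groupoid_simps [simp]:
  "gtop (restrict_groupoid G S) = subtopology (gtop G) S"
  "gsrc (restrict_groupoid G S) = gsrc G" "grng (restrict_groupoid G S) = grng G"
  "gmult (restrict_groupoid G S) = gmult G" "ginv (restrict_groupoid G S) = ginv G"
  by (simp_all add: restrict_groupoid_def)

locale open_subgroupoid = bisection_groupoid +
  fixes S
  assumes subgroupoid: "subgroupoid S G" and open_S: "openin (gtop G) S"
begin

abbreviation "K \<equiv> restrict_groupoid G S"

lemma sub_arrow [simp]: "\<alpha> \<in> S \<Longrightarrow> \<alpha> \<in> \<G>"
  and sub_inv [simp]: "\<alpha> \<in> S \<Longrightarrow> \<i> \<alpha> \<in> S"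
  and sub_mult [simp]: "\<alpha> \<in> S \<Longrightarrow> \<beta> \<in> S \<Longrightarrow> \<s> \<alpha> = \<r> \<beta> \<Longrightarrow> \<m> \<alpha> \<beta> \<in> S"
  using subgroupoid unfolding subgroupoid_def composable_def by blast+

lemma sub_rng [simp]: "\<alpha> \<in> S \<Longrightarrow> \<r> \<alpha> \<in> S"
  using sub_mult[of \<alpha> "\<i> \<alpha>"] by simp

lemma sub_src [simp]: "\<alpha> \<in> S \<Longrightarrow> \<s> \<alpha> \<in> S"
  using sub_mult[of "\<i> \<alpha>" \<alpha>] by simp

lemma arrows_K [simp]: "arrows K = S"
  using openin_subset_arrows[OF open_S] by (auto simp: arrows_def)

lemma gunits_K: "gunits K = \<X> \<inter> S"
  using sub_arrow unfolding gunits_def by auto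

lemma composable_K: "composable K = composable G \<inter> S \<times> S"
  using sub_arrow unfolding composable_def by auto

lemma openin_K: "openin (gtop K) U \<longleftrightarrow> openin \<T> U \<and> U \<subseteq> S"
  using open_S by (simp add: openin_open_subtopology)

lemma compactin_K: "compactin (gtop K) U \<longleftrightarrow> compactin \<T> U \<and> U \<subseteq> S"
  by (simp add: compactin_subtopology)

lemma groupoid_K: "groupoid K"
proof
  fix \<alpha> \<beta> \<gamma> assume "(\<alpha>, \<beta>) \<in> composable K" "(\<beta>, \<gamma>) \<in> composable K"
  then show "gmult K (gmult K \<alpha> \<beta>) \<gamma> = gmult K \<alpha> (gmult K \<beta> \<gamma>)"
    using mult_assoc by (auto simp: composable_K)
qed (auto simp: composable_K composable_def)

lemma bisection_groupoid_K: "bisection_groupoid K"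
proof -
  interpret K: groupoid K by (rule groupoid_K)
  have unit_space_K: "unit_space K = subtopology (unit_space G) S"
    unfolding unit_space_def gunits_K by (simp add: subtopology_subtopology Int_ac)
  show ?thesis
  proof
    show "arrows K \<noteq> {}" using subgroupoid by (auto simp: subgroupoid_def)
    have top: "subtopology (prod_topology (gtop K) (gtop K)) (composable K)
      = subtopology (subtopology (prod_topology \<T> \<T>) (composable G)) (S \<times> S)"
      by (simp add: composable_K subtopology_Times[symmetric] subtopology_subtopology Int_ac)
    show "continuous_map (subtopology (prod_topology (gtop K) (gtop K)) (composable K)) (gtop K)
        (\<lambda>(\<alpha>, \<beta>). gmult K \<alpha> \<beta>)"
      unfolding top
      unfolding restrict_groupoid_simps continuous_map_in_subtopology
    proof
      show "continuous_map (subtopology (subtopology (prod_topology \<T> \<T>) (composable G)) (S \<times> S))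
          \<T> (\<lambda>(\<alpha>, \<beta>). \<m> \<alpha> \<beta>)"
        by (rule continuous_map_from_subtopology[OF cont_mult])
    qed (auto simp: topspace_subtopology composable_def)
    show "continuous_map (gtop K) (gtop K) (ginv K)"
      using cont_inv by (auto simp: continuous_map_in_subtopology intro!: continuous_map_from_subtopology)
    show "Hausdorff_space (unit_space K)"
      unfolding unit_space_K using Hausdorff_unit_space Hausdorff_space_subtopology by blast
  next
    fix W assume "openin (gtop K) W"
    then show "openin (gtop K) (grng K ` W)"
      unfolding openin_K using open_rng by auto
  next
    fix W \<gamma> assume "openin (gtop K) W" "\<gamma> \<in> W"
    then show "\<exists>U. openin (gtop K) U \<and> compactin (gtop K) U \<and> \<gamma> \<in> U \<and> U \<subseteq> W \<and>
        inj_on (grng K) U \<and> inj_on (gsrc K) U"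
      unfolding openin_K compactin_K using bisection_basis[of W \<gamma>] by auto
  qed
qed

lemma compact_open_bisections_K:
  "compact_open_bisections K = {U \<in> \<B>. U \<subseteq> S}"
  using bisection_groupoid.compact_open_bisections_iff[OF bisection_groupoid_K]
  by (auto simp: compact_open_bisections_iff openin_K compactin_K simp del: restrict_groupoid_simps(1))

end

section \<open>Convolution\<close>

lemma left_span_zero: "0 \<in> left_span B"
  unfolding left_span_def by (intro CollectI exI[of _ "{}"]) auto

lemma left_span_add:
  assumes "f \<in> left_span B" "g \<in> left_span B"
  shows "f + g \<in> left_span B"
proof -
  obtain F a where F: "f = (\<lambda>\<gamma>. \<Sum>b\<in>F. a b * b \<gamma>)" "finite F" "F \<subseteq> B"
    using assms(1) unfolding left_span_def by blast
  obtain E c where E: "g = (\<lambda>\<gamma>. \<Sum>b\<in>E. c b * b \<gamma>)" "finite E" "E \<subseteq> B"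
    using assms(2) unfolding left_span_def by blast
  define d where "d b = (if b \<in> F then a b else 0) + (if b \<in> E then c b else 0)" for b
  have "(f + g) \<gamma> = (\<Sum>b\<in>F \<union> E. d b * b \<gamma>)" for \<gamma>
  proof -
    have "f \<gamma> = (\<Sum>b\<in>F \<union> E. (if b \<in> F then a b else 0) * b \<gamma>)"
      unfolding F(1) using F(2) E(2) by (intro sum.mono_neutral_cong_left) auto
    moreover have "g \<gamma> = (\<Sum>b\<in>F \<union> E. (if b \<in> E then c b else 0) * b \<gamma>)"
      unfolding E(1) using F(2) E(2) by (intro sum.mono_neutral_cong_left) auto
    ultimately show ?thesis by (simp add: d_def distrib_right sum.distrib)
  qed
  then show ?thesis using F E unfolding left_span_def by blast
qed

lemma left_span_scale:
  assumes "f \<in> left_span B"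
  shows "(\<lambda>\<gamma>. r * f \<gamma>) \<in> left_span B"
proof -
  obtain F a where F: "f = (\<lambda>\<gamma>. \<Sum>b\<in>F. a b * b \<gamma>)" "finite F" "F \<subseteq> B"
    using assms(1) unfolding left_span_def by blast
  have "(\<lambda>\<gamma>. r * f \<gamma>) = (\<lambda>\<gamma>. \<Sum>b\<in>F. (r * a b) * b \<gamma>)"
    unfolding F(1) by (simp add: sum_distrib_left mult.assoc)
  then show ?thesis using F unfolding left_span_def by (intro CollectI exI[of _ F] exI[of _ "\<lambda>b. r * a b"]) auto
qed

lemma left_span_base: "b \<in> B \<Longrightarrow> b \<in> left_span B"
  unfolding left_span_def by (intro CollectI exI[of _ "{b}"] exI[of _ "\<lambda>_. 1"]) auto

lemma left_span_diff:
  assumes "f \<in> left_span B" "g \<in> left_span B"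
  shows "f - g \<in> left_span B"
proof -
  have "f - g = f + (\<lambda>\<gamma>. - 1 * g \<gamma>)" by auto
  then show ?thesis using left_span_add[OF assms(1) left_span_scale[OF assms(2), of "- 1"]] by (simp only:)
qed

lemma left_span_mono: "B \<subseteq> C \<Longrightarrow> left_span B \<subseteq> left_span C"
  unfolding left_span_def by blast

lemma left_span_induct [consumes 1, case_names zero add]:
  assumes "f \<in> left_span B" "P 0"
    and add: "\<And>r b f. b \<in> B \<Longrightarrow> f \<in> left_span B \<Longrightarrow> P f \<Longrightarrow> P ((\<lambda>\<gamma>. r * b \<gamma>) + f)"
  shows "P f"
proof -
  obtain F a where F: "f = (\<lambda>\<gamma>. \<Sum>b\<in>F. a b * b \<gamma>)" "finite F" "F \<subseteq> B"
    using assms(1) unfolding left_span_def by blast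
  have "P (\<lambda>\<gamma>. \<Sum>b\<in>F. a b * b \<gamma>)"
    using F(2,3)
  proof (induction F)
    case empty
    have "(\<lambda>\<gamma>. \<Sum>b\<in>{}. a b * b \<gamma>) = 0" by auto
    then show ?case using assms(2) by simp
  next
    case (insert c F)
    have "(\<lambda>\<gamma>. \<Sum>b\<in>insert c F. a b * b \<gamma>) = (\<lambda>\<gamma>. a c * c \<gamma>) + (\<lambda>\<gamma>. \<Sum>b\<in>F. a b * b \<gamma>)"
      using insert by auto
    moreover have "(\<lambda>\<gamma>. \<Sum>b\<in>F. a b * b \<gamma>) \<in> left_span B"
      using insert unfolding left_span_def by blast
    ultimately show ?case using add[of c _ "a c"] insert by simp
  qed
  then show ?thesis using F by simp
qed

abbreviation span_of :: "'g set set \<Rightarrow> ('g \<Rightarrow> 'r::ring_1) set" where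
  "span_of \<C> \<equiv> left_span (indicator ` \<C>)"

text \<open>Finiteness of the left factor on range fibres makes every convolution sum finite,
  whatever the right factor is. This admits right factors such as the constant function 1, which in
  general lies outside the algebra.\<close>

definition fibre_finite :: "'g top_groupoid \<Rightarrow> ('g \<Rightarrow> 'r::zero) \<Rightarrow> bool" where
  "fibre_finite G f \<longleftrightarrow> (\<forall>\<gamma>. f \<gamma> \<noteq> 0 \<longrightarrow> \<gamma> \<in> arrows G) \<and>
     (\<forall>y. finite {\<gamma>. f \<gamma> \<noteq> 0 \<and> grng G \<gamma> = y})"

lemma fibre_finiteD:
  assumes "fibre_finite G f"
  shows "f \<gamma> \<noteq> 0 \<Longrightarrow> \<gamma> \<in> arrows G" "finite {\<gamma>. f \<gamma> \<noteq> 0 \<and> grng G \<gamma> = y}"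
  using assms unfolding fibre_finite_def by auto

lemma fibre_finite_add:
  fixes f g :: "'g \<Rightarrow> 'r::group_add"
  assumes "fibre_finite G f" "fibre_finite G g"
  shows "fibre_finite G (f + g)"
  unfolding fibre_finite_def
proof (intro conjI allI impI)
  show "\<gamma> \<in> arrows G" if "(f + g) \<gamma> \<noteq> 0" for \<gamma>
    using that fibre_finiteD(1)[OF assms(1), of \<gamma>] fibre_finiteD(1)[OF assms(2), of \<gamma>] by force
  show "finite {\<gamma>. (f + g) \<gamma> \<noteq> 0 \<and> grng G \<gamma> = y}" for y
    by (rule finite_subset[of _ "{\<gamma>. f \<gamma> \<noteq> 0 \<and> grng G \<gamma> = y} \<union> {\<gamma>. g \<gamma> \<noteq> 0 \<and> grng G \<gamma> = y}"])
      (use fibre_finiteD(2)[OF assms(1)] fibre_finiteD(2)[OF assms(2)] in auto)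
qed

lemma fibre_finite_support_mono:
  assumes "fibre_finite G f" "\<And>\<gamma>. g \<gamma> \<noteq> 0 \<Longrightarrow> f \<gamma> \<noteq> 0"
  shows "fibre_finite G g"
  unfolding fibre_finite_def
proof (intro conjI allI impI)
  show "\<gamma> \<in> arrows G" if "g \<gamma> \<noteq> 0" for \<gamma>
    by (rule fibre_finiteD(1)[OF assms(1) assms(2)[OF that]])
  show "finite {\<gamma>. g \<gamma> \<noteq> 0 \<and> grng G \<gamma> = y}" for y
    by (rule finite_subset[OF _ fibre_finiteD(2)[OF assms(1), of y]]) (blast dest: assms(2))
qed

lemma fibre_finite_diff:
  fixes f g :: "'g \<Rightarrow> 'r::ab_group_add"
  assumes "fibre_finite G f" "fibre_finite G g"
  shows "fibre_finite G (f - g)"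
  using fibre_finite_add[OF assms(1), of "- g"] fibre_finite_support_mono[OF assms(2), of "- g"] by simp

section \<open>Algebraic laws of convolution for fibre-finite functions\<close>

context groupoid
begin

lemma convolution_outside: "\<gamma> \<notin> \<G> \<Longrightarrow> conv f g \<gamma> = 0"
  unfolding convolution_def by (rule sum.neutral) (auto simp: composable_def)

text \<open>In a factorisation of \<gamma> the first factor determines the second, so the sum may
  run over first factors. The freedom in \<open>A\<close> allows several convolutions to be compared
  over a common index set.\<close>

lemma convolution_eq:
  fixes f g :: "'g \<Rightarrow> 'r::ring_1"
  assumes "\<gamma> \<in> \<G>" "finite A" "\<And>\<alpha>. \<alpha> \<in> A \<Longrightarrow> \<alpha> \<in> \<G> \<and> \<r> \<alpha> = \<r> \<gamma>"
    and supp: "\<And>\<alpha>. \<alpha> \<in> \<G> \<Longrightarrow> f \<alpha> \<noteq> 0 \<Longrightarrow> \<r> \<alpha> = \<r> \<gamma> \<Longrightarrow>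
      g (\<m> (\<i> \<alpha>) \<gamma>) \<noteq> 0 \<Longrightarrow> \<alpha> \<in> A"
  shows "conv f g \<gamma> = (\<Sum>\<alpha>\<in>A. f \<alpha> * g (\<m> (\<i> \<alpha>) \<gamma>))"
proof -
  define A' where "A' = {\<alpha> \<in> A. f \<alpha> \<noteq> 0 \<and> g (\<m> (\<i> \<alpha>) \<gamma>) \<noteq> 0}"
  let ?p = "\<lambda>\<alpha>. (\<alpha>, \<m> (\<i> \<alpha>) \<gamma>)"
  have "{(\<alpha>, \<beta>) \<in> composable G. \<m> \<alpha> \<beta> = \<gamma> \<and> f \<alpha> \<noteq> 0 \<and> g \<beta> \<noteq> 0} = ?p ` A'"
  proof (intro Set.set_eqI iffI)
    fix p assume "p \<in> {(\<alpha>, \<beta>) \<in> composable G. \<m> \<alpha> \<beta> = \<gamma> \<and> f \<alpha> \<noteq> 0 \<and> g \<beta> \<noteq> 0}"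
    then obtain \<alpha> \<beta> where p: "p = (\<alpha>, \<beta>)" "\<alpha> \<in> \<G>" "\<beta> \<in> \<G>" "\<s> \<alpha> = \<r> \<beta>"
      "\<m> \<alpha> \<beta> = \<gamma>" "f \<alpha> \<noteq> 0" "g \<beta> \<noteq> 0"
      by (auto simp: composable_def)
    then have "\<beta> = \<m> (\<i> \<alpha>) \<gamma>" "\<r> \<alpha> = \<r> \<gamma>" by auto
    then have "p = ?p \<alpha>" "\<alpha> \<in> A'" using p supp unfolding A'_def by auto
    then show "p \<in> ?p ` A'" by blast
  next
    fix p assume "p \<in> ?p ` A'"
    then obtain \<alpha> where \<alpha>: "\<alpha> \<in> A'" "p = ?p \<alpha>" by blast
    then have "\<alpha> \<in> \<G>" "\<r> \<alpha> = \<r> \<gamma>" using assms(3) unfolding A'_def by auto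
    then show "p \<in> {(\<alpha>, \<beta>) \<in> composable G. \<m> \<alpha> \<beta> = \<gamma> \<and> f \<alpha> \<noteq> 0 \<and> g \<beta> \<noteq> 0}"
      using \<alpha> assms(1) unfolding A'_def composable_def by auto
  qed
  then have "conv f g \<gamma> = (\<Sum>(\<alpha>, \<beta>) \<in> ?p ` A'. f \<alpha> * g \<beta>)"
    unfolding convolution_def by simp
  also have "\<dots> = (\<Sum>\<alpha>\<in>A'. f \<alpha> * g (\<m> (\<i> \<alpha>) \<gamma>))"
    by (subst sum.reindex) (auto simp: inj_on_def)
  also have "\<dots> = (\<Sum>\<alpha>\<in>A. f \<alpha> * g (\<m> (\<i> \<alpha>) \<gamma>))"
    using assms(2) unfolding A'_def by (intro sum.mono_neutral_left) auto
  finally show ?thesis .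
qed

lemma convolution_eq_support:
  fixes f g :: "'g \<Rightarrow> 'r::ring_1"
  assumes "\<gamma> \<in> \<G>" "fibre_finite G f"
  shows "conv f g \<gamma> =
    (\<Sum>\<alpha> | f \<alpha> \<noteq> 0 \<and> \<r> \<alpha> = \<r> \<gamma>. f \<alpha> * g (\<m> (\<i> \<alpha>) \<gamma>))"
  by (rule convolution_eq[OF assms(1) fibre_finiteD(2)[OF assms(2)]])
    (use fibre_finiteD(1)[OF assms(2)] in auto)

lemma convolution_add_left:
  fixes f g k :: "'g \<Rightarrow> 'r::ring_1"
  assumes "fibre_finite G f" "fibre_finite G g"
  shows "conv (f + g) k = conv f k + conv g k"
proof
  fix \<gamma>
  show "conv (f + g) k \<gamma> = (conv f k + conv g k) \<gamma>"
  proof (cases "\<gamma> \<in> \<G>")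
    case True
    let ?A = "{\<alpha>. f \<alpha> \<noteq> 0 \<and> \<r> \<alpha> = \<r> \<gamma>} \<union> {\<alpha>. g \<alpha> \<noteq> 0 \<and> \<r> \<alpha> = \<r> \<gamma>}"
    have A: "finite ?A" "\<And>\<alpha>. \<alpha> \<in> ?A \<Longrightarrow> \<alpha> \<in> \<G> \<and> \<r> \<alpha> = \<r> \<gamma>"
      using fibre_finiteD[OF assms(1)] fibre_finiteD[OF assms(2)] by auto
    have "conv h k \<gamma> = (\<Sum>\<alpha>\<in>?A. h \<alpha> * k (\<m> (\<i> \<alpha>) \<gamma>))"
      if "h = f \<or> h = g \<or> h = f + g" for h
      by (rule convolution_eq[OF True A]) (use that in auto)
    then show ?thesis by (simp add: distrib_right sum.distrib)
  qed (simp add: convolution_outside)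
qed

lemma convolution_add_right:
  fixes f g k :: "'g \<Rightarrow> 'r::ring_1"
  assumes "fibre_finite G f"
  shows "conv f (g + k) = conv f g + conv f k"
proof
  fix \<gamma>
  show "conv f (g + k) \<gamma> = (conv f g + conv f k) \<gamma>"
    by (cases "\<gamma> \<in> \<G>")
      (auto simp: convolution_outside convolution_eq_support[OF _ assms] distrib_left sum.distrib)
qed

lemma convolution_scale_left:
  fixes f g :: "'g \<Rightarrow> 'r::ring_1"
  assumes "fibre_finite G f"
  shows "conv (\<lambda>\<gamma>. r * f \<gamma>) g = (\<lambda>\<gamma>. r * conv f g \<gamma>)"
proof
  fix \<gamma>
  show "conv (\<lambda>\<gamma>. r * f \<gamma>) g \<gamma> = r * conv f g \<gamma>"
  proof (cases "\<gamma> \<in> \<G>")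
    case True
    have "conv (\<lambda>\<gamma>. r * f \<gamma>) g \<gamma> =
        (\<Sum>\<alpha> | f \<alpha> \<noteq> 0 \<and> \<r> \<alpha> = \<r> \<gamma>. (r * f \<alpha>) * g (\<m> (\<i> \<alpha>) \<gamma>))"
      by (rule convolution_eq[OF True fibre_finiteD(2)[OF assms]])
        (use fibre_finiteD(1)[OF assms] in auto)
    then show ?thesis
      by (simp add: convolution_eq_support[OF True assms] sum_distrib_left mult.assoc)
  qed (simp add: convolution_outside)
qed

lemma convolution_diff_left:
  fixes f g k :: "'g \<Rightarrow> 'r::ring_1"
  assumes "fibre_finite G f" "fibre_finite G g"
  shows "conv (f - g) k = conv f k - conv g k"
  using convolution_add_left[OF fibre_finite_diff[OF assms] assms(2), of k] by simp

lemma convolution_diff_right: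
  fixes f g k :: "'g \<Rightarrow> 'r::ring_1"
  assumes "fibre_finite G f"
  shows "conv f (g - k) = conv f g - conv f k"
  using convolution_add_right[OF assms, of "g - k" k] by simp

text \<open>Both sides are double sums over the finite parts of the supports of \<open>f\<close> and
  \<open>g\<close> that matter for \<gamma>. The third function stays arbitrary, since the
  augmentation puts the constant function 1 there.\<close>

lemma convolution_assoc:
  fixes f g k :: "'g \<Rightarrow> 'r::ring_1"
  assumes f: "fibre_finite G f" and g: "fibre_finite G g"
  shows "conv (conv f g) k = conv f (conv g k)"
proof
  fix \<gamma>
  show "conv (conv f g) k \<gamma> = conv f (conv g k) \<gamma>"
  proof (cases "\<gamma> \<in> \<G>")
    case \<gamma>: True
    define A where "A = {\<alpha>. f \<alpha> \<noteq> 0 \<and> \<r> \<alpha> = \<r> \<gamma>}"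
    define B where "B \<alpha> = {\<beta>. g \<beta> \<noteq> 0 \<and> \<r> \<beta> = \<s> \<alpha>}" for \<alpha>
    have A: "finite A" "\<And>\<alpha>. \<alpha> \<in> A \<Longrightarrow> \<alpha> \<in> \<G> \<and> \<r> \<alpha> = \<r> \<gamma>"
      unfolding A_def using fibre_finiteD[OF f] by auto
    have B: "finite (B \<alpha>)" "\<And>\<beta>. \<beta> \<in> B \<alpha> \<Longrightarrow> \<beta> \<in> \<G> \<and> \<r> \<beta> = \<s> \<alpha>" for \<alpha>
      unfolding B_def using fibre_finiteD[OF g] by auto
    \<comment> \<open>All products of arrows from the two supports; they contain the support of
      \<open>conv f g\<close> over the range of \<gamma>.\<close>
    define D where "D = (\<Union>\<alpha>\<in>A. \<m> \<alpha> ` B \<alpha>)"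
    have D: "finite D" "\<And>\<delta>. \<delta> \<in> D \<Longrightarrow> \<delta> \<in> \<G> \<and> \<r> \<delta> = \<r> \<gamma>"
      unfolding D_def using A B by auto
    have fg: "conv f g \<delta> = (\<Sum>\<alpha>\<in>A. f \<alpha> * g (\<m> (\<i> \<alpha>) \<delta>))"
      if "\<delta> \<in> \<G>" "\<r> \<delta> = \<r> \<gamma>" for \<delta>
    proof (rule convolution_eq[OF that(1) A(1)])
      show "\<alpha> \<in> \<G> \<and> \<r> \<alpha> = \<r> \<delta>" if "\<alpha> \<in> A" for \<alpha>
        using A(2)[OF that] \<open>\<r> \<delta> = \<r> \<gamma>\<close> by simp
    qed (use that in \<open>auto simp: A_def\<close>)
    have "conv (conv f g) k \<gamma>
        = (\<Sum>\<delta>\<in>D. conv f g \<delta> * k (\<m> (\<i> \<delta>) \<gamma>))"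
    proof (rule convolution_eq[OF \<gamma> D])
      fix \<delta> assume \<delta>: "\<delta> \<in> \<G>" "conv f g \<delta> \<noteq> 0" "\<r> \<delta> = \<r> \<gamma>"
      then obtain \<alpha> where \<alpha>: "\<alpha> \<in> A" "g (\<m> (\<i> \<alpha>) \<delta>) \<noteq> 0"
        using fg[of \<delta>] by (metis (no_types, lifting) mult_zero_right sum.neutral)
      then have "\<m> (\<i> \<alpha>) \<delta> \<in> B \<alpha>" using A(2)[of \<alpha>] \<delta> by (auto simp: B_def)
      moreover have "\<delta> = \<m> \<alpha> (\<m> (\<i> \<alpha>) \<delta>)" using A(2)[of \<alpha>] \<delta> \<alpha> by auto
      ultimately show "\<delta> \<in> D" unfolding D_def using \<alpha>(1) by blast
    qed
    also have "\<dots> = (\<Sum>\<delta>\<in>D. \<Sum>\<alpha>\<in>A. f \<alpha> * (g (\<m> (\<i> \<alpha>) \<delta>) * k (\<m> (\<i> \<delta>) \<gamma>)))"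
      using D(2) by (intro sum.cong) (auto simp: fg sum_distrib_right mult.assoc)
    also have "\<dots> = (\<Sum>\<alpha>\<in>A. f \<alpha> * (\<Sum>\<delta>\<in>D. g (\<m> (\<i> \<alpha>) \<delta>) * k (\<m> (\<i> \<delta>) \<gamma>)))"
      by (subst sum.swap) (simp add: sum_distrib_left)
    also have "\<dots> = (\<Sum>\<alpha>\<in>A. f \<alpha> * conv g k (\<m> (\<i> \<alpha>) \<gamma>))"
    proof (intro sum.cong refl arg_cong2[where f = "(*)"])
      fix \<alpha> assume \<alpha>: "\<alpha> \<in> A"
      note \<alpha>' = A(2)[OF \<alpha>]
      have inj: "inj_on (\<m> \<alpha>) (B \<alpha>)"
      proof (rule inj_onI)
        fix \<beta> \<beta>' assume "\<beta> \<in> B \<alpha>" "\<beta>' \<in> B \<alpha>" and eq: "\<m> \<alpha> \<beta> = \<m> \<alpha> \<beta>'"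
        have "\<m> (\<i> \<alpha>) (\<m> \<alpha> \<beta>) = \<beta>" "\<m> (\<i> \<alpha>) (\<m> \<alpha> \<beta>') = \<beta>'"
          using inv_mult_cancel B(2)[OF \<open>\<beta> \<in> B \<alpha>\<close>] B(2)[OF \<open>\<beta>' \<in> B \<alpha>\<close>] \<alpha>' by metis+
        then show "\<beta> = \<beta>'" unfolding eq by simp
      qed
      \<comment> \<open>Only those \<delta> contribute that prolong \<alpha> by an arrow in the
        support of \<open>g\<close>; they correspond bijectively to
        \<open>B \<alpha>\<close>.\<close>
      have "(\<Sum>\<delta>\<in>D. g (\<m> (\<i> \<alpha>) \<delta>) * k (\<m> (\<i> \<delta>) \<gamma>))
          = (\<Sum>\<delta>\<in>\<m> \<alpha> ` B \<alpha>. g (\<m> (\<i> \<alpha>) \<delta>) * k (\<m> (\<i> \<delta>) \<gamma>))"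
      proof (rule sum.mono_neutral_right[OF D(1)])
        show "\<m> \<alpha> ` B \<alpha> \<subseteq> D" unfolding D_def using \<alpha> by blast
        show "\<forall>\<delta>\<in>D - \<m> \<alpha> ` B \<alpha>. g (\<m> (\<i> \<alpha>) \<delta>) * k (\<m> (\<i> \<delta>) \<gamma>) = 0"
        proof
          fix \<delta> assume \<delta>: "\<delta> \<in> D - \<m> \<alpha> ` B \<alpha>"
          have "\<delta> = \<m> \<alpha> (\<m> (\<i> \<alpha>) \<delta>)" using \<alpha>' D(2)[of \<delta>] \<delta> by auto
          then have "\<m> (\<i> \<alpha>) \<delta> \<notin> B \<alpha>" using \<delta> by blast
          then have "g (\<m> (\<i> \<alpha>) \<delta>) = 0" using \<alpha>' D(2)[of \<delta>] \<delta> by (auto simp: B_def)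
          then show "g (\<m> (\<i> \<alpha>) \<delta>) * k (\<m> (\<i> \<delta>) \<gamma>) = 0" by simp
        qed
      qed
      also have "\<dots> = (\<Sum>\<beta>\<in>B \<alpha>. g (\<m> (\<i> \<alpha>) (\<m> \<alpha> \<beta>)) * k (\<m> (\<i> (\<m> \<alpha> \<beta>)) \<gamma>))"
        unfolding sum.reindex[OF inj] comp_def ..
      also have "\<dots> = (\<Sum>\<beta>\<in>B \<alpha>. g \<beta> * k (\<m> (\<i> \<beta>) (\<m> (\<i> \<alpha>) \<gamma>)))"
      proof (rule sum.cong[OF refl])
        fix \<beta> assume "\<beta> \<in> B \<alpha>"
        then show "g (\<m> (\<i> \<alpha>) (\<m> \<alpha> \<beta>)) * k (\<m> (\<i> (\<m> \<alpha> \<beta>)) \<gamma>) =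
            g \<beta> * k (\<m> (\<i> \<beta>) (\<m> (\<i> \<alpha>) \<gamma>))"
          using B(2)[of \<beta> \<alpha>] \<alpha>' \<gamma> by (simp add: inv_mult_rev arrow_assoc)
      qed
      also have "\<dots> = conv g k (\<m> (\<i> \<alpha>) \<gamma>)"
        using \<alpha>' \<gamma> unfolding B_def by (subst convolution_eq_support[OF _ g]) auto
      finally show "(\<Sum>\<delta>\<in>D. g (\<m> (\<i> \<alpha>) \<delta>) * k (\<m> (\<i> \<delta>) \<gamma>)) =
        conv g k (\<m> (\<i> \<alpha>) \<gamma>)" .
    qed
    also have "\<dots> = conv f (conv g k) \<gamma>"
      unfolding A_def by (rule convolution_eq_support[OF \<gamma> f, symmetric])
    finally show ?thesis .
  qed (simp add: convolution_outside)
qed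

text \<open>A bisection has at most one arrow with the range of \<gamma>, so this convolution is a
  translation. In this way identities in the algebra become identities at single arrows.\<close>

lemma convolution_indicator_left:
  fixes g :: "'g \<Rightarrow> 'r::ring_1"
  assumes "U \<subseteq> \<G>" "inj_on (\<r>) U" "\<alpha> \<in> U" "\<gamma> \<in> \<G>" "\<r> \<alpha> = \<r> \<gamma>"
  shows "conv (indicator U) g \<gamma> = g (\<m> (\<i> \<alpha>) \<gamma>)"
proof -
  have "conv (indicator U) g \<gamma> = (\<Sum>\<alpha>\<in>{\<alpha>}. indicator U \<alpha> * g (\<m> (\<i> \<alpha>) \<gamma>))"
  proof (rule convolution_eq[OF assms(4)])
    fix \<beta> assume "\<beta> \<in> \<G>" "(indicator U \<beta> :: 'r) \<noteq> 0" "\<r> \<beta> = \<r> \<gamma>"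
    then have "\<beta> \<in> U" "\<r> \<beta> = \<r> \<alpha>" using assms by (auto simp: indicator_def split: if_splits)
    then show "\<beta> \<in> {\<alpha>}" using assms(2,3) by (simp add: inj_on_def)
  qed (use assms in auto)
  then show ?thesis using assms(3) by simp
qed

lemma convolution_indicator_left_outside:
  fixes g :: "'g \<Rightarrow> 'r::ring_1"
  assumes "\<r> \<gamma> \<notin> \<r> ` U"
  shows "conv (indicator U) g \<gamma> = 0"
proof (cases "\<gamma> \<in> \<G>")
  case True
  have "conv (indicator U) g \<gamma> = (\<Sum>\<alpha>\<in>{}. indicator U \<alpha> * g (\<m> (\<i> \<alpha>) \<gamma>))"
    by (rule convolution_eq[OF True]) (use assms in \<open>auto simp: indicator_def image_iff split: if_splits\<close>)
  then show ?thesis by simp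
qed (simp add: convolution_outside)

lemma convolution_indicator_units_right:
  fixes f :: "'g \<Rightarrow> 'r::ring_1"
  assumes "fibre_finite G f" "N \<subseteq> \<X>"
  shows "conv f (\<lambda>\<gamma>. a * indicator N \<gamma>) = (\<lambda>\<gamma>. if \<s> \<gamma> \<in> N then f \<gamma> * a else 0)"
proof
  fix \<gamma>
  show "conv f (\<lambda>\<gamma>. a * indicator N \<gamma>) \<gamma> = (if \<s> \<gamma> \<in> N then f \<gamma> * a else 0)"
  proof (cases "\<gamma> \<in> \<G>")
    case True
    have "conv f (\<lambda>\<gamma>. a * indicator N \<gamma>) \<gamma> =
        (\<Sum>\<alpha>\<in>{\<gamma>}. f \<alpha> * (a * indicator N (\<m> (\<i> \<alpha>) \<gamma>)))"
    proof (rule convolution_eq[OF True])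
      fix \<alpha> assume \<alpha>: "\<alpha> \<in> \<G>" "\<r> \<alpha> = \<r> \<gamma>" "a * indicator N (\<m> (\<i> \<alpha>) \<gamma>) \<noteq> 0"
      \<comment> \<open>If the quotient of \<alpha> and \<gamma> is a unit, then \<alpha> =
        \<gamma>; hence a single term remains.\<close>
      then have *: "\<m> (\<i> \<alpha>) \<gamma> \<in> \<X>"
        using assms(2) by (cases "\<m> (\<i> \<alpha>) \<gamma> \<in> N") auto
      have "\<r> (\<m> (\<i> \<alpha>) \<gamma>) = \<s> \<alpha>" using \<alpha> True by simp
      then have "\<m> (\<i> \<alpha>) \<gamma> = \<s> \<alpha>" unfolding unitsD(3)[OF *] .
      then have "\<m> \<alpha> (\<m> (\<i> \<alpha>) \<gamma>) = \<alpha>" using \<alpha>(1) by simp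
      moreover have "\<m> \<alpha> (\<m> (\<i> \<alpha>) \<gamma>) = \<gamma>" using \<alpha>(1,2) True by simp
      ultimately show "\<alpha> \<in> {\<gamma>}" by simp
    qed (use True in auto)
    then show ?thesis using True by (simp add: indicator_def)
  next
    case False
    then have "f \<gamma> = 0" using fibre_finiteD(1)[OF assms(1), of \<gamma>] by blast
    then show ?thesis using False by (simp add: convolution_outside)
  qed
qed

end

section \<open>The groupoid algebra as a ring without unit\<close>

context bisection_groupoid
begin

lemma fibre_finite_indicator:
  assumes "U \<in> \<B>"
  shows "fibre_finite G (indicator U :: 'a \<Rightarrow> 'r::zero_neq_one)"
  unfolding fibre_finite_def
proof (intro conjI allI impI)
  note U = bisectionsD[OF assms]
  show "\<gamma> \<in> \<G>" if "(indicator U \<gamma> :: 'r) \<noteq> 0" for \<gamma>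
    using that U(5) by (auto simp: indicator_def split: if_splits)
  have "{\<gamma>. (indicator U \<gamma> :: 'r) \<noteq> 0 \<and> \<r> \<gamma> = y} = {\<gamma> \<in> U. \<r> \<gamma> = y}" for y
    by (auto simp: indicator_def)
  moreover have "finite {\<gamma> \<in> U. \<r> \<gamma> = y}" for y
  proof (cases "\<exists>\<gamma>\<in>U. \<r> \<gamma> = y")
    case True
    then obtain \<gamma> where "\<gamma> \<in> U" "\<r> \<gamma> = y" by blast
    then have "{\<gamma> \<in> U. \<r> \<gamma> = y} = {\<gamma>}" using U(3) by (auto simp: inj_on_def)
    then show ?thesis by simp
  next
    case False
    then have "{\<gamma> \<in> U. \<r> \<gamma> = y} = {}" by blast
    then show ?thesis by (simp only: finite.emptyI)
  qed
  ultimately show "finite {\<gamma>. (indicator U \<gamma> :: 'r) \<noteq> 0 \<and> \<r> \<gamma> = y}" for y by simp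
qed

lemma fibre_finite_span:
  fixes f :: "'a \<Rightarrow> 'r::ring_1"
  assumes "f \<in> span_of \<C>" "\<C> \<subseteq> \<B>"
  shows "fibre_finite G f"
  using assms(1)
proof (induction rule: left_span_induct)
  case zero
  then show ?case by (simp add: fibre_finite_def)
next
  case (add r b f)
  then obtain U where "b = indicator U" "U \<in> \<B>" using assms(2) by auto
  then have "fibre_finite G b" using fibre_finite_indicator by blast
  then have "fibre_finite G (\<lambda>\<gamma>. r * b \<gamma>)" by (rule fibre_finite_support_mono) auto
  then show ?case using add fibre_finite_add by blast
qed

lemma convolution_indicator:
  fixes a b :: "'r::ring_1"
  assumes "U \<in> \<B>" "V \<in> \<B>"
  shows "conv (\<lambda>\<gamma>. a * indicator U \<gamma>) (\<lambda>\<gamma>. b * indicator V \<gamma>) =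
    (\<lambda>\<gamma>. a * b * indicator (product_set G U V) \<gamma>)"
proof
  fix \<gamma>
  note U = bisectionsD[OF assms(1)] and V = bisectionsD[OF assms(2)]
  let ?c = "conv (indicator U) (\<lambda>\<gamma>. b * indicator V \<gamma>) \<gamma>"
  have *: "?c = b * indicator (product_set G U V) \<gamma>"
  proof (cases "\<gamma> \<in> \<G> \<and> (\<exists>\<alpha>\<in>U. \<r> \<alpha> = \<r> \<gamma>)")
    case True
    then obtain \<alpha> where \<alpha>: "\<alpha> \<in> U" "\<r> \<alpha> = \<r> \<gamma>" "\<gamma> \<in> \<G>" by blast
    have "?c = b * indicator V (\<m> (\<i> \<alpha>) \<gamma>)"
      using convolution_indicator_left[OF U(5,3) \<alpha>(1,3,2)] .
    moreover have "\<m> (\<i> \<alpha>) \<gamma> \<in> V \<longleftrightarrow> \<gamma> \<in> product_set G U V"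
      using mem_product_set_iff[OF U(5) V(5)] \<alpha> inj_onD[OF U(3)] by metis
    ultimately show ?thesis by (simp add: indicator_def)
  next
    case False
    then have "?c = 0"
      using convolution_outside[of \<gamma>] convolution_indicator_left_outside[of \<gamma> U] by (metis imageE)
    moreover have "\<gamma> \<notin> product_set G U V" using mem_product_set_iff[OF U(5) V(5)] False by blast
    ultimately show ?thesis by simp
  qed
  show "conv (\<lambda>\<gamma>. a * indicator U \<gamma>) (\<lambda>\<gamma>. b * indicator V \<gamma>) \<gamma> =
      a * b * indicator (product_set G U V) \<gamma>"
    by (simp only: convolution_scale_left[OF fibre_finite_indicator[OF assms(1)]] * mult.assoc)
qed

lemma convolution_zero: "conv 0 f = (0 :: 'a \<Rightarrow> 'r::ring_1)"
  "conv f 0 = (0 :: 'a \<Rightarrow> 'r::ring_1)"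
  by (auto simp: convolution_def fun_eq_iff intro!: sum.neutral)

text \<open>With three separate families one induction yields closure of the algebra, closure of its
  component of degree \<open>\<one>\<close>, and the rule for degrees of products.\<close>

lemma convolution_span:
  fixes f g :: "'a \<Rightarrow> 'r::ring_1"
  assumes fg: "f \<in> span_of \<C>" "g \<in> span_of \<D>"
    and sub: "\<C> \<subseteq> \<B>" "\<D> \<subseteq> \<B>"
    and mult: "\<And>U V. U \<in> \<C> \<Longrightarrow> V \<in> \<D> \<Longrightarrow> product_set G U V \<in> \<E>"
  shows "conv f g \<in> span_of \<E>"
  using fg(1)
proof (induction rule: left_span_induct)
  case zero
  then show ?case unfolding convolution_zero by (rule left_span_zero)
next
  case (add a b f)
  then obtain U where U: "b = indicator U" "U \<in> \<C>" by auto
  have ffb: "fibre_finite G b" using U sub fibre_finite_indicator by blast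
  then have ff: "fibre_finite G (\<lambda>\<gamma>. a * b \<gamma>)" by (rule fibre_finite_support_mono) auto
  have "conv (\<lambda>\<gamma>. a * b \<gamma>) g \<in> span_of \<E>"
    using fg(2)
  proof (induction rule: left_span_induct)
    case zero
    then show ?case unfolding convolution_zero by (rule left_span_zero)
  next
    case (add a' b' g)
    then obtain V where V: "b' = indicator V" "V \<in> \<D>" by auto
    have "conv (\<lambda>\<gamma>. a * b \<gamma>) (\<lambda>\<gamma>. a' * b' \<gamma>) = (\<lambda>\<gamma>. a * a' * indicator (product_set G U V) \<gamma>)"
      unfolding U V using U V sub by (intro convolution_indicator) auto
    moreover have "(\<lambda>\<gamma>. a * a' * indicator (product_set G U V) \<gamma>) \<in> span_of \<E>"
      by (rule left_span_scale[OF left_span_base]) (rule imageI[OF mult[OF U(2) V(2)]])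
    ultimately have "conv (\<lambda>\<gamma>. a * b \<gamma>) (\<lambda>\<gamma>. a' * b' \<gamma>) \<in> span_of \<E>" by simp
    then show ?case
      unfolding convolution_add_right[OF ff] using add left_span_add by blast
  qed
  moreover have "fibre_finite G f" using add fibre_finite_span sub by blast
  ultimately show ?case
    using convolution_add_left[OF ff] left_span_add add by metis
qed

lemma nonunital_ring_span:
  assumes "\<C> \<subseteq> \<B>"
    "\<And>U V. U \<in> \<C> \<Longrightarrow> V \<in> \<C> \<Longrightarrow> product_set G U V \<in> \<C>"
  shows "nonunital_ring (span_of \<C> :: ('a \<Rightarrow> 'r::ring_1) set) (conv)"
  using assms fibre_finite_span[OF _ assms(1)]
  by unfold_locales
    (auto intro!: left_span_zero left_span_diff convolution_span convolution_assoc
      convolution_diff_left convolution_diff_right)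

lemma nonunital_ring_groupoid_algebra:
  "nonunital_ring (alg :: ('a \<Rightarrow> 'r::ring_1) set) (conv)"
  unfolding groupoid_algebra_def using bisections_mult by (intro nonunital_ring_span) auto

lemma fibre_finite_algebra: "f \<in> alg \<Longrightarrow> fibre_finite G f"
  unfolding groupoid_algebra_def using fibre_finite_span by blast

lemma indicator_in_algebra: "U \<in> \<B> \<Longrightarrow> indicator U \<in> alg"
  unfolding groupoid_algebra_def by (intro left_span_base) blast

text \<open>Intersecting with a clopen set keeps a bisection compact and open. The clopen sets that
  occur later are fibres of the cocycle and preimages of clopen sets of units under the source
  map.\<close>

lemma span_restrict_clopen:
  fixes f :: "'a \<Rightarrow> 'r::ring_1"
  assumes "f \<in> alg" "openin \<T> D" "openin \<T> (\<G> - D)"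
  shows "(\<lambda>\<gamma>. if \<gamma> \<in> D then f \<gamma> else 0) \<in> span_of {U \<in> \<B>. U \<subseteq> D}"
  using assms(1) unfolding groupoid_algebra_def
proof (induction rule: left_span_induct)
  case zero
  have "(\<lambda>\<gamma>. if \<gamma> \<in> D then 0 \<gamma> else 0) = (0 :: 'a \<Rightarrow> 'r)" by auto
  then show ?case using left_span_zero by metis
next
  case (add r b f)
  then obtain U where U: "b = indicator U" "U \<in> \<B>" by auto
  have eq: "(\<lambda>\<gamma>. if \<gamma> \<in> D then ((\<lambda>\<gamma>. r * b \<gamma>) + f) \<gamma> else 0) =
      (\<lambda>\<gamma>. r * indicator (U \<inter> D) \<gamma>) + (\<lambda>\<gamma>. if \<gamma> \<in> D then f \<gamma> else 0)"
    by (auto simp: U indicator_def)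
  have "U \<inter> D \<in> {U \<in> \<B>. U \<subseteq> D}"
    using bisections_Int_clopen[OF U(2) assms(2,3)] by simp
  then have "(\<lambda>\<gamma>. r * indicator (U \<inter> D) \<gamma> :: 'r) \<in> span_of {U \<in> \<B>. U \<subseteq> D}"
    by (intro left_span_scale left_span_base imageI)
  then show ?case unfolding eq using add(3) by (rule left_span_add)
qed

lemma algebra_restrict_clopen:
  fixes f :: "'a \<Rightarrow> 'r::ring_1"
  assumes "f \<in> alg" "openin \<T> D" "openin \<T> (\<G> - D)"
  shows "(\<lambda>\<gamma>. if \<gamma> \<in> D then f \<gamma> else 0) \<in> alg"
proof -
  have "span_of {U \<in> \<B>. U \<subseteq> D} \<subseteq> (alg :: ('a \<Rightarrow> 'r) set)"
    unfolding groupoid_algebra_def by (intro left_span_mono) auto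
  then show ?thesis using span_restrict_clopen[OF assms] by (rule subsetD)
qed

text \<open>The support itself need not be open, so a finite cover by compact open bisections serves
  as its substitute.\<close>

lemma algebra_support:
  fixes f :: "'a \<Rightarrow> 'r::ring_1"
  assumes "f \<in> span_of \<C>"
  obtains \<U> where "finite \<U>" "\<U> \<subseteq> \<C>" "f \<in> span_of \<U>" "{\<gamma>. f \<gamma> \<noteq> 0} \<subseteq> \<Union>\<U>"
proof -
  obtain F a where F: "f = (\<lambda>\<gamma>. \<Sum>b\<in>F. a b * b \<gamma>)" "finite F" "F \<subseteq> indicator ` \<C>"
    using assms unfolding left_span_def by blast
  obtain \<U> where \<U>: "\<U> \<subseteq> \<C>" "finite \<U>" "F = indicator ` \<U>"
    using finite_subset_image[OF F(2,3)] by blast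
  have "f \<in> span_of \<U>" using F \<U> unfolding left_span_def by blast
  moreover have "\<gamma> \<in> \<Union>\<U>" if "f \<gamma> \<noteq> 0" for \<gamma>
  proof (rule ccontr)
    assume "\<gamma> \<notin> \<Union>\<U>"
    then have "b \<gamma> = 0" if "b \<in> F" for b using that \<U>(3) by (auto simp: indicator_def)
    then have "f \<gamma> = 0" unfolding F(1) by (intro sum.neutral ballI) (metis mult_zero_right)
    then show False using that by simp
  qed
  ultimately show ?thesis using that[OF \<U>(2,1)] by (simp add: subset_iff)
qed

end

section \<open>Algebras of open subgroupoids\<close>

context open_subgroupoid
begin

lemma convolution_K:
  fixes f g :: "'a \<Rightarrow> 'r::ring_1"
  assumes "\<And>\<gamma>. f \<gamma> \<noteq> 0 \<Longrightarrow> \<gamma> \<in> S" "\<And>\<gamma>. g \<gamma> \<noteq> 0 \<Longrightarrow> \<gamma> \<in> S"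
  shows "convolution K f g = conv f g"
proof
  fix \<gamma>
  have "{(\<alpha>, \<beta>) \<in> composable K. gmult K \<alpha> \<beta> = \<gamma> \<and> f \<alpha> \<noteq> 0 \<and> g \<beta> \<noteq> 0} =
    {(\<alpha>, \<beta>) \<in> composable G. \<m> \<alpha> \<beta> = \<gamma> \<and> f \<alpha> \<noteq> 0 \<and> g \<beta> \<noteq> 0}"
    using assms by (auto simp: composable_K)
  then show "convolution K f g \<gamma> = conv f g \<gamma>" unfolding convolution_def by simp
qed

lemma groupoid_algebra_K:
  "groupoid_algebra K = span_of {U \<in> \<B>. U \<subseteq> S}"
  unfolding groupoid_algebra_def compact_open_bisections_K ..

lemma groupoid_algebra_K_subset: "groupoid_algebra K \<subseteq> alg"
  unfolding groupoid_algebra_def compact_open_bisections_K by (intro left_span_mono) auto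

lemma algebra_K_support:
  fixes f :: "'a \<Rightarrow> 'r::ring_1"
  assumes "f \<in> groupoid_algebra K" "f \<gamma> \<noteq> 0"
  shows "\<gamma> \<in> S"
proof -
  interpret K: bisection_groupoid K by (rule bisection_groupoid_K)
  show ?thesis
    using fibre_finiteD(1)[OF K.fibre_finite_algebra[OF assms(1)] assms(2)] by simp
qed

end

section \<open>Consequences of regularity\<close>

context bisection_groupoid
begin

lemma source_fibre_bound:
  assumes "finite \<V>" "\<V> \<subseteq> \<B>"
  shows "finite {\<zeta> \<in> \<Union>\<V>. \<s> \<zeta> = z}" "card {\<zeta> \<in> \<Union>\<V>. \<s> \<zeta> = z} \<le> card \<V>"
proof -
  have eq: "{\<zeta> \<in> \<Union>\<V>. \<s> \<zeta> = z} = (\<Union>V\<in>\<V>. {\<zeta> \<in> V. \<s> \<zeta> = z})" by blast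
  have fin: "finite {\<zeta> \<in> V. \<s> \<zeta> = z} \<and> card {\<zeta> \<in> V. \<s> \<zeta> = z} \<le> 1" if "V \<in> \<V>" for V
  proof (cases "\<exists>\<zeta>\<in>V. \<s> \<zeta> = z")
    case True
    then obtain \<zeta> where "\<zeta> \<in> V" "\<s> \<zeta> = z" by blast
    then have "{\<zeta> \<in> V. \<s> \<zeta> = z} = {\<zeta>}"
      using bisectionsD(4)[of V] assms(2) that by (auto simp: inj_on_def)
    then show ?thesis by simp
  next
    case False
    then have "{\<zeta> \<in> V. \<s> \<zeta> = z} = {}" by blast
    then show ?thesis by (metis card.empty finite.emptyI zero_le)
  qed
  show "finite {\<zeta> \<in> \<Union>\<V>. \<s> \<zeta> = z}" unfolding eq using assms(1) fin by blast
  have "card (\<Union>V\<in>\<V>. {\<zeta> \<in> V. \<s> \<zeta> = z}) \<le> (\<Sum>V\<in>\<V>. card {\<zeta> \<in> V. \<s> \<zeta> = z})"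
    by (rule card_UN_le[OF assms(1)])
  also have "\<dots> \<le> (\<Sum>V\<in>\<V>. 1)" using fin by (intro sum_mono) blast
  finally show "card {\<zeta> \<in> \<Union>\<V>. \<s> \<zeta> = z} \<le> card \<V>" unfolding eq by simp
qed

lemma convolution_indicator_arrows:
  fixes f :: "'a \<Rightarrow> 'r::ring_1"
  assumes "fibre_finite G f" "\<gamma> \<in> \<G>"
  shows "conv f (indicator (\<G>)) \<gamma> = (\<Sum>\<eta> | f \<eta> \<noteq> 0 \<and> \<r> \<eta> = \<r> \<gamma>. f \<eta>)"
  unfolding convolution_eq_support[OF assms(2,1)]
  using fibre_finiteD(1)[OF assms(1)] assms(2) by (intro sum.cong) auto

text \<open>
  Convolution with the constant function 1 is the augmentation map. The elements annihilated by it
  form the left ideal \<open>L\<close>; the function \<open>h\<close> is \<open>1\<^sub>V - e\<close> for a common right unit \<open>e\<close> of the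
  elements \<open>a U\<close> of \<open>L\<close>.
\<close>

lemma obtain_invariant_function:
  assumes regular: "von_neumann_regular (alg :: ('a \<Rightarrow> 'r::ring_1) set) (conv)"
    and \<U>: "finite \<U>" "\<U> \<subseteq> \<B>"
  obtains h :: "'a \<Rightarrow> 'r::ring_1" where "h \<in> alg"
    "\<And>\<gamma> \<eta>. \<gamma> \<in> \<Union>\<U> \<Longrightarrow> \<eta> \<in> \<G> \<Longrightarrow> \<r> \<eta> = \<r> \<gamma> \<Longrightarrow> h (\<m> (\<i> \<gamma>) \<eta>) = h \<eta>"
    "\<And>\<gamma>. \<gamma> \<in> \<Union>\<U> \<Longrightarrow> (\<Sum>\<eta> | h \<eta> \<noteq> 0 \<and> \<r> \<eta> = \<r> \<gamma>. h \<eta>) = 1"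
proof -
  interpret A: nonunital_ring "alg :: ('a \<Rightarrow> 'r) set" "conv"
    by (rule nonunital_ring_groupoid_algebra)
  \<comment> \<open>The constant function 1 need not lie in the algebra. Closure of \<open>L\<close>
    under left multiplication is an instance of associativity, which permits such a right
    factor.\<close>
  define L where "L = {f \<in> alg :: ('a \<Rightarrow> 'r) set. conv f (indicator (\<G>)) = 0}"
  define a :: "'a set \<Rightarrow> 'a \<Rightarrow> 'r" where "a U = indicator U - indicator (\<r> ` U)" for U
  have ff: "fibre_finite G (indicator U :: 'a \<Rightarrow> 'r)" if "U \<in> \<B>" for U
    using that by (rule fibre_finite_indicator)
  have aug: "conv (indicator U) (indicator (\<G>)) =
      (indicator {\<gamma> \<in> \<G>. \<r> \<gamma> \<in> \<r> ` U} :: 'a \<Rightarrow> 'r)"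
    if U: "U \<in> \<B>" for U
  proof
    fix \<gamma>
    show "conv (indicator U) (indicator (\<G>)) \<gamma> =
      (indicator {\<gamma> \<in> \<G>. \<r> \<gamma> \<in> \<r> ` U} \<gamma> :: 'r)"
    proof (cases "\<gamma> \<in> \<G> \<and> \<r> \<gamma> \<in> \<r> ` U")
      case True
      then obtain \<alpha> where \<alpha>: "\<alpha> \<in> U" "\<r> \<alpha> = \<r> \<gamma>" "\<gamma> \<in> \<G>" by auto
      have "\<alpha> \<in> \<G>" using \<alpha> bisectionsD(5)[OF U] by blast
      then show ?thesis
        unfolding convolution_indicator_left[OF bisectionsD(5,3)[OF U] \<alpha>(1,3,2)] using True \<alpha> by simp
    next
      case False
      then have "conv (indicator U) (indicator (\<G>)) \<gamma> = (0 :: 'r)"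
        using convolution_outside[of \<gamma>] convolution_indicator_left_outside[of \<gamma> U] by metis
      then show ?thesis using False by (auto simp: indicator_def)
    qed
  qed
  have a_alg: "a U \<in> alg" if "U \<in> \<U>" for U
    unfolding a_def using that \<U>(2) bisections_rng by (intro A.diff_closed indicator_in_algebra) auto
  have a_L: "a U \<in> L" if "U \<in> \<U>" for U
  proof -
    have U: "U \<in> \<B>" using that \<U> by blast
    have "\<r> ` \<r> ` U = \<r> ` U"
      unfolding image_image using bisectionsD(5)[OF U] by (intro image_cong) auto
    then have "conv (a U) (indicator (\<G>)) = 0"
      unfolding a_def
      by (simp add: convolution_diff_left[OF ff[OF U] ff[OF bisections_rng(1)[OF U]]] aug[OF U]
          aug[OF bisections_rng(1)[OF U]])
    then show ?thesis using a_alg[OF that] unfolding L_def by blast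
  qed
  have ffA: "fibre_finite G f" if "f \<in> alg" for f :: "'a \<Rightarrow> 'r"
    using that by (rule fibre_finite_algebra)
  have "\<exists>e\<in>L. \<forall>b\<in>a ` \<U>. conv b e = b"
  proof (rule A.left_ideal_common_right_unit[OF regular])
    show "0 \<in> L" unfolding L_def using A.zero_closed convolution_zero by blast
    show "x - y \<in> L" if "x \<in> L" "y \<in> L" for x y
      using that A.diff_closed ffA unfolding L_def by (auto simp: convolution_diff_left)
    show "conv x y \<in> L" if "x \<in> alg" "y \<in> L" for x y
      using that A.mult_closed ffA unfolding L_def by (auto simp: convolution_assoc convolution_zero)
  qed (use a_L \<U>(1) in \<open>auto simp: L_def\<close>)
  then obtain e where e: "e \<in> L" "\<And>U. U \<in> \<U> \<Longrightarrow> conv (a U) e = a U" by auto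
  \<comment> \<open>A compact open set of units containing the ranges and sources of all given
    bisections, so that its indicator is a right unit of each \<open>a U\<close>.\<close>
  define V where "V = (\<Union>U\<in>\<U>. \<r> ` U \<union> \<s> ` U)"
  have V: "V \<subseteq> \<X>" "V \<in> \<B>"
  proof -
    have V_eq: "V = \<Union>(image (\<r>) ` \<U> \<union> image (\<s>) ` \<U>)" unfolding V_def by auto
    have sub: "image (\<r>) ` \<U> \<union> image (\<s>) ` \<U> \<subseteq> \<B>"
      using \<U>(2) bisections_rng(1) bisections_src(1) by blast
    show "V \<subseteq> \<X>" unfolding V_def using \<U>(2) bisections_rng(2) bisections_src(2) by blast
    then show "V \<in> \<B>"
      unfolding V_eq using compact_Union_bisections[OF _ sub] \<U>(1) by (intro bisections_units) auto
  qed
  define h where "h = indicator V - e"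
  have e_alg: "e \<in> alg" using e unfolding L_def by blast
  have h_alg: "h \<in> alg"
    unfolding h_def using A.diff_closed indicator_in_algebra V e_alg by blast
  \<comment> \<open>Both \<open>indicator V\<close> and \<open>e\<close> are right units of
    \<open>a U\<close>, so \<open>a U\<close> annihilates their difference. Evaluated at single
    arrows, this is the invariance of \<open>h\<close>.\<close>
  have ah: "conv (a U) h = 0" if "U \<in> \<U>" for U
  proof -
    have U: "U \<in> \<B>" using that \<U> by blast
    have ffa: "fibre_finite G (a U)" using a_alg[OF that] fibre_finite_algebra by blast
    have "\<s> \<gamma> \<in> V" if "a U \<gamma> \<noteq> 0" for \<gamma>
    proof -
      have "\<gamma> \<in> U \<or> \<gamma> \<in> \<r> ` U" using that unfolding a_def by (auto simp: indicator_def split: if_splits)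
      moreover have "\<s> \<gamma> = \<gamma>" if "\<gamma> \<in> \<r> ` U" using that bisectionsD(5)[OF U] by auto
      ultimately show ?thesis unfolding V_def using \<open>U \<in> \<U>\<close> by auto
    qed
    then have "(\<lambda>\<gamma>. if \<s> \<gamma> \<in> V then a U \<gamma> * 1 else 0) = a U" by (intro ext) (metis mult_1_right)
    then have "conv (a U) (indicator V) = a U"
      using convolution_indicator_units_right[OF ffa V(1), of 1] by simp
    then show ?thesis unfolding h_def using convolution_diff_right[OF ffa] e(2)[OF that] by simp
  qed
  show ?thesis
  proof (rule that[OF h_alg])
    fix \<gamma> \<eta> assume \<gamma>\<eta>: "\<gamma> \<in> \<Union>\<U>" "\<eta> \<in> \<G>" "\<r> \<eta> = \<r> \<gamma>"
    then obtain U where U: "U \<in> \<U>" "\<gamma> \<in> U" by blast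
    then have U': "U \<in> \<B>" using \<U> by blast
    note rU = bisections_rng[OF U']
    have \<gamma>: "\<gamma> \<in> \<G>" using bisectionsD(5)[OF U'] U by blast
    have "conv (indicator U) h \<eta> = h (\<m> (\<i> \<gamma>) \<eta>)"
      using convolution_indicator_left[OF bisectionsD(5,3)[OF U'] U(2) \<gamma>\<eta>(2)] \<gamma>\<eta>(3) by simp
    moreover have "conv (indicator (\<r> ` U)) h \<eta> = h (\<m> (\<i> (\<r> \<gamma>)) \<eta>)"
      using convolution_indicator_left[OF bisectionsD(5,3)[OF rU(1)] imageI[OF U(2)] \<gamma>\<eta>(2)] \<gamma>\<eta>(3) \<gamma> by simp
    moreover have "\<m> (\<i> (\<r> \<gamma>)) \<eta> = \<eta>" using \<gamma> \<gamma>\<eta> by (simp flip: \<gamma>\<eta>(3))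
    moreover have "conv (indicator U) h - conv (indicator (\<r> ` U)) h = 0"
      using ah[OF U(1)] convolution_diff_left[OF ff[OF U'] ff[OF rU(1)]] unfolding a_def by simp
    ultimately show "h (\<m> (\<i> \<gamma>) \<eta>) = h \<eta>" by (metis eq_iff_diff_eq_0)
  next
    fix \<gamma> assume "\<gamma> \<in> \<Union>\<U>"
    then obtain U where U: "U \<in> \<U>" "\<gamma> \<in> U" by blast
    have \<gamma>: "\<gamma> \<in> \<G>" using bisectionsD(5) U \<U> by blast
    have "\<r> \<gamma> \<in> V" unfolding V_def using U by blast
    then have "\<r> \<gamma> \<in> \<r> ` V" using image_eqI[of "\<r> \<gamma>" "\<r>" "\<r> \<gamma>" V] \<gamma> by simp
    moreover have "conv h (indicator (\<G>)) =
        conv (indicator V) (indicator (\<G>)) - conv e (indicator (\<G>))"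
      unfolding h_def using convolution_diff_left ff[OF V(2)] fibre_finite_algebra[OF e_alg] by blast
    moreover have "conv e (indicator (\<G>)) = 0" using e unfolding L_def by blast
    ultimately have "conv h (indicator (\<G>)) \<gamma> = 1"
      using aug[OF V(2)] \<gamma> by simp
    then show "(\<Sum>\<eta> | h \<eta> \<noteq> 0 \<and> \<r> \<eta> = \<r> \<gamma>. h \<eta>) = 1"
      using convolution_indicator_arrows[OF fibre_finite_algebra[OF h_alg] \<gamma>] by simp
  qed
qed

text \<open>Multiply the indicator of a compact open set of units by r and take a quasi-inverse in
  the algebra: its value at a unit of that set is a quasi-inverse of r.\<close>

lemma regular_algebra_imp_regular_coefficients:
  assumes regular: "von_neumann_regular (alg :: ('a \<Rightarrow> 'r::ring_1) set) (conv)"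
  shows "von_neumann_regular (UNIV :: 'r set) (*)"
  unfolding von_neumann_regular_def
proof
  fix r :: 'r
  obtain \<gamma> where "\<gamma> \<in> \<G>" using arrows_nonempty by blast
  then obtain x where x: "x \<in> \<X>" using rng_unit by blast
  obtain U where U: "U \<in> \<B>" "x \<in> U" "U \<subseteq> \<X>"
    using bisections_basis[OF open_units x] by blast
  have "(\<lambda>\<gamma>. r * indicator U \<gamma>) \<in> alg"
    unfolding groupoid_algebra_def using U(1) by (intro left_span_scale left_span_base imageI)
  then obtain g where g: "g \<in> alg" "conv (conv (\<lambda>\<gamma>. r * indicator U \<gamma>) g)
      (\<lambda>\<gamma>. r * indicator U \<gamma>) = (\<lambda>\<gamma>. r * indicator U \<gamma>)"
    using regular unfolding von_neumann_regular_def by blast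
  note ff = fibre_finite_indicator[OF U(1), where 'r = 'r]
  note xa = unitsD(1)[OF x]
  have left: "conv (\<lambda>\<gamma>. r * indicator U \<gamma>) k x = r * k x" for k :: "'a \<Rightarrow> 'r"
    using convolution_indicator_left[OF bisectionsD(5,3)[OF U(1)] U(2) xa refl, of k] x xa
      rng_mult_self[OF xa]
    by (simp add: convolution_scale_left[OF ff])
  have ffr: "fibre_finite G (\<lambda>\<gamma>. r * indicator U \<gamma>)"
    by (rule fibre_finite_support_mono[OF ff]) auto
  have "r * conv g (\<lambda>\<gamma>. r * indicator U \<gamma>) x = r"
    using fun_cong[OF g(2), of x] U(2) left convolution_assoc[OF ffr fibre_finite_algebra[OF g(1)]] by simp
  moreover have "conv g (\<lambda>\<gamma>. r * indicator U \<gamma>) x = g x * r"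
    using fun_cong[OF convolution_indicator_units_right[OF fibre_finite_algebra[OF g(1)] U(3)], of r x] x U(2)
    by simp
  ultimately have "r * g x * r = r" by (simp add: mult.assoc)
  then show "\<exists>b\<in>UNIV. r * b * r = r" by blast
qed

text \<open>Left translation by \<open>K\<close> preserves \<open>X\<close>, the support of
  \<open>h\<close> over \<open>x\<close>, and acts freely on it. As \<open>h\<close> is constant on
  orbits, its total 1 is \<open>card K\<close> times a sum with one term per orbit.\<close>

lemma regular_algebra_imp_isotropy_invertible:
  assumes regular: "von_neumann_regular (alg :: ('a \<Rightarrow> 'r::ring_1) set) (conv)"
    and x: "x \<in> \<X>" and K: "subgroup K (isotropy_group G x)" "finite K"
  shows "invertible_element (of_nat (card K) :: 'r)"
proof -
  have K_arrow: "k \<in> \<G>" "\<s> k = x" "\<r> k = x" if "k \<in> K" for k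
    using subgroup.subset[OF K(1)] that by (auto simp: isotropy_group_def)
  have K_mult: "\<m> j k \<in> K" if "j \<in> K" "k \<in> K" for j k
    using subgroup.m_closed[OF K(1) that] by (simp add: isotropy_group_def)
  have xK: "x \<in> K" using subgroup.one_closed[OF K(1)] by (simp add: isotropy_group_def)
  have "\<exists>U\<in>\<B>. k \<in> U" if "k \<in> K" for k
    using bisections_basis[OF openin_topspace] K_arrow(1)[OF that] unfolding arrows_def by metis
  then obtain u where u: "\<And>k. k \<in> K \<Longrightarrow> u k \<in> \<B> \<and> k \<in> u k" by metis
  have \<U>: "finite (u ` K)" "u ` K \<subseteq> \<B>" using u K(2) by auto
  obtain h :: "'a \<Rightarrow> 'r" where h: "h \<in> alg"
    "\<And>\<gamma> \<eta>. \<gamma> \<in> \<Union>(u ` K) \<Longrightarrow> \<eta> \<in> \<G> \<Longrightarrow> \<r> \<eta> = \<r> \<gamma> \<Longrightarrow> h (\<m> (\<i> \<gamma>) \<eta>) = h \<eta>"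
    "\<And>\<gamma>. \<gamma> \<in> \<Union>(u ` K) \<Longrightarrow> (\<Sum>\<eta> | h \<eta> \<noteq> 0 \<and> \<r> \<eta> = \<r> \<gamma>. h \<eta>) = 1"
    using obtain_invariant_function[OF regular \<U>] by blast
  define X where "X = {\<eta>. h \<eta> \<noteq> 0 \<and> \<r> \<eta> = x}"
  have X_arrow: "\<eta> \<in> \<G>" "\<r> \<eta> = x" if "\<eta> \<in> X" for \<eta>
    using that fibre_finiteD(1)[OF fibre_finite_algebra[OF h(1)]] unfolding X_def by auto
  have finX: "finite X" unfolding X_def using fibre_finiteD(2)[OF fibre_finite_algebra[OF h(1)]] .
  have sum1: "(\<Sum>\<eta>\<in>X. h \<eta>) = 1" using h(3)[of x] u xK x unfolding X_def by auto
  have h_inv: "h (\<m> k \<eta>) = h \<eta>" if "k \<in> K" "\<eta> \<in> X" for k \<eta>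
  proof -
    note arr = K_arrow[OF that(1)] X_arrow[OF that(2)]
    have "\<m> (\<i> k) (\<m> k \<eta>) = \<eta>" using arr by simp
    then show ?thesis using h(2)[of k "\<m> k \<eta>"] u that(1) arr by force
  qed
  have X_mult: "\<m> k \<eta> \<in> X" if "k \<in> K" "\<eta> \<in> X" for k \<eta>
    using h_inv[OF that] that K_arrow[OF that(1)] X_arrow[OF that(2)] unfolding X_def by simp
  define orb where "orb \<eta> = (\<lambda>k. \<m> k \<eta>) ` K" for \<eta>
  have self: "\<eta> \<in> orb \<eta>" if "\<eta> \<in> X" for \<eta>
    unfolding orb_def using xK X_arrow[OF that] by (metis imageI rng_mult_self)
  have inj: "inj_on (\<lambda>k. \<m> k \<eta>) K" if "\<eta> \<in> \<G>" "\<r> \<eta> = x" for \<eta>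
  proof (rule inj_onI)
    fix j k assume jk: "j \<in> K" "k \<in> K" "\<m> j \<eta> = \<m> k \<eta>"
    have "\<m> (\<m> j \<eta>) (\<i> \<eta>) = j" "\<m> (\<m> k \<eta>) (\<i> \<eta>) = k"
      using mult_cancel_right K_arrow[OF jk(1)] K_arrow[OF jk(2)] that by metis+
    then show "j = k" using jk(3) by metis
  qed
  have orb_eq: "orb \<eta>' = orb \<eta>" if \<eta>: "\<eta> \<in> X" "\<eta>' \<in> orb \<eta>" for \<eta> \<eta>'
  proof -
    obtain k where k: "k \<in> K" "\<eta>' = \<m> k \<eta>" using \<eta>(2) unfolding orb_def by blast
    \<comment> \<open>Right translation by an element of the finite set \<open>K\<close> permutes
      \<open>K\<close>, so every point of an orbit generates the same orbit.\<close>
    have "(\<lambda>j. \<m> j k) ` K = K"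
      using inj[OF K_arrow(1,3)[OF k(1)]] K_mult k(1) by (intro endo_inj_surj[OF K(2)]) auto
    moreover have "orb \<eta>' = (\<lambda>j. \<m> j \<eta>) ` (\<lambda>j. \<m> j k) ` K"
      unfolding orb_def image_image k(2)
      by (intro image_cong refl) (simp add: arrow_assoc K_arrow[OF k(1)] K_arrow X_arrow[OF \<eta>(1)])
    ultimately show ?thesis unfolding orb_def by simp
  qed
  have "(\<Sum>\<eta>\<in>X. h \<eta>) = (\<Sum>y\<in>orb ` X. \<Sum>\<eta>\<in>{\<eta> \<in> X. orb \<eta> = y}. h \<eta>)"
    using finX by (intro sum.group[symmetric]) auto
  also have "\<dots> = (\<Sum>y\<in>orb ` X. of_nat (card K) * h (SOME \<eta>. \<eta> \<in> X \<and> orb \<eta> = y))"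
  proof (rule sum.cong[OF refl])
    fix y assume "y \<in> orb ` X"
    then have "\<exists>\<eta>. \<eta> \<in> X \<and> orb \<eta> = y" by blast
    then have "(SOME \<eta>. \<eta> \<in> X \<and> orb \<eta> = y) \<in> X \<and> orb (SOME \<eta>. \<eta> \<in> X \<and> orb \<eta> = y) = y" by (rule someI_ex)
    then obtain \<eta> where \<eta>: "\<eta> = (SOME \<eta>. \<eta> \<in> X \<and> orb \<eta> = y)" "\<eta> \<in> X" "orb \<eta> = y" by blast
    have "{\<eta> \<in> X. orb \<eta> = y} = orb \<eta>"
    proof (intro equalityI subsetI)
      fix \<zeta> assume "\<zeta> \<in> {\<eta> \<in> X. orb \<eta> = y}"
      then show "\<zeta> \<in> orb \<eta>" using self[of \<zeta>] \<eta>(3) by simp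
    next
      fix \<zeta> assume "\<zeta> \<in> orb \<eta>"
      then show "\<zeta> \<in> {\<eta> \<in> X. orb \<eta> = y}"
        using orb_eq[OF \<eta>(2)] X_mult[OF _ \<eta>(2)] \<eta>(3) by (auto simp: orb_def[of \<eta>])
    qed
    then have "(\<Sum>\<eta>\<in>{\<eta> \<in> X. orb \<eta> = y}. h \<eta>) = (\<Sum>k\<in>K. h (\<m> k \<eta>))"
      using sum.reindex[OF inj[OF X_arrow[OF \<eta>(2)]]] unfolding orb_def by simp
    also have "\<dots> = of_nat (card K) * h \<eta>" using h_inv[OF _ \<eta>(2)] by simp
    finally show "(\<Sum>\<eta>\<in>{\<eta> \<in> X. orb \<eta> = y}. h \<eta>) =
        of_nat (card K) * h (SOME \<eta>. \<eta> \<in> X \<and> orb \<eta> = y)" unfolding \<eta>(1) .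
  qed
  finally have "of_nat (card K) * (\<Sum>y\<in>orb ` X. h (SOME \<eta>. \<eta> \<in> X \<and> orb \<eta> = y)) = 1"
    using sum1 by (simp add: sum_distrib_left)
  \<comment> \<open>Natural multiples of 1 are central, which makes the right inverse
    two-sided.\<close>
  then show ?thesis
    unfolding invertible_element_def using mult_of_nat_commute by metis
qed

end

text \<open>Index n stands for words of n + 1 letters, because a groupoid has no single empty
  word.\<close>

primrec set_words :: "'g top_groupoid \<Rightarrow> 'g set \<Rightarrow> nat \<Rightarrow> 'g set" where
  "set_words G E 0 = E"
| "set_words G E (Suc n) = product_set G E (set_words G E n)"

declare set_words.simps(2) [simp del]

text \<open>Closure under ranges makes the sets of words increasing, as a word may be preceded by
  its range. Closure under inverses makes their union closed under inversion.\<close>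

locale symmetric_set = groupoid +
  fixes E
  assumes E_subset: "E \<subseteq> arrows G"
    and E_inv: "\<gamma> \<in> E \<Longrightarrow> ginv G \<gamma> \<in> E"
    and E_rng: "\<gamma> \<in> E \<Longrightarrow> grng G \<gamma> \<in> E"
begin

abbreviation "W \<equiv> set_words G E"

definition generated :: "'a set" where
  "generated = (\<Union>n. W n)"

lemma E_generated: "E \<subseteq> generated"
  unfolding generated_def using UN_upper[of 0 UNIV W] by simp

lemma words_SucE:
  assumes "\<gamma> \<in> W (Suc n)"
  obtains \<epsilon> \<delta> where "\<epsilon> \<in> E" "\<delta> \<in> W n" "\<epsilon> \<in> \<G>" "\<delta> \<in> \<G>" "\<s> \<epsilon> = \<r> \<delta>"
    "\<gamma> = \<m> \<epsilon> \<delta>"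
  using assms by (auto simp: product_set_def composable_def set_words.simps(2))

lemma words_SucI:
  assumes "\<epsilon> \<in> E" "\<delta> \<in> W n" "\<delta> \<in> \<G>" "\<s> \<epsilon> = \<r> \<delta>"
  shows "\<m> \<epsilon> \<delta> \<in> W (Suc n)"
  using assms E_subset unfolding product_set_def composable_def set_words.simps(2) by blast

lemma words_arrow: "\<gamma> \<in> W n \<Longrightarrow> \<gamma> \<in> \<G>"
  by (cases n) (use E_subset in \<open>auto elim!: words_SucE\<close>)

lemma words_rng: "\<gamma> \<in> W n \<Longrightarrow> \<r> \<gamma> \<in> E"
  by (cases n) (use E_rng in \<open>auto elim!: words_SucE\<close>)

lemma words_Suc_mono: "W n \<subseteq> W (Suc n)"
proof
  fix \<gamma> assume \<gamma>: "\<gamma> \<in> W n"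
  then have "\<m> (\<r> \<gamma>) \<gamma> \<in> W (Suc n)"
    using words_arrow words_rng by (intro words_SucI) auto
  then show "\<gamma> \<in> W (Suc n)" using words_arrow[OF \<gamma>] by simp
qed

lemma words_mono: "mono W"
  using words_Suc_mono by (simp add: mono_iff_le_Suc)

text \<open>The factors have j + 1 and k + 1 letters, hence the index
  \<open>Suc (j + k)\<close>.\<close>

lemma words_mult:
  assumes "\<alpha> \<in> W j" "\<beta> \<in> W k" "\<s> \<alpha> = \<r> \<beta>"
  shows "\<m> \<alpha> \<beta> \<in> W (Suc (j + k))"
  using assms
proof (induction j arbitrary: \<alpha>)
  case 0
  then show ?case using words_SucI words_arrow by simp
next
  case (Suc j)
  obtain \<epsilon> \<delta> where *: "\<epsilon> \<in> E" "\<delta> \<in> W j" "\<epsilon> \<in> \<G>" "\<delta> \<in> \<G>" "\<s> \<epsilon> = \<r> \<delta>"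
    "\<alpha> = \<m> \<epsilon> \<delta>" using words_SucE[OF Suc.prems(1)] .
  have \<beta>: "\<beta> \<in> \<G>" using words_arrow[OF Suc.prems(2)] .
  have src: "\<s> \<delta> = \<r> \<beta>" using * Suc.prems(3) by simp
  have "\<m> \<epsilon> (\<m> \<delta> \<beta>) \<in> W (Suc (Suc (j + k)))"
    by (rule words_SucI) (use Suc.IH[OF *(2) Suc.prems(2) src] * \<beta> src in auto)
  then show ?case using * \<beta> src arrow_assoc[of \<epsilon> \<delta> \<beta>] by (metis add_Suc)
qed

lemma words_inv: "\<gamma> \<in> W n \<Longrightarrow> \<i> \<gamma> \<in> W n"
proof (induction n arbitrary: \<gamma>)
  case 0
  then show ?case using E_inv by simp
next
  case (Suc n)
  obtain \<epsilon> \<delta> where *: "\<epsilon> \<in> E" "\<delta> \<in> W n" "\<epsilon> \<in> \<G>" "\<delta> \<in> \<G>" "\<s> \<epsilon> = \<r> \<delta>"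
    "\<gamma> = \<m> \<epsilon> \<delta>" using words_SucE[OF Suc.prems] .
  have "\<i> \<epsilon> \<in> W 0" using E_inv * by simp
  then have "\<m> (\<i> \<delta>) (\<i> \<epsilon>) \<in> W (Suc (n + 0))"
    by (rule words_mult[OF Suc.IH[OF *(2)]]) (use * in auto)
  then show ?case using * inv_mult_rev by simp
qed

lemma subgroupoid_generated:
  assumes "E \<noteq> {}"
  shows "subgroupoid generated G"
  unfolding subgroupoid_def
proof (intro conjI ballI impI)
  show "generated \<noteq> {}" using assms E_generated by auto
  show "generated \<subseteq> \<G>" unfolding generated_def using words_arrow by auto
  show "\<i> \<alpha> \<in> generated" if "\<alpha> \<in> generated" for \<alpha>
    using that words_inv unfolding generated_def by auto
  show "\<m> \<alpha> \<beta> \<in> generated" if "\<alpha> \<in> generated" "\<beta> \<in> generated" "(\<alpha>, \<beta>) \<in> composable G" for \<alpha> \<beta>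
  proof -
    obtain j k where "\<alpha> \<in> W j" "\<beta> \<in> W k" using \<open>\<alpha> \<in> generated\<close> \<open>\<beta> \<in> generated\<close> unfolding generated_def by auto
    then have "\<m> \<alpha> \<beta> \<in> W (Suc (j + k))"
      using words_mult \<open>(\<alpha>, \<beta>) \<in> composable G\<close> unfolding composable_def by auto
    then show ?thesis unfolding generated_def by (rule UN_I[OF UNIV_I])
  qed
qed

lemma invariant_words:
  assumes inv: "\<And>\<gamma> \<eta>. \<gamma> \<in> E \<Longrightarrow> \<eta> \<in> \<G> \<Longrightarrow> \<r> \<eta> = \<r> \<gamma> \<Longrightarrow>
      h (\<m> (\<i> \<gamma>) \<eta>) = h \<eta>"
    and "\<gamma> \<in> W n" "\<eta> \<in> \<G>" "\<r> \<eta> = \<r> \<gamma>"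
  shows "h (\<m> (\<i> \<gamma>) \<eta>) = h \<eta>"
  using assms(2-4)
proof (induction n arbitrary: \<gamma> \<eta>)
  case 0
  then show ?case using inv by simp
next
  case (Suc n)
  obtain \<epsilon> \<delta> where *: "\<epsilon> \<in> E" "\<delta> \<in> W n" "\<epsilon> \<in> \<G>" "\<delta> \<in> \<G>" "\<s> \<epsilon> = \<r> \<delta>"
    "\<gamma> = \<m> \<epsilon> \<delta>" using words_SucE[OF Suc.prems(1)] .
  have \<eta>: "\<r> \<eta> = \<r> \<epsilon>" using Suc.prems(3) * by simp
  have "\<m> (\<i> \<gamma>) \<eta> = \<m> (\<i> \<delta>) (\<m> (\<i> \<epsilon>) \<eta>)"
    using * \<eta> Suc.prems(2) by (simp add: inv_mult_rev arrow_assoc)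
  also have "h \<dots> = h (\<m> (\<i> \<epsilon>) \<eta>)"
    using * \<eta> Suc.prems(2) by (intro Suc.IH) auto
  also have "\<dots> = h \<eta>" using inv * \<eta> Suc.prems(2) by blast
  finally show ?case .
qed

text \<open>
  Translating a point of the support of \<open>h\<close> over \<open>x\<close> embeds the source fibre of the generated
  subgroupoid at \<open>x\<close> into a source fibre of the support.
\<close>

lemma generated_fibre_bound:
  assumes inv: "\<And>\<gamma> \<eta>. \<gamma> \<in> E \<Longrightarrow> \<eta> \<in> \<G> \<Longrightarrow> \<r> \<eta> = \<r> \<gamma> \<Longrightarrow>
      h (\<m> (\<i> \<gamma>) \<eta>) = h \<eta>"
    and \<eta>: "\<eta> \<in> \<G>" "h \<eta> \<noteq> 0"
    and bound: "finite {\<zeta> \<in> \<G>. h \<zeta> \<noteq> 0 \<and> \<s> \<zeta> = \<s> \<eta>}"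
      "card {\<zeta> \<in> \<G>. h \<zeta> \<noteq> 0 \<and> \<s> \<zeta> = \<s> \<eta>} \<le> m"
  shows "{\<delta> \<in> generated. \<s> \<delta> = \<r> \<eta>} \<subseteq> W m"
proof -
  define S where "S = {\<delta> \<in> generated. \<s> \<delta> = \<r> \<eta>}"
  define f where "f n = {\<delta> \<in> W n. \<s> \<delta> = \<r> \<eta>}" for n
  have S_arrow: "\<delta> \<in> \<G>" "\<s> \<delta> = \<r> \<eta>" if "\<delta> \<in> S" for \<delta>
    using that words_arrow unfolding S_def generated_def by auto
  have inj: "inj_on (\<lambda>\<delta>. \<m> \<delta> \<eta>) S"
  proof (rule inj_onI)
    fix \<delta> \<delta>' assume "\<delta> \<in> S" "\<delta>' \<in> S" and eq: "\<m> \<delta> \<eta> = \<m> \<delta>' \<eta>"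
    then have "\<m> (\<m> \<delta> \<eta>) (\<i> \<eta>) = \<delta>" "\<m> (\<m> \<delta>' \<eta>) (\<i> \<eta>) = \<delta>'"
      using mult_cancel_right S_arrow \<eta>(1) by metis+
    then show "\<delta> = \<delta>'" using eq by metis
  qed
  have into: "(\<lambda>\<delta>. \<m> \<delta> \<eta>) ` S \<subseteq> {\<zeta> \<in> \<G>. h \<zeta> \<noteq> 0 \<and> \<s> \<zeta> = \<s> \<eta>}"
  proof
    fix \<zeta> assume "\<zeta> \<in> (\<lambda>\<delta>. \<m> \<delta> \<eta>) ` S"
    then obtain \<delta> where \<delta>: "\<delta> \<in> S" "\<zeta> = \<m> \<delta> \<eta>" by blast
    note arr = S_arrow[OF \<delta>(1)]
    obtain n where n: "\<delta> \<in> W n" using \<delta>(1) unfolding S_def generated_def by blast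
    have "h (\<m> (\<i> \<delta>) (\<m> \<delta> \<eta>)) = h (\<m> \<delta> \<eta>)"
      by (rule invariant_words[where h = h and n = n, OF inv n]) (use arr \<eta>(1) in simp_all)
    moreover have "\<m> (\<i> \<delta>) (\<m> \<delta> \<eta>) = \<eta>" using arr \<eta>(1) by simp
    ultimately have "h (\<m> \<delta> \<eta>) \<noteq> 0" using \<eta>(2) by simp
    then show "\<zeta> \<in> {\<zeta> \<in> \<G>. h \<zeta> \<noteq> 0 \<and> \<s> \<zeta> = \<s> \<eta>}"
      using \<delta>(2) arr \<eta>(1) by simp
  qed
  have fin: "finite S" "card S \<le> m"
    using inj_on_finite[OF inj into bound(1)] card_inj_on_le[OF inj into bound(1)] bound(2) by auto
  have f_mono: "mono f" using words_mono unfolding f_def mono_def by blast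
  have f_sub: "f n \<subseteq> S" for n unfolding f_def S_def generated_def by blast
  \<comment> \<open>The sets \<open>f n\<close> increase inside \<open>S\<close>, and a step without
    growth is final, so growth lasts for at most \<open>card S\<close> steps.\<close>
  have "f (card S) = (\<Union>n. f n)"
  proof (rule finite_mono_strict_prefix_implies_finite_fixpoint[OF f_sub fin(1)])
    show "\<exists>N. (\<forall>n\<le>N. \<forall>m\<le>N. m < n \<longrightarrow> f m \<subset> f n) \<and> (\<forall>n\<ge>N. f N = f n)"
    proof (rule finite_mono_remains_stable_implies_strict_prefix[OF _ f_mono])
      have "range f \<subseteq> Pow S" using f_sub by blast
      then show "finite (range f)" using fin(1) finite_subset by blast
      \<comment> \<open>A longer word is a letter followed by a shorter word with the same source.
        If that shorter word can be taken from \<open>f n\<close>, nothing new arises.\<close>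
      show "\<forall>n. f n = f (Suc n) \<longrightarrow> f (Suc n) = f (Suc (Suc n))"
      proof (intro allI impI equalityI subsetI)
        fix n \<delta> assume eq: "f n = f (Suc n)" and \<delta>: "\<delta> \<in> f (Suc (Suc n))"
        then have d: "\<delta> \<in> W (Suc (Suc n))" "\<s> \<delta> = \<r> \<eta>" unfolding f_def by auto
        obtain \<epsilon> \<delta>' where *: "\<epsilon> \<in> E" "\<delta>' \<in> W (Suc n)" "\<epsilon> \<in> \<G>" "\<delta>' \<in> \<G>"
          "\<s> \<epsilon> = \<r> \<delta>'" "\<delta> = \<m> \<epsilon> \<delta>'" using words_SucE[OF d(1)] .
        have "\<delta>' \<in> f (Suc n)" unfolding f_def using * d by simp
        then have "\<delta>' \<in> f n" by (simp only: eq)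
        then have "\<delta>' \<in> W n" unfolding f_def by simp
        then show "\<delta> \<in> f (Suc n)" using words_SucI[of \<epsilon> \<delta>' n] * d(2) unfolding f_def by blast
      qed (use f_mono in \<open>auto simp: mono_iff_le_Suc\<close>)
    qed
  qed
  then have "S \<subseteq> f (card S)" unfolding S_def generated_def f_def by blast
  also have "\<dots> \<subseteq> f m" using f_mono fin(2) by (rule monoD)
  finally show ?thesis unfolding S_def f_def by blast
qed

end

section \<open>Quasi-compactness of generated subgroupoids\<close>

context bisection_groupoid
begin

lemma words_bisections:
  assumes "finite \<U>" "\<U> \<subseteq> \<B>"
  shows "\<exists>\<W>. finite \<W> \<and> \<W> \<subseteq> \<B> \<and> set_words G (\<Union>\<U>) n = \<Union>\<W>"
proof (induction n)
  case 0
  then show ?case using assms by auto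
next
  case (Suc n)
  then obtain \<W> where \<W>: "finite \<W>" "\<W> \<subseteq> \<B>" "set_words G (\<Union>\<U>) n = \<Union>\<W>"
    by metis
  define \<W>' where "\<W>' = (\<lambda>(U, V). product_set G U V) ` (\<U> \<times> \<W>)"
  have "finite \<W>'" unfolding \<W>'_def using assms(1) \<W>(1) by simp
  moreover have "\<W>' \<subseteq> \<B>"
    unfolding \<W>'_def using bisections_mult assms(2) \<W>(2) by auto
  moreover have "product_set G (\<Union>\<U>) (\<Union>\<W>) = \<Union>\<W>'"
  proof -
    have "product_set G (\<Union>\<U>) (\<Union>\<W>) = (\<Union>U\<in>\<U>. \<Union>V\<in>\<W>. product_set G U V)"
      unfolding product_set_def by blast
    also have "\<dots> = \<Union>\<W>'" unfolding \<W>'_def by auto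
    finally show ?thesis .
  qed
  ultimately show ?case using \<W>(3) unfolding set_words.simps(2) by metis
qed

text \<open>If finitely many bisections \<open>\<V>\<close> cover the support of \<open>h\<close>,
  then \<open>card \<V>\<close> bounds its source fibres at all units simultaneously. The generated
  subgroupoid is therefore exhausted by words of index \<open>card \<V>\<close>, a finite union of
  compact open bisections.\<close>

lemma regular_algebra_compact_subgroupoid:
  assumes regular: "von_neumann_regular (alg :: ('a \<Rightarrow> 'r::ring_1) set) (conv)"
    and C: "compactin \<T> C" "C \<noteq> {}"
  shows "\<exists>S. subgroupoid S G \<and> openin \<T> S \<and> compactin \<T> S \<and> C \<subseteq> S"
proof -
  obtain \<C> where \<C>: "finite \<C>" "\<C> \<subseteq> \<B>" "C \<subseteq> \<Union>\<C>"
    using compact_cover_bisections[OF C(1)] .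
  define \<U> where "\<U> = \<C> \<union> image (\<i>) ` \<C> \<union> image (\<r>) ` \<C> \<union> image (\<s>) ` \<C>"
  define E where "E = \<Union>\<U>"
  have \<U>: "finite \<U>" "\<U> \<subseteq> \<B>"
    unfolding \<U>_def using \<C>(1,2) bisections_inv bisections_rng(1) bisections_src(1) by auto
  have memE: "\<gamma> \<in> E \<longleftrightarrow> (\<exists>\<alpha>\<in>\<Union>\<C>. \<gamma> = \<alpha> \<or> \<gamma> = \<i> \<alpha> \<or> \<gamma> = \<r> \<alpha> \<or> \<gamma> = \<s> \<alpha>)" for \<gamma>
  proof -
    have "E = \<Union>\<C> \<union> \<i> ` \<Union>\<C> \<union> \<r> ` \<Union>\<C> \<union> \<s> ` \<Union>\<C>"
      unfolding E_def \<U>_def by (simp only: Union_Un_distrib image_Union)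
    then show ?thesis by (auto simp only: Un_iff image_iff)
  qed
  have \<C>_arrow: "\<alpha> \<in> \<G>" if "\<alpha> \<in> \<Union>\<C>" for \<alpha> using that \<C>(2) bisectionsD(5) by blast
  interpret symmetric_set G E
  proof
    show "E \<subseteq> \<G>"
    proof
      fix \<gamma> assume "\<gamma> \<in> E"
      then obtain \<alpha> where \<alpha>: "\<alpha> \<in> \<Union>\<C>" "\<gamma> = \<alpha> \<or> \<gamma> = \<i> \<alpha> \<or> \<gamma> = \<r> \<alpha> \<or> \<gamma> = \<s> \<alpha>"
        using memE by blast
      then show "\<gamma> \<in> \<G>" using \<C>_arrow[OF \<alpha>(1)] by auto
    qed
    show "\<i> \<gamma> \<in> E" if \<gamma>: "\<gamma> \<in> E" for \<gamma>
    proof -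
      obtain \<alpha> where \<alpha>: "\<alpha> \<in> \<Union>\<C>" "\<gamma> = \<alpha> \<or> \<gamma> = \<i> \<alpha> \<or> \<gamma> = \<r> \<alpha> \<or> \<gamma> = \<s> \<alpha>"
        using \<gamma> memE by blast
      then have "\<i> \<gamma> = \<i> \<alpha> \<or> \<i> \<gamma> = \<alpha> \<or> \<i> \<gamma> = \<r> \<alpha> \<or> \<i> \<gamma> = \<s> \<alpha>"
        using \<C>_arrow[OF \<alpha>(1)] by auto
      then show ?thesis using memE \<alpha>(1) by blast
    qed
    show "\<r> \<gamma> \<in> E" if \<gamma>: "\<gamma> \<in> E" for \<gamma>
    proof -
      obtain \<alpha> where \<alpha>: "\<alpha> \<in> \<Union>\<C>" "\<gamma> = \<alpha> \<or> \<gamma> = \<i> \<alpha> \<or> \<gamma> = \<r> \<alpha> \<or> \<gamma> = \<s> \<alpha>"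
        using \<gamma> memE by blast
      then have "\<r> \<gamma> = \<r> \<alpha> \<or> \<r> \<gamma> = \<s> \<alpha>"
        using \<C>_arrow[OF \<alpha>(1)] by auto
      then show ?thesis using memE \<alpha>(1) by blast
    qed
  qed
  obtain h :: "'a \<Rightarrow> 'r" where h: "h \<in> alg"
    "\<And>\<gamma> \<eta>. \<gamma> \<in> E \<Longrightarrow> \<eta> \<in> \<G> \<Longrightarrow> \<r> \<eta> = \<r> \<gamma> \<Longrightarrow> h (\<m> (\<i> \<gamma>) \<eta>) = h \<eta>"
    "\<And>\<gamma>. \<gamma> \<in> E \<Longrightarrow> (\<Sum>\<eta> | h \<eta> \<noteq> 0 \<and> \<r> \<eta> = \<r> \<gamma>. h \<eta>) = 1"
    using obtain_invariant_function[OF regular \<U>] unfolding E_def by blast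
  obtain \<V> where \<V>: "finite \<V>" "\<V> \<subseteq> \<B>" "h \<in> span_of \<V>"
      "{\<gamma>. h \<gamma> \<noteq> 0} \<subseteq> \<Union>\<V>"
    using algebra_support[OF h(1)[unfolded groupoid_algebra_def]] .
  have "generated \<subseteq> W (card \<V>)"
  proof
    fix \<delta> assume \<delta>: "\<delta> \<in> generated"
    then obtain n where n: "\<delta> \<in> W n" unfolding generated_def by blast
    have \<delta>_arrow: "\<delta> \<in> \<G>" using words_arrow[OF n] .
    \<comment> \<open>The source of a word is the range of its inverse, hence again in
      \<open>E\<close>.\<close>
    have "\<s> \<delta> \<in> E" using words_rng[OF words_inv[OF n]] \<delta>_arrow by simp
    then have "(\<Sum>\<eta> | h \<eta> \<noteq> 0 \<and> \<r> \<eta> = \<s> \<delta>. h \<eta>) = 1"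
      using h(3)[of "\<s> \<delta>"] \<delta>_arrow by simp
    \<comment> \<open>Since 0 and 1 differ in the coefficient ring, a sum equal to 1 has a nonzero
      term. This gives a point of the support to translate.\<close>
    then have "{\<eta>. h \<eta> \<noteq> 0 \<and> \<r> \<eta> = \<s> \<delta>} \<noteq> {}" by (metis sum.empty zero_neq_one)
    then obtain \<eta> where \<eta>: "h \<eta> \<noteq> 0" "\<r> \<eta> = \<s> \<delta>" by blast
    have \<eta>_arrow: "\<eta> \<in> \<G>" using fibre_finiteD(1)[OF fibre_finite_algebra[OF h(1)] \<eta>(1)] .
    have sub: "{\<zeta> \<in> \<G>. h \<zeta> \<noteq> 0 \<and> \<s> \<zeta> = \<s> \<eta>} \<subseteq> {\<zeta> \<in> \<Union>\<V>. \<s> \<zeta> = \<s> \<eta>}"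
      using \<V>(4) by blast
    note bound = source_fibre_bound[OF \<V>(1,2), of "\<s> \<eta>"]
    have "{\<delta> \<in> generated. \<s> \<delta> = \<r> \<eta>} \<subseteq> W (card \<V>)"
      by (rule generated_fibre_bound[of h, OF h(2) \<eta>_arrow \<eta>(1)])
        (use finite_subset[OF sub bound(1)] card_mono[OF bound(1) sub] bound(2) in auto)
    then show "\<delta> \<in> W (card \<V>)" using \<delta> \<eta>(2) by auto
  qed
  then have gen: "generated = W (card \<V>)" unfolding generated_def by blast
  obtain \<W> where \<W>: "finite \<W>" "\<W> \<subseteq> \<B>" "W (card \<V>) = \<Union>\<W>"
    using words_bisections[OF \<U>, of "card \<V>"] unfolding E_def by metis
  have "C \<subseteq> E" using \<C>(3) memE by auto
  then have "C \<subseteq> generated" "E \<noteq> {}" using C(2) E_generated by auto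
  then show ?thesis
    using subgroupoid_generated compact_Union_bisections[OF \<W>(1,2)] gen \<W>(3) by metis
qed

text \<open>The directed family consists of all quasi-compact open subgroupoids: one arises around
  each arrow, and one around the union of any two members.\<close>

lemma regular_algebra_imp_approximately_quasi_compact:
  assumes regular: "von_neumann_regular (alg :: ('a \<Rightarrow> 'r::ring_1) set) (conv)"
  shows "approximately_quasi_compact G"
  unfolding approximately_quasi_compact_def
proof (intro exI conjI ballI)
  let ?\<F> = "{S. subgroupoid S G \<and> openin \<T> S \<and> compactin \<T> S}"
  have point: "\<exists>S\<in>?\<F>. \<gamma> \<in> S" if "\<gamma> \<in> \<G>" for \<gamma>
    using regular_algebra_compact_subgroupoid[OF regular, of "{\<gamma>}"] that by (auto simp: arrows_def)
  show "?\<F> \<noteq> {}" using point arrows_nonempty by blast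
  show "subgroupoid S G" "openin \<T> S" "compactin \<T> S" if "S \<in> ?\<F>" for S
    using that by auto
  show "\<exists>W\<in>?\<F>. S \<union> T \<subseteq> W" if "S \<in> ?\<F>" "T \<in> ?\<F>" for S T
  proof -
    have "S \<union> T \<noteq> {}" using that unfolding subgroupoid_def by auto
    then show ?thesis
      using regular_algebra_compact_subgroupoid[OF regular, of "S \<union> T"] that compactin_Un by blast
  qed
  show "\<Union>?\<F> = \<G>" using point openin_subset_arrows by blast
qed

end

section \<open>Regularity for quasi-compact groupoids\<close>

lemma left_span_sum:
  assumes "finite I" "\<And>i. i \<in> I \<Longrightarrow> f i \<in> left_span B"
  shows "(\<lambda>\<gamma>. \<Sum>i\<in>I. f i \<gamma>) \<in> left_span B"
  using assms
proof (induction I)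
  case empty
  have "(\<lambda>\<gamma>. \<Sum>i\<in>{}. f i \<gamma>) = 0" by auto
  then show ?case using left_span_zero by metis
next
  case (insert i I)
  have "(\<lambda>\<gamma>. \<Sum>j\<in>insert i I. f j \<gamma>) = f i + (\<lambda>\<gamma>. \<Sum>j\<in>I. f j \<gamma>)"
    using insert.hyps by auto
  moreover have "f i \<in> left_span B" "(\<lambda>\<gamma>. \<Sum>j\<in>I. f j \<gamma>) \<in> left_span B"
    using insert by auto
  ultimately show ?case using left_span_add by metis
qed

text \<open>The index set of the sum depends on the supports, so the hypothesis also provides for
  pairs that drop out on both sides.\<close>

lemma convolution_cong:
  assumes "\<And>\<alpha> \<beta>. (\<alpha>, \<beta>) \<in> composable G \<Longrightarrow> gmult G \<alpha> \<beta> = \<eta> \<Longrightarrow>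
    f \<alpha> = 0 \<and> f' \<alpha> = 0 \<or> g \<beta> = 0 \<and> g' \<beta> = 0 \<or> f \<alpha> = f' \<alpha> \<and> g \<beta> = g' \<beta>"
  shows "convolution G f g \<eta> = convolution G f' g' \<eta>"
  unfolding convolution_def
proof (rule sum.cong)
  show "{(\<alpha>, \<beta>) \<in> composable G. gmult G \<alpha> \<beta> = \<eta> \<and> f \<alpha> \<noteq> 0 \<and> g \<beta> \<noteq> 0} =
    {(\<alpha>, \<beta>) \<in> composable G. gmult G \<alpha> \<beta> = \<eta> \<and> f' \<alpha> \<noteq> 0 \<and> g' \<beta> \<noteq> 0}"
  proof (rule Set.set_eqI)
    fix p :: "'a \<times> 'a"
    obtain \<alpha> \<beta> where p: "p = (\<alpha>, \<beta>)" by (cases p)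
    show "p \<in> {(\<alpha>, \<beta>) \<in> composable G. gmult G \<alpha> \<beta> = \<eta> \<and> f \<alpha> \<noteq> 0 \<and> g \<beta> \<noteq> 0} \<longleftrightarrow>
      p \<in> {(\<alpha>, \<beta>) \<in> composable G. gmult G \<alpha> \<beta> = \<eta> \<and> f' \<alpha> \<noteq> 0 \<and> g' \<beta> \<noteq> 0}"
      unfolding p using assms[of \<alpha> \<beta>] by auto
  qed
  fix p assume "p \<in> {(\<alpha>, \<beta>) \<in> composable G. gmult G \<alpha> \<beta> = \<eta> \<and> f' \<alpha> \<noteq> 0 \<and> g' \<beta> \<noteq> 0}"
  then show "(case p of (\<alpha>, \<beta>) \<Rightarrow> f \<alpha> * g \<beta>) = (case p of (\<alpha>, \<beta>) \<Rightarrow> f' \<alpha> * g' \<beta>)"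
    using assms[of "fst p" "snd p"] by (cases p) auto
qed

text \<open>When the product of two arrows lies over an invariant set of units, so do both
  factors.\<close>

lemma (in groupoid) convolution_local:
  assumes A: "\<And>\<gamma>. \<gamma> \<in> arrows G \<Longrightarrow> gsrc G \<gamma> \<in> A \<longleftrightarrow> grng G \<gamma> \<in> A" and "gsrc G \<eta> \<in> A"
    and f: "\<And>\<gamma>. \<gamma> \<in> arrows G \<Longrightarrow> gsrc G \<gamma> \<in> A \<Longrightarrow> f \<gamma> = f' \<gamma>"
    and g: "\<And>\<gamma>. \<gamma> \<in> arrows G \<Longrightarrow> gsrc G \<gamma> \<in> A \<Longrightarrow> g \<gamma> = g' \<gamma>"
  shows "convolution G f g \<eta> = convolution G f' g' \<eta>"
proof (rule convolution_cong)
  fix \<alpha> \<beta> assume comp: "(\<alpha>, \<beta>) \<in> composable G" "gmult G \<alpha> \<beta> = \<eta>"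
  have arr: "\<alpha> \<in> arrows G" "\<beta> \<in> arrows G" "gsrc G \<alpha> = grng G \<beta>"
    using comp(1) by (auto simp: composable_def)
  have "gsrc G \<beta> \<in> A" using arr comp(2) \<open>gsrc G \<eta> \<in> A\<close> by auto
  then have "gsrc G \<alpha> \<in> A" using A[OF arr(2)] arr(3) by simp
  then show "f \<alpha> = 0 \<and> f' \<alpha> = 0 \<or> g \<beta> = 0 \<and> g' \<beta> = 0 \<or> f \<alpha> = f' \<alpha> \<and> g \<beta> = g' \<beta>"
    using f[OF arr(1)] g[OF arr(2)] \<open>gsrc G \<beta> \<in> A\<close> by blast
qed

section \<open>Elements of the algebra near a source fibre\<close>

context bisection_groupoid
begin

text \<open>
  Near the source fibre of \<open>x\<close> every element of the algebra is determined by its values on that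
  fibre. This replaces restriction to a neighbourhood, as the topology need not be Hausdorff.
\<close>

lemma germ_expansion:
  fixes f :: "'a \<Rightarrow> 'r::ring_1"
  assumes f: "f \<in> alg" and x: "x \<in> \<X>"
    and F: "finite F" "F = {\<gamma> \<in> \<G>. \<s> \<gamma> = x}"
    and U: "\<And>\<gamma>. \<gamma> \<in> F \<Longrightarrow> U \<gamma> \<in> \<B> \<and> \<gamma> \<in> U \<gamma>"
  shows "\<exists>N. openin \<T> N \<and> x \<in> N \<and> N \<subseteq> \<X> \<and>
    (\<forall>\<eta>\<in>\<G>. \<s> \<eta> \<in> N \<longrightarrow> f \<eta> = (\<Sum>\<gamma>\<in>F. if \<eta> \<in> U \<gamma> then f \<gamma> else 0))"
  using f unfolding groupoid_algebra_def
proof (induction rule: left_span_induct)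
  case zero
  have "(\<Sum>\<gamma>\<in>F. if \<eta> \<in> U \<gamma> then (0 :: 'a \<Rightarrow> 'r) \<gamma> else 0) = 0" for \<eta>
    by (rule sum.neutral) auto
  then show ?case using open_units x by (intro exI[of _ "\<X>"]) simp
next
  case (add r b f)
  obtain N1 where N1: "openin \<T> N1" "x \<in> N1" "N1 \<subseteq> \<X>"
    "\<And>\<eta>. \<eta> \<in> \<G> \<Longrightarrow> \<s> \<eta> \<in> N1 \<Longrightarrow> f \<eta> = (\<Sum>\<gamma>\<in>F. if \<eta> \<in> U \<gamma> then f \<gamma> else 0)"
    using add.IH by metis
  obtain V where V: "b = indicator V" "V \<in> \<B>" using add.hyps(1) by blast
  note V' = bisectionsD[OF V(2)]
  have "\<exists>N. openin \<T> N \<and> x \<in> N \<and>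
    (\<forall>\<eta>\<in>\<G>. \<s> \<eta> \<in> N \<longrightarrow> b \<eta> = (\<Sum>\<gamma>\<in>F. if \<eta> \<in> U \<gamma> then b \<gamma> else 0))"
  proof (cases "\<exists>\<gamma>\<^sub>0\<in>F. \<gamma>\<^sub>0 \<in> V")
    case True
    then obtain \<gamma>\<^sub>0 where \<gamma>\<^sub>0: "\<gamma>\<^sub>0 \<in> F" "\<gamma>\<^sub>0 \<in> V" by blast
    note U0 = U[OF \<gamma>\<^sub>0(1)]
    \<comment> \<open>\<open>V\<close> contains exactly one arrow \<open>\<gamma>\<^sub>0\<close> of
      the fibre. For every source in \<open>N\<close> the bisections \<open>V\<close> and
      \<open>U \<gamma>\<^sub>0\<close> share the arrow with that source, so over \<open>N\<close>
      membership in one is membership in the other.\<close>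
    define N where "N = \<s> ` (V \<inter> U \<gamma>\<^sub>0)"
    have "openin \<T> N" unfolding N_def
      using open_src V'(1) bisectionsD(1) U0 by blast
    moreover have "x \<in> N" unfolding N_def using \<gamma>\<^sub>0 U0 F(2) by blast
    moreover have "b \<eta> = (\<Sum>\<gamma>\<in>F. if \<eta> \<in> U \<gamma> then b \<gamma> else 0)" if \<eta>: "\<eta> \<in> \<G>" "\<s> \<eta> \<in> N" for \<eta>
    proof -
      obtain \<zeta> where \<zeta>: "\<zeta> \<in> V" "\<zeta> \<in> U \<gamma>\<^sub>0" "\<s> \<zeta> = \<s> \<eta>" using \<eta>(2) unfolding N_def by auto
      have "\<eta> \<in> V \<longleftrightarrow> \<eta> \<in> U \<gamma>\<^sub>0"
        using \<zeta> inj_onD[OF V'(4)] inj_onD[OF bisectionsD(4)[of "U \<gamma>\<^sub>0"]] U0 by metis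
      moreover have "(\<Sum>\<gamma>\<in>F. if \<eta> \<in> U \<gamma> then b \<gamma> else 0) =
          (\<Sum>\<gamma>\<in>F. if \<gamma> = \<gamma>\<^sub>0 then if \<eta> \<in> U \<gamma>\<^sub>0 then 1 else 0 else 0)"
      proof (rule sum.cong[OF refl])
        fix \<gamma> assume "\<gamma> \<in> F"
        then have src: "\<s> \<gamma> = x" "\<s> \<gamma>\<^sub>0 = x" using \<gamma>\<^sub>0(1) F(2) by auto
        show "(if \<eta> \<in> U \<gamma> then b \<gamma> else 0) = (if \<gamma> = \<gamma>\<^sub>0 then if \<eta> \<in> U \<gamma>\<^sub>0 then 1 else 0 else 0)"
        proof (cases "\<gamma> = \<gamma>\<^sub>0")
          case False
          then have "\<gamma> \<notin> V" using inj_onD[OF V'(4), of \<gamma> \<gamma>\<^sub>0] src \<gamma>\<^sub>0(2) by auto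
          then show ?thesis using False by (auto simp: V)
        qed (use \<gamma>\<^sub>0 in \<open>auto simp: V\<close>)
      qed
      moreover have "\<dots> = (if \<eta> \<in> U \<gamma>\<^sub>0 then 1 else 0)" using F(1) \<gamma>\<^sub>0(1) by simp
      ultimately show ?thesis by (simp add: V indicator_def)
    qed
    ultimately show ?thesis by blast
  next
    case False
    \<comment> \<open>\<open>V\<close> misses the fibre, so \<open>x\<close> lies outside the set of
      sources of \<open>V\<close>, which is compact and hence closed among the units.\<close>
    define N where "N = \<X> - \<s> ` V"
    have "openin \<T> N"
      unfolding N_def using open_units_minus_compact bisections_src[OF V(2)] bisectionsD(2) by blast
    moreover have "x \<in> N" unfolding N_def using False x F(2) V'(5) by auto
    moreover have "b \<eta> = (\<Sum>\<gamma>\<in>F. if \<eta> \<in> U \<gamma> then b \<gamma> else 0)" if \<eta>: "\<eta> \<in> \<G>" "\<s> \<eta> \<in> N" for \<eta>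
    proof -
      have "\<eta> \<notin> V" using \<eta>(2) unfolding N_def by blast
      moreover have "(\<Sum>\<gamma>\<in>F. if \<eta> \<in> U \<gamma> then b \<gamma> else 0) = 0"
        using False by (intro sum.neutral) (auto simp: V)
      ultimately show ?thesis by (simp add: V)
    qed
    ultimately show ?thesis by blast
  qed
  then obtain N2 where N2: "openin \<T> N2" "x \<in> N2"
    "\<And>\<eta>. \<eta> \<in> \<G> \<Longrightarrow> \<s> \<eta> \<in> N2 \<Longrightarrow> b \<eta> = (\<Sum>\<gamma>\<in>F. if \<eta> \<in> U \<gamma> then b \<gamma> else 0)" by metis
  show ?case
  proof (intro exI[of _ "N1 \<inter> N2"] conjI ballI impI)
    show "openin \<T> (N1 \<inter> N2)" using N1 N2 by blast
    show "x \<in> N1 \<inter> N2" "N1 \<inter> N2 \<subseteq> \<X>" using N1 N2 by auto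
    fix \<eta> assume \<eta>: "\<eta> \<in> \<G>" "\<s> \<eta> \<in> N1 \<inter> N2"
    have "((\<lambda>\<gamma>. r * b \<gamma>) + f) \<eta>
        = r * (\<Sum>\<gamma>\<in>F. if \<eta> \<in> U \<gamma> then b \<gamma> else 0) + (\<Sum>\<gamma>\<in>F. if \<eta> \<in> U \<gamma> then f \<gamma> else 0)"
      using N1(4)[OF \<eta>(1)] N2(3)[OF \<eta>(1)] \<eta>(2) by simp
    also have "\<dots> = (\<Sum>\<gamma>\<in>F. r * (if \<eta> \<in> U \<gamma> then b \<gamma> else 0) + (if \<eta> \<in> U \<gamma> then f \<gamma> else 0))"
      by (simp only: sum_distrib_left sum.distrib)
    also have "\<dots> = (\<Sum>\<gamma>\<in>F. if \<eta> \<in> U \<gamma> then ((\<lambda>\<gamma>. r * b \<gamma>) + f) \<gamma> else 0)"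
      by (intro sum.cong) auto
    finally show "((\<lambda>\<gamma>. r * b \<gamma>) + f) \<eta> = (\<Sum>\<gamma>\<in>F. if \<eta> \<in> U \<gamma> then ((\<lambda>\<gamma>. r * b \<gamma>) + f) \<gamma> else 0)" .
  qed
qed

lemma vanishing_near_fibre:
  fixes f :: "'a \<Rightarrow> 'r::ring_1"
  assumes f: "f \<in> alg" and x: "x \<in> \<X>"
    and fin: "finite {\<gamma> \<in> \<G>. \<s> \<gamma> = x}"
    and zero: "\<And>\<gamma>. \<gamma> \<in> \<G> \<Longrightarrow> \<s> \<gamma> = x \<Longrightarrow> f \<gamma> = 0"
  obtains N where "openin \<T> N" "x \<in> N" "N \<subseteq> \<X>"
    "\<forall>\<eta>\<in>\<G>. \<s> \<eta> \<in> N \<longrightarrow> f \<eta> = 0"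
proof -
  have "\<exists>U\<in>\<B>. \<gamma> \<in> U" if "\<gamma> \<in> \<G>" for \<gamma>
    using bisections_basis[OF openin_topspace] that unfolding arrows_def by metis
  then obtain U where U: "\<And>\<gamma>. \<gamma> \<in> \<G> \<Longrightarrow> U \<gamma> \<in> \<B> \<and> \<gamma> \<in> U \<gamma>" by metis
  obtain N where N: "openin \<T> N" "x \<in> N" "N \<subseteq> \<X>"
    "\<forall>\<eta>\<in>\<G>. \<s> \<eta> \<in> N \<longrightarrow>
      f \<eta> = (\<Sum>\<gamma>\<in>{\<gamma> \<in> \<G>. \<s> \<gamma> = x}. if \<eta> \<in> U \<gamma> then f \<gamma> else 0)"
    using germ_expansion[OF f x fin refl, of U] U by auto
  have "(\<Sum>\<gamma>\<in>{\<gamma> \<in> \<G>. \<s> \<gamma> = x}. if \<eta> \<in> U \<gamma> then f \<gamma> else 0) = 0" for \<eta>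
    using zero by (intro sum.neutral) auto
  then have "\<forall>\<eta>\<in>\<G>. \<s> \<eta> \<in> N \<longrightarrow> f \<eta> = 0" using N(4) by metis
  then show ?thesis using that N by blast
qed

text \<open>Each point of \<open>\<Delta>\<close> has a bisection avoiding the other points: those
  with a different source are removed by excluding finitely many units, a closed set in the unit
  space, and those with the same source by injectivity.\<close>

lemma interpolation:
  fixes g\<^sub>0 :: "'a \<Rightarrow> 'r::ring_1"
  assumes \<Delta>: "finite \<Delta>" "\<Delta> \<subseteq> \<G>"
  shows "\<exists>g\<in>alg. \<forall>\<delta>\<in>\<Delta>. g \<delta> = g\<^sub>0 \<delta>"
proof -
  have "\<exists>U\<in>\<B>. U \<inter> \<Delta> = {\<delta>}" if \<delta>: "\<delta> \<in> \<Delta>" for \<delta>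
  proof -
    define C where "C = \<s> ` \<Delta> - {\<s> \<delta>}"
    have C: "C \<subseteq> \<X>" unfolding C_def using \<Delta>(2) by auto
    have "compactin \<T> C"
      using \<Delta>(1) C units_subset unfolding C_def arrows_def by (intro finite_imp_compactin) auto
    then have W: "openin \<T> {\<gamma> \<in> \<G>. \<s> \<gamma> \<in> \<X> - C}"
      using C open_units_minus_compact openin_src_vimage by blast
    have \<delta>_W: "\<delta> \<in> {\<gamma> \<in> \<G>. \<s> \<gamma> \<in> \<X> - C}"
      using \<Delta>(2) \<delta> unfolding C_def by auto
    obtain U where U: "U \<in> \<B>" "\<delta> \<in> U"
      "U \<subseteq> {\<gamma> \<in> \<G>. \<s> \<gamma> \<in> \<X> - C}" using bisections_basis[OF W \<delta>_W] .
    have "\<gamma> = \<delta>" if "\<gamma> \<in> U" "\<gamma> \<in> \<Delta>" for \<gamma>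
    proof -
      have "\<s> \<gamma> \<notin> C" using U(3) that(1) by blast
      then have "\<s> \<gamma> = \<s> \<delta>" unfolding C_def using that(2) by blast
      then show ?thesis using inj_onD[OF bisectionsD(4)[OF U(1)]] that(1) U(2) by blast
    qed
    then show ?thesis using U \<delta> by blast
  qed
  then obtain U where U: "\<And>\<delta>. \<delta> \<in> \<Delta> \<Longrightarrow> U \<delta> \<in> \<B> \<and> U \<delta> \<inter> \<Delta> = {\<delta>}" by metis
  define g where "g = (\<lambda>\<gamma>. \<Sum>\<delta>\<in>\<Delta>. g\<^sub>0 \<delta> * indicator (U \<delta>) \<gamma>)"
  have "g \<in> alg"
    unfolding g_def groupoid_algebra_def
    by (intro left_span_sum[OF \<Delta>(1)] left_span_scale left_span_base imageI) (use U in blast)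
  moreover have "g \<gamma> = g\<^sub>0 \<gamma>" if \<gamma>: "\<gamma> \<in> \<Delta>" for \<gamma>
  proof -
    have "g\<^sub>0 \<delta> * indicator (U \<delta>) \<gamma> = (if \<delta> = \<gamma> then g\<^sub>0 \<gamma> else 0)" if "\<delta> \<in> \<Delta>" for \<delta>
    proof -
      have "\<gamma> \<in> U \<delta> \<longleftrightarrow> \<delta> = \<gamma>" using U[OF that] \<gamma> by (metis Int_iff singleton_iff)
      then show ?thesis by (auto simp: indicator_def)
    qed
    then show ?thesis unfolding g_def using \<Delta>(1) \<gamma> by simp
  qed
  ultimately show ?thesis by blast
qed

end

lemma inverse_of_nat_commutes:
  fixes b :: "'r::ring_1"
  assumes "of_nat n * b = 1" "b * of_nat n = 1"
  shows "b * r = r * b"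
proof -
  have "b * r = b * (r * (of_nat n * b))" using assms by simp
  also have "\<dots> = (b * of_nat n) * r * b" using mult_of_nat_commute[of n r] by (simp add: mult.assoc)
  finally show ?thesis using assms by simp
qed

section \<open>An averaged quasi-inverse over one orbit\<close>

context groupoid
begin

text \<open>
  Right convolution by \<open>f\<close> on the range fibre \<open>X\<close> of \<open>x\<close> is given by the matrix \<open>v\<close>. Averaging a
  quasi-inverse over the arrows from a given unit to \<open>x\<close>, of which there are as many as elements of
  the isotropy group, makes it equivariant, that is, right convolution by some \<open>g\<close>.
\<close>

lemma quasi_inverse_on_orbit:
  fixes f :: "'g \<Rightarrow> 'r::ring_1"
  assumes regular: "von_neumann_regular (UNIV :: 'r set) (*)"
    and x: "x \<in> \<X>"
    and fin: "\<And>y. finite {\<gamma> \<in> \<G>. \<r> \<gamma> = y}"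
    and unit: "invertible_element (of_nat (card {\<gamma> \<in> \<G>. \<s> \<gamma> = x \<and> \<r> \<gamma> = x}) :: 'r)"
  obtains g\<^sub>0 where "\<And>g \<eta> \<tau>. \<lbrakk>\<eta> \<in> \<G>; \<tau> \<in> \<G>; \<r> \<tau> = x; \<s> \<tau> = \<r> \<eta>;
      \<And>\<beta> \<tau>. \<lbrakk>\<beta> \<in> \<G>; \<tau> \<in> \<G>; \<r> \<tau> = x; \<s> \<tau> = \<r> \<beta>\<rbrakk> \<Longrightarrow> g \<beta> = g\<^sub>0 \<beta>\<rbrakk>
    \<Longrightarrow> conv (conv f g) f \<eta> = f \<eta>"
proof -
  define X where "X = {\<gamma> \<in> \<G>. \<r> \<gamma> = x}"
  have finX: "finite X" unfolding X_def by (rule fin)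
  have X: "\<gamma> \<in> \<G>" "\<r> \<gamma> = x" if "\<gamma> \<in> X" for \<gamma> using that unfolding X_def by auto
  \<comment> \<open>The rows are cut off outside the finite set \<open>X\<close>, so that the value
    of a functional on them is determined by its values on the unit vectors
    \<open>e \<gamma>\<close>.\<close>
  define v where "v \<tau> \<gamma> = (if \<gamma> \<in> X then f (\<m> (\<i> \<tau>) \<gamma>) else 0)" for \<tau> \<gamma>
  obtain N where N: "\<And>\<rho>. \<rho> \<in> X \<Longrightarrow> left_linear_functional (N \<rho>)"
    "\<And>\<tau> \<gamma>. \<tau> \<in> X \<Longrightarrow> \<gamma> \<in> X \<Longrightarrow> (\<Sum>\<rho>\<in>X. N \<rho> (v \<tau>) * v \<rho> \<gamma>) = v \<tau> \<gamma>"
    using regular_vectors[OF regular finX finX, of v] by metis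
  define e :: "'g \<Rightarrow> 'g \<Rightarrow> 'r" where "e \<gamma> = (\<lambda>\<delta>. if \<delta> = \<gamma> then 1 else 0)" for \<gamma>
  have N_v: "N \<rho> (v \<tau>) = (\<Sum>\<gamma>\<in>X. v \<tau> \<gamma> * N \<rho> (e \<gamma>))" if "\<rho> \<in> X" for \<rho> \<tau>
  proof -
    have "(\<lambda>\<delta>. \<Sum>\<gamma>\<in>X. v \<tau> \<gamma> * e \<gamma> \<delta>) = v \<tau>"
    proof
      fix \<delta>
      have "(\<Sum>\<gamma>\<in>X. v \<tau> \<gamma> * e \<gamma> \<delta>) = (\<Sum>\<gamma>\<in>X. if \<gamma> = \<delta> then v \<tau> \<delta> else 0)"
        by (intro sum.cong) (auto simp: e_def)
      then show "(\<Sum>\<gamma>\<in>X. v \<tau> \<gamma> * e \<gamma> \<delta>) = v \<tau> \<delta>" using finX by (simp add: v_def)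
    qed
    then show ?thesis using left_linear_functional_sum[OF N(1)[OF that] finX, of "v \<tau>" e] by simp
  qed
  define n where "n = card {\<gamma> \<in> \<G>. \<s> \<gamma> = x \<and> \<r> \<gamma> = x}"
  obtain \<kappa> :: 'r where \<kappa>: "of_nat n * \<kappa> = 1" "\<kappa> * of_nat n = 1"
    using unit unfolding invertible_element_def n_def by blast
  \<comment> \<open>\<open>N (\<m> \<gamma> \<beta>) (e \<gamma>)\<close> is the entry of the
    quasi-inverse in row \<gamma> and column \<gamma>\<beta>. For right convolution by
    \<open>g\<close> this entry is \<open>g \<beta>\<close>, independently of \<gamma>; averaging
    over \<gamma> produces such a matrix.\<close>
  define g\<^sub>0 where "g\<^sub>0 \<beta> = \<kappa> * (\<Sum>\<gamma>\<in>{\<gamma> \<in> X. \<s> \<gamma> = \<r> \<beta>}. N (\<m> \<gamma> \<beta>) (e \<gamma>))" for \<beta>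
  show ?thesis
  proof (rule that[of g\<^sub>0])
    \<comment> \<open>Since \<open>g\<^sub>0\<close> need not lie in the algebra, the claim concerns
      every \<open>g\<close> that agrees with it over the orbit. An arrow from the range of \<eta>
      to \<open>x\<close> expresses that \<eta> lies over the orbit.\<close>
    fix g \<eta> \<tau>\<^sub>0
    assume \<eta>: "\<eta> \<in> \<G>" and \<tau>\<^sub>0: "\<tau>\<^sub>0 \<in> \<G>" "\<r> \<tau>\<^sub>0 = x" "\<s> \<tau>\<^sub>0 = \<r> \<eta>"
      and g: "\<And>\<beta> \<tau>. \<lbrakk>\<beta> \<in> \<G>; \<tau> \<in> \<G>; \<r> \<tau> = x; \<s> \<tau> = \<r> \<beta>\<rbrakk> \<Longrightarrow> g \<beta> = g\<^sub>0 \<beta>"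
    define Y where "Y = {\<gamma> \<in> \<G>. \<r> \<gamma> = \<r> \<eta>}"
    have finY: "finite Y" unfolding Y_def by (rule fin)
    have Y: "\<gamma> \<in> \<G>" "\<r> \<gamma> = \<r> \<eta>" if "\<gamma> \<in> Y" for \<gamma> using that unfolding Y_def by auto
    define T where "T = {\<tau> \<in> X. \<s> \<tau> = \<r> \<eta>}"
    have T: "\<tau> \<in> X" "\<tau> \<in> \<G>" "\<r> \<tau> = x" "\<s> \<tau> = \<r> \<eta>" if "\<tau> \<in> T" for \<tau>
      using that X unfolding T_def by auto
    have bij: "bij_betw (\<m> \<tau>) Y X" if "\<tau> \<in> T" for \<tau>
    proof (rule bij_betw_byWitness[where f' = "\<m> (\<i> \<tau>)"])
      show "\<forall>a\<in>Y. \<m> (\<i> \<tau>) (\<m> \<tau> a) = a" using T[OF that] Y by simp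
      show "\<forall>a\<in>X. \<m> \<tau> (\<m> (\<i> \<tau>) a) = a" using T[OF that] X by simp
      show "\<m> \<tau> ` Y \<subseteq> X" unfolding X_def using T[OF that] Y by auto
      show "\<m> (\<i> \<tau>) ` X \<subseteq> Y" unfolding Y_def using T[OF that] X by auto
    qed
    \<comment> \<open>The arrows from the range of \<eta> to \<open>x\<close> form a torsor under
      the isotropy group of \<open>x\<close>.\<close>
    have cardT: "card T = n"
    proof -
      let ?K = "{\<gamma> \<in> \<G>. \<s> \<gamma> = x \<and> \<r> \<gamma> = x}"
      have "bij_betw (\<lambda>k. \<m> k \<tau>\<^sub>0) ?K T"
      proof (rule bij_betw_byWitness[where f' = "\<lambda>\<tau>. \<m> \<tau> (\<i> \<tau>\<^sub>0)"])
        show "\<forall>a\<in>?K. \<m> (\<m> a \<tau>\<^sub>0) (\<i> \<tau>\<^sub>0) = a" using \<tau>\<^sub>0 by simp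
        show "\<forall>a\<in>T. \<m> (\<m> a (\<i> \<tau>\<^sub>0)) \<tau>\<^sub>0 = a" using \<tau>\<^sub>0 T by simp
        show "(\<lambda>k. \<m> k \<tau>\<^sub>0) ` ?K \<subseteq> T" unfolding T_def X_def using \<tau>\<^sub>0 by auto
        show "(\<lambda>\<tau>. \<m> \<tau> (\<i> \<tau>\<^sub>0)) ` T \<subseteq> ?K" using \<tau>\<^sub>0 T by auto
      qed
      then show ?thesis unfolding n_def by (rule bij_betw_same_card[symmetric])
    qed
    \<comment> \<open>The arrows from the source of \<alpha> to \<open>x\<close> are the products
      \<tau>\<alpha> with \<tau> in \<open>T\<close>. So all averages run over one set, independent
      of \<alpha> and \<zeta>.\<close>
    have gY: "g (\<m> (\<i> \<alpha>) \<zeta>) = \<kappa> * (\<Sum>\<tau>\<in>T. N (\<m> \<tau> \<zeta>) (e (\<m> \<tau> \<alpha>)))"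
      if \<alpha>: "\<alpha> \<in> Y" and \<zeta>: "\<zeta> \<in> Y" for \<alpha> \<zeta>
    proof -
      note a = Y[OF \<alpha>] and z = Y[OF \<zeta>]
      let ?\<beta> = "\<m> (\<i> \<alpha>) \<zeta>"
      have \<beta>: "?\<beta> \<in> \<G>" "\<r> ?\<beta> = \<s> \<alpha>" using a z by auto
      have "g ?\<beta> = g\<^sub>0 ?\<beta>"
        by (rule g[of ?\<beta> "\<m> \<tau>\<^sub>0 \<alpha>"]) (use \<beta> a \<tau>\<^sub>0 in auto)
      also have "\<dots> = \<kappa> * (\<Sum>\<gamma>\<in>{\<gamma> \<in> X. \<s> \<gamma> = \<s> \<alpha>}. N (\<m> \<gamma> ?\<beta>) (e \<gamma>))"
        unfolding g\<^sub>0_def \<beta>(2) ..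
      also have "(\<Sum>\<gamma>\<in>{\<gamma> \<in> X. \<s> \<gamma> = \<s> \<alpha>}. N (\<m> \<gamma> ?\<beta>) (e \<gamma>)) =
          (\<Sum>\<tau>\<in>T. N (\<m> \<tau> \<zeta>) (e (\<m> \<tau> \<alpha>)))"
      proof (rule sum.reindex_bij_witness[where i = "\<lambda>\<tau>. \<m> \<tau> \<alpha>" and j = "\<lambda>\<gamma>. \<m> \<gamma> (\<i> \<alpha>)"])
        fix \<gamma> assume "\<gamma> \<in> {\<gamma> \<in> X. \<s> \<gamma> = \<s> \<alpha>}"
        then have \<gamma>: "\<gamma> \<in> \<G>" "\<r> \<gamma> = x" "\<s> \<gamma> = \<s> \<alpha>" using X by auto
        show eq: "\<m> (\<m> \<gamma> (\<i> \<alpha>)) \<alpha> = \<gamma>" using \<gamma> a by simp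
        show "\<m> \<gamma> (\<i> \<alpha>) \<in> T" unfolding T_def X_def using \<gamma> a by simp
        have "\<m> (\<m> \<gamma> (\<i> \<alpha>)) \<zeta> = \<m> \<gamma> ?\<beta>" using \<gamma> a z by (simp add: arrow_assoc)
        then show "N (\<m> (\<m> \<gamma> (\<i> \<alpha>)) \<zeta>) (e (\<m> (\<m> \<gamma> (\<i> \<alpha>)) \<alpha>)) =
          N (\<m> \<gamma> ?\<beta>) (e \<gamma>)" unfolding eq by simp
      next
        fix \<tau> assume "\<tau> \<in> T"
        note t = T[OF this]
        show "\<m> (\<m> \<tau> \<alpha>) (\<i> \<alpha>) = \<tau>" using t a by simp
        show "\<m> \<tau> \<alpha> \<in> {\<gamma> \<in> X. \<s> \<gamma> = \<s> \<alpha>}" unfolding X_def using t a by simp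
      qed
      finally show ?thesis .
    qed
    \<comment> \<open>Left translation by \<tau> carries sums over \<open>Y\<close> to sums over
      \<open>X\<close>, where they become the quasi-inverse identity of the matrix \<open>v\<close>.
      The value is the same for each \<tau>, so averaging preserves it.\<close>
    have per_\<tau>: "(\<Sum>\<zeta>\<in>Y. \<Sum>\<alpha>\<in>Y. f \<alpha> * N (\<m> \<tau> \<zeta>) (e (\<m> \<tau> \<alpha>)) * f (\<m> (\<i> \<zeta>) \<eta>)) = f \<eta>"
      if \<tau>: "\<tau> \<in> T" for \<tau>
    proof -
      note t = T[OF \<tau>]
      have t\<eta>: "\<m> \<tau> \<eta> \<in> X" unfolding X_def using t \<eta> by simp
      have "f (\<m> (\<i> \<zeta>) \<eta>) = v (\<m> \<tau> \<zeta>) (\<m> \<tau> \<eta>)" if "\<zeta> \<in> Y" for \<zeta>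
        using t\<eta> t Y[OF that] \<eta> by (simp add: v_def inv_mult_rev arrow_assoc)
      moreover have "f \<alpha> = v \<tau> (\<m> \<tau> \<alpha>)" if "\<alpha> \<in> Y" for \<alpha>
        using bij_betwE[OF bij[OF \<tau>]] that t Y[OF that] by (simp add: v_def)
      ultimately have "(\<Sum>\<zeta>\<in>Y. \<Sum>\<alpha>\<in>Y. f \<alpha> * N (\<m> \<tau> \<zeta>) (e (\<m> \<tau> \<alpha>)) * f (\<m> (\<i> \<zeta>) \<eta>)) =
        (\<Sum>\<zeta>\<in>Y. \<Sum>\<alpha>\<in>Y. v \<tau> (\<m> \<tau> \<alpha>) * N (\<m> \<tau> \<zeta>) (e (\<m> \<tau> \<alpha>)) *
          v (\<m> \<tau> \<zeta>) (\<m> \<tau> \<eta>))"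
        by (intro sum.cong) auto
      also have "\<dots> = (\<Sum>\<zeta>\<in>Y. \<Sum>\<gamma>\<in>X. v \<tau> \<gamma> * N (\<m> \<tau> \<zeta>) (e \<gamma>) * v (\<m> \<tau> \<zeta>) (\<m> \<tau> \<eta>))"
        by (rule sum.cong[OF refl]) (rule sum.reindex_bij_betw[OF bij[OF \<tau>]])
      also have "\<dots> = (\<Sum>\<rho>\<in>X. \<Sum>\<gamma>\<in>X. v \<tau> \<gamma> * N \<rho> (e \<gamma>) * v \<rho> (\<m> \<tau> \<eta>))"
        by (rule sum.reindex_bij_betw[OF bij[OF \<tau>]])
      also have "\<dots> = (\<Sum>\<rho>\<in>X. N \<rho> (v \<tau>) * v \<rho> (\<m> \<tau> \<eta>))"
        by (intro sum.cong) (simp_all add: N_v sum_distrib_right)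
      also have "\<dots> = v \<tau> (\<m> \<tau> \<eta>)" by (rule N(2)[OF t(1) t\<eta>])
      also have "\<dots> = f \<eta>" using t\<eta> t \<eta> by (simp add: v_def)
      finally show ?thesis .
    qed
    have "conv (conv f g) f \<eta> =
        (\<Sum>\<zeta>\<in>Y. conv f g \<zeta> * f (\<m> (\<i> \<zeta>) \<eta>))"
      by (rule convolution_eq[OF \<eta> finY]) (auto simp: Y_def)
    also have "\<dots> = (\<Sum>\<zeta>\<in>Y. (\<Sum>\<alpha>\<in>Y. f \<alpha> * g (\<m> (\<i> \<alpha>) \<zeta>)) * f (\<m> (\<i> \<zeta>) \<eta>))"
    proof (intro sum.cong refl arg_cong[where f = "\<lambda>a. a * _"])
      fix \<zeta> assume \<zeta>: "\<zeta> \<in> Y"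
      show "conv f g \<zeta> = (\<Sum>\<alpha>\<in>Y. f \<alpha> * g (\<m> (\<i> \<alpha>) \<zeta>))"
        by (rule convolution_eq[OF Y(1)[OF \<zeta>] finY]) (use Y(2)[OF \<zeta>] in \<open>auto simp: Y_def\<close>)
    qed
    also have "\<dots> = (\<Sum>\<zeta>\<in>Y. \<Sum>\<alpha>\<in>Y. \<Sum>\<tau>\<in>T.
        \<kappa> * (f \<alpha> * N (\<m> \<tau> \<zeta>) (e (\<m> \<tau> \<alpha>)) * f (\<m> (\<i> \<zeta>) \<eta>)))"
    proof (rule sum.cong[OF refl])
      fix \<zeta> assume \<zeta>: "\<zeta> \<in> Y"
      have "f \<alpha> * g (\<m> (\<i> \<alpha>) \<zeta>) * f (\<m> (\<i> \<zeta>) \<eta>) = (\<Sum>\<tau>\<in>T.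
        \<kappa> * (f \<alpha> * N (\<m> \<tau> \<zeta>) (e (\<m> \<tau> \<alpha>)) * f (\<m> (\<i> \<zeta>) \<eta>)))" if "\<alpha> \<in> Y" for \<alpha>
      proof -
        have "f \<alpha> * (\<kappa> * s) * k = \<kappa> * (f \<alpha> * s * k)" for s k
          using inverse_of_nat_commutes[OF \<kappa>, of "f \<alpha>"] by (metis mult.assoc)
        then show ?thesis unfolding gY[OF that \<zeta>] by (simp add: sum_distrib_left sum_distrib_right)
      qed
      then show "(\<Sum>\<alpha>\<in>Y. f \<alpha> * g (\<m> (\<i> \<alpha>) \<zeta>)) * f (\<m> (\<i> \<zeta>) \<eta>) = (\<Sum>\<alpha>\<in>Y. \<Sum>\<tau>\<in>T.
        \<kappa> * (f \<alpha> * N (\<m> \<tau> \<zeta>) (e (\<m> \<tau> \<alpha>)) * f (\<m> (\<i> \<zeta>) \<eta>)))"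
        unfolding sum_distrib_right by (intro sum.cong) auto
    qed
    also have "\<dots> = (\<Sum>\<zeta>\<in>Y. \<Sum>\<tau>\<in>T. \<Sum>\<alpha>\<in>Y.
        \<kappa> * (f \<alpha> * N (\<m> \<tau> \<zeta>) (e (\<m> \<tau> \<alpha>)) * f (\<m> (\<i> \<zeta>) \<eta>)))"
      by (intro sum.cong refl sum.swap)
    also have "\<dots> = (\<Sum>\<tau>\<in>T. \<Sum>\<zeta>\<in>Y. \<Sum>\<alpha>\<in>Y.
        \<kappa> * (f \<alpha> * N (\<m> \<tau> \<zeta>) (e (\<m> \<tau> \<alpha>)) * f (\<m> (\<i> \<zeta>) \<eta>)))"
      by (rule sum.swap)
    also have "\<dots> = (\<Sum>\<tau>\<in>T. \<kappa> * f \<eta>)"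
      by (rule sum.cong[OF refl]) (simp only: sum_distrib_left[symmetric] per_\<tau>)
    also have "\<dots> = of_nat n * \<kappa> * f \<eta>" using cardT by (simp add: mult.assoc)
    finally show "conv (conv f g) f \<eta> = f \<eta>" using \<kappa> by simp
  qed
qed

end

section \<open>Gluing quasi-inverses in a quasi-compact groupoid\<close>

locale quasi_compact_groupoid = bisection_groupoid +
  assumes compact_arrows: "compactin (gtop G) (arrows G)"
begin

lemma finite_src_fibre: "finite {\<gamma> \<in> \<G>. \<s> \<gamma> = x}"
proof -
  obtain \<V> where \<V>: "finite \<V>" "\<V> \<subseteq> \<B>" "\<G> \<subseteq> \<Union>\<V>"
    using compact_cover_bisections[OF compact_arrows] .
  show ?thesis
    by (rule finite_subset[OF _ source_fibre_bound(1)[OF \<V>(1,2), of x]]) (use \<V>(3) in blast)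
qed

lemma finite_rng_fibre: "finite {\<gamma> \<in> \<G>. \<r> \<gamma> = x}"
proof -
  have "{\<gamma> \<in> \<G>. \<r> \<gamma> = x} \<subseteq> \<i> ` {\<gamma> \<in> \<G>. \<s> \<gamma> = x}"
  proof
    fix \<gamma> assume "\<gamma> \<in> {\<gamma> \<in> \<G>. \<r> \<gamma> = x}"
    then have "\<gamma> = \<i> (\<i> \<gamma>)" "\<i> \<gamma> \<in> {\<gamma> \<in> \<G>. \<s> \<gamma> = x}" by auto
    then show "\<gamma> \<in> \<i> ` {\<gamma> \<in> \<G>. \<s> \<gamma> = x}" by (rule image_eqI)
  qed
  then show ?thesis using finite_src_fibre finite_subset by blast
qed

lemma compact_closed_subset:
  assumes "Q \<subseteq> \<G>" "openin \<T> (\<G> - Q)"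
  shows "compactin \<T> Q"
proof -
  have "closedin \<T> Q" using assms unfolding closedin_def arrows_def by blast
  then show ?thesis using closed_compactin[OF compact_arrows assms(1)] by blast
qed

text \<open>A compact open set \<open>M\<close> of units inside \<open>N'\<close> that contains the
  orbit is made invariant by removing the saturation \<open>B\<close> of its complement.
  \<open>B\<close> is clopen in the unit space: it is the image, under the open and continuous range
  map, of a set of arrows that is clopen and therefore compact.\<close>

lemma invariant_neighbourhood:
  assumes N': "openin \<T> N'" "N' \<subseteq> \<X>" and x: "x \<in> \<X>"
    and orbit: "\<And>\<gamma>. \<gamma> \<in> \<G> \<Longrightarrow> \<s> \<gamma> = x \<Longrightarrow> \<r> \<gamma> \<in> N'"
  obtains N where "openin \<T> N" "openin \<T> (\<X> - N)" "x \<in> N" "N \<subseteq> N'"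
    "\<forall>\<gamma>\<in>\<G>. \<s> \<gamma> \<in> N \<longleftrightarrow> \<r> \<gamma> \<in> N"
proof -
  define O' where "O' = \<r> ` {\<gamma> \<in> \<G>. \<s> \<gamma> = x}"
  have fin: "finite O'" and sub: "O' \<subseteq> N'" unfolding O'_def using finite_src_fibre orbit by auto
  have "\<exists>U\<in>\<B>. y \<in> U \<and> U \<subseteq> N'" if "y \<in> O'" for y
  proof -
    have "y \<in> N'" using sub that by blast
    then show ?thesis using bisections_basis[OF N'(1)] by metis
  qed
  then obtain U where U: "\<And>y. y \<in> O' \<Longrightarrow> U y \<in> \<B> \<and> y \<in> U y \<and> U y \<subseteq> N'" by metis
  define M where "M = \<Union>(U ` O')"
  have M_sub: "M \<subseteq> N'" "O' \<subseteq> M" unfolding M_def using U by auto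
  have M: "compactin \<T> M" "openin \<T> M"
    unfolding M_def using compact_Union_bisections[of "U ` O'"] fin U by auto
  define Q where "Q = {\<gamma> \<in> \<G>. \<s> \<gamma> \<in> \<X> - M}"
  have "openin \<T> (\<X> - M)"
    using open_units_minus_compact[OF M(1)] M_sub(1) N'(2) by blast
  then have Q_open: "openin \<T> Q" unfolding Q_def by (rule openin_src_vimage)
  have "\<G> - Q = {\<gamma> \<in> \<G>. \<s> \<gamma> \<in> M}" unfolding Q_def by auto
  then have "openin \<T> (\<G> - Q)" using openin_src_vimage[OF M(2)] by simp
  then have Q_compact: "compactin \<T> Q" using compact_closed_subset Q_def by auto
  define B where "B = \<r> ` Q"
  have B: "B \<subseteq> \<X>" "openin \<T> B" "compactin \<T> B"
    unfolding B_def using open_rng[OF Q_open] image_compactin[OF Q_compact continuous_map_rng]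
    by (auto simp: Q_def)
  have M_units: "M \<subseteq> \<X>" using M_sub(1) N'(2) by blast
  have B_step: "\<r> \<delta> \<in> B" if \<delta>: "\<delta> \<in> \<G>" "\<s> \<delta> \<in> B" for \<delta>
  proof -
    obtain \<gamma> where \<gamma>: "\<gamma> \<in> \<G>" "\<s> \<gamma> \<in> \<X> - M" "\<s> \<delta> = \<r> \<gamma>"
      using \<delta>(2) unfolding B_def Q_def by auto
    have "\<m> \<delta> \<gamma> \<in> Q" unfolding Q_def using \<gamma> \<delta>(1) by simp
    moreover have "\<r> (\<m> \<delta> \<gamma>) = \<r> \<delta>" using \<gamma> \<delta>(1) by simp
    ultimately show ?thesis unfolding B_def by (metis imageI)
  qed
  show ?thesis
  proof (rule that[of "\<X> - B"])
    show "openin \<T> (\<X> - B)" using open_units_minus_compact B by blast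
    have "\<X> - (\<X> - B) = B" using B(1) by blast
    then show "openin \<T> (\<X> - (\<X> - B))" using B(2) by simp
    show "x \<in> \<X> - B"
    proof
      show "x \<notin> B"
      proof
        assume "x \<in> B"
        then obtain \<gamma> where \<gamma>: "\<gamma> \<in> \<G>" "\<s> \<gamma> \<in> \<X> - M" "x = \<r> \<gamma>"
          unfolding B_def Q_def by auto
        have "\<r> (\<i> \<gamma>) \<in> O'" unfolding O'_def by (rule imageI) (use \<gamma> in simp)
        then show False using \<gamma>(1,2) M_sub(2) by auto
      qed
    qed (rule x)
    show "\<X> - B \<subseteq> N'"
    proof
      fix y assume y: "y \<in> \<X> - B"
      have "y \<in> M"
      proof (rule ccontr)
        assume "y \<notin> M"
        then have "y \<in> Q" unfolding Q_def using y by simp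
        then have "\<r> y \<in> B" unfolding B_def by (rule imageI)
        then show False using y by simp
      qed
      then show "y \<in> N'" using M_sub(1) by blast
    qed
    show "\<forall>\<gamma>\<in>\<G>. \<s> \<gamma> \<in> \<X> - B \<longleftrightarrow> \<r> \<gamma> \<in> \<X> - B"
    proof
      fix \<gamma> assume \<gamma>: "\<gamma> \<in> \<G>"
      have "\<s> \<gamma> \<in> B \<longleftrightarrow> \<r> \<gamma> \<in> B" using B_step[OF \<gamma>] B_step[of "\<i> \<gamma>"] \<gamma> by auto
      then show "\<s> \<gamma> \<in> \<X> - B \<longleftrightarrow> \<r> \<gamma> \<in> \<X> - B" using \<gamma> by simp
    qed
  qed
qed

text \<open>Clopenness and invariance belong to the notion because they allow a solution over one
  set of units to be cut off and combined with a solution over another.\<close>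

definition solvable_over :: "('a \<Rightarrow> 'r::ring_1) \<Rightarrow> 'a set \<Rightarrow> bool" where
  "solvable_over f N \<longleftrightarrow> openin \<T> N \<and> openin \<T> (\<X> - N) \<and> N \<subseteq> \<X> \<and>
     (\<forall>\<gamma>\<in>\<G>. \<s> \<gamma> \<in> N \<longleftrightarrow> \<r> \<gamma> \<in> N) \<and>
     (\<exists>g\<in>alg. \<forall>\<eta>\<in>\<G>. \<s> \<eta> \<in> N \<longrightarrow>
       conv (conv f g) f \<eta> = f \<eta>)"

lemma solvable_over_Un:
  fixes f :: "'a \<Rightarrow> 'r::ring_1"
  assumes A: "solvable_over f A" and B: "solvable_over f B"
  shows "solvable_over f (A \<union> B)"
proof -
  obtain gA where gA: "gA \<in> alg" "\<And>\<eta>. \<eta> \<in> \<G> \<Longrightarrow> \<s> \<eta> \<in> A \<Longrightarrow>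
       conv (conv f gA) f \<eta> = f \<eta>"
    using A unfolding solvable_over_def by blast
  obtain gB where gB: "gB \<in> alg" "\<And>\<eta>. \<eta> \<in> \<G> \<Longrightarrow> \<s> \<eta> \<in> B \<Longrightarrow>
       conv (conv f gB) f \<eta> = f \<eta>"
    using B unfolding solvable_over_def by blast
  have invA: "\<s> \<gamma> \<in> A \<longleftrightarrow> \<r> \<gamma> \<in> A" and invB: "\<s> \<gamma> \<in> B \<longleftrightarrow> \<r> \<gamma> \<in> B"
    if "\<gamma> \<in> \<G>" for \<gamma>
    using that A B unfolding solvable_over_def by auto
  have opA: "openin \<T> A" "openin \<T> (\<X> - A)" "A \<subseteq> \<X>"
    and opB: "openin \<T> B" "openin \<T> (\<X> - B)" "B \<subseteq> \<X>"
    using A B unfolding solvable_over_def by auto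
  define D where "D = {\<gamma> \<in> \<G>. \<s> \<gamma> \<in> A}"
  define D' where "D' = {\<gamma> \<in> \<G>. \<s> \<gamma> \<in> \<X> - A}"
  have D: "openin \<T> D" "openin \<T> D'" "\<G> - D = D'" "\<G> - D' = D"
    unfolding D_def D'_def using openin_src_vimage[OF opA(1)] openin_src_vimage[OF opA(2)] by auto
  \<comment> \<open>\<open>gA\<close> is used over all of \<open>A\<close>, and \<open>gB\<close>
    over the remaining units; cutting off along clopen sets stays in the algebra.\<close>
  define g where "g = (\<lambda>\<gamma>. if \<gamma> \<in> D then gA \<gamma> else 0) + (\<lambda>\<gamma>. if \<gamma> \<in> D' then gB \<gamma> else 0)"
  have "(\<lambda>\<gamma>. if \<gamma> \<in> D then gA \<gamma> else 0) \<in> alg"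
    using algebra_restrict_clopen[OF gA(1)] D by simp
  moreover have "(\<lambda>\<gamma>. if \<gamma> \<in> D' then gB \<gamma> else 0) \<in> alg"
    using algebra_restrict_clopen[OF gB(1)] D by simp
  ultimately have "g \<in> alg"
    unfolding g_def groupoid_algebra_def by (rule left_span_add)
  moreover have "conv (conv f g) f \<eta> = f \<eta>"
    if \<eta>: "\<eta> \<in> \<G>" "\<s> \<eta> \<in> A \<union> B" for \<eta>
  proof (cases "\<s> \<eta> \<in> A")
    case True
    have "g \<gamma> = gA \<gamma>" if "\<gamma> \<in> \<G>" "\<s> \<gamma> \<in> A" for \<gamma>
      using that unfolding g_def D_def D'_def by simp
    then have "conv f g \<gamma> = conv f gA \<gamma>" if "\<s> \<gamma> \<in> A" for \<gamma>
      using convolution_local[of A \<gamma> f f g gA, OF invA that] by blast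
    then have "conv (conv f g) f \<eta> = conv (conv f gA) f \<eta>"
      using convolution_local[of A \<eta> "conv f g" "conv f gA" f f, OF invA True] by blast
    then show ?thesis using gA(2)[OF \<eta>(1) True] by simp
  next
    case False
    then have BA: "\<s> \<eta> \<in> B - A" using \<eta>(2) by blast
    have inv: "\<s> \<gamma> \<in> B - A \<longleftrightarrow> \<r> \<gamma> \<in> B - A" if "\<gamma> \<in> \<G>" for \<gamma>
      using invA[OF that] invB[OF that] by simp
    have "g \<gamma> = gB \<gamma>" if "\<gamma> \<in> \<G>" "\<s> \<gamma> \<in> B - A" for \<gamma>
      using that unfolding g_def D_def D'_def by simp
    then have "conv f g \<gamma> = conv f gB \<gamma>" if "\<s> \<gamma> \<in> B - A" for \<gamma>
      using convolution_local[of "B - A" \<gamma> f f g gB, OF inv that] by blast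
    then have "conv (conv f g) f \<eta> = conv (conv f gB) f \<eta>"
      using convolution_local[of "B - A" \<eta> "conv f g" "conv f gB" f f, OF inv BA] by blast
    then show ?thesis using gB(2)[OF \<eta>(1)] BA by simp
  qed
  moreover have "openin \<T> (A \<union> B)" using opA opB by blast
  moreover have "openin \<T> (\<X> - (A \<union> B))"
  proof -
    have "\<X> - (A \<union> B) = (\<X> - A) \<inter> (\<X> - B)" by blast
    then show ?thesis using opA opB openin_Int by metis
  qed
  moreover have "A \<union> B \<subseteq> \<X>" using opA opB by blast
  moreover have "\<forall>\<gamma>\<in>\<G>. \<s> \<gamma> \<in> A \<union> B \<longleftrightarrow> \<r> \<gamma> \<in> A \<union> B" using invA invB by simp
  ultimately show ?thesis unfolding solvable_over_def by blast
qed

text \<open>Interpolation on the finitely many arrows over the orbit brings the averaged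
  quasi-inverse into the algebra. The defect \<open>k\<close> then vanishes near each of the
  finitely many source fibres over the orbit.\<close>

lemma solvable_over_nhd:
  fixes f :: "'a \<Rightarrow> 'r::ring_1"
  assumes regular: "von_neumann_regular (UNIV :: 'r set) (*)"
    and f: "f \<in> alg" and x: "x \<in> \<X>"
    and unit: "invertible_element (of_nat (card {\<gamma> \<in> \<G>. \<s> \<gamma> = x \<and> \<r> \<gamma> = x}) :: 'r)"
  shows "\<exists>N. x \<in> N \<and> solvable_over f N"
proof -
  interpret A: nonunital_ring "alg :: ('a \<Rightarrow> 'r) set" "conv"
    by (rule nonunital_ring_groupoid_algebra)
  obtain g\<^sub>0 where g\<^sub>0: "\<And>g \<eta> \<tau>. \<lbrakk>\<eta> \<in> \<G>; \<tau> \<in> \<G>; \<r> \<tau> = x; \<s> \<tau> = \<r> \<eta>;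
      \<And>\<beta> \<tau>. \<lbrakk>\<beta> \<in> \<G>; \<tau> \<in> \<G>; \<r> \<tau> = x; \<s> \<tau> = \<r> \<beta>\<rbrakk> \<Longrightarrow> g \<beta> = g\<^sub>0 \<beta>\<rbrakk>
    \<Longrightarrow> conv (conv f g) f \<eta> = f \<eta>"
    using quasi_inverse_on_orbit[OF regular x finite_rng_fibre unit, of f] by metis
  define \<Delta> where "\<Delta> = (\<Union>\<tau>\<in>{\<tau> \<in> \<G>. \<r> \<tau> = x}. {\<beta> \<in> \<G>. \<r> \<beta> = \<s> \<tau>})"
  have "finite \<Delta>" "\<Delta> \<subseteq> \<G>" unfolding \<Delta>_def using finite_rng_fibre by auto
  then obtain g where g: "g \<in> alg" "\<And>\<delta>. \<delta> \<in> \<Delta> \<Longrightarrow> g \<delta> = g\<^sub>0 \<delta>"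
    using interpolation[of \<Delta> g\<^sub>0] by blast
  define k where "k = conv (conv f g) f - f"
  have k: "k \<in> alg" unfolding k_def by (intro A.diff_closed A.mult_closed f g(1))
  have k_zero: "k \<eta> = 0" if "\<eta> \<in> \<G>" "\<tau> \<in> \<G>" "\<r> \<tau> = x" "\<s> \<tau> = \<r> \<eta>" for \<eta> \<tau>
  proof -
    have "g \<beta> = g\<^sub>0 \<beta>" if "\<beta> \<in> \<G>" "\<tau> \<in> \<G>" "\<r> \<tau> = x" "\<s> \<tau> = \<r> \<beta>" for \<beta> \<tau>
      by (rule g(2)) (use that in \<open>auto simp: \<Delta>_def\<close>)
    then have "conv (conv f g) f \<eta> = f \<eta>" using g\<^sub>0[OF that] by blast
    then show ?thesis unfolding k_def by simp
  qed
  define O' where "O' = \<r> ` {\<gamma> \<in> \<G>. \<s> \<gamma> = x}"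
  have "\<exists>N. openin \<T> N \<and> y \<in> N \<and> N \<subseteq> \<X> \<and> (\<forall>\<eta>\<in>\<G>. \<s> \<eta> \<in> N \<longrightarrow> k \<eta> = 0)"
    if y: "y \<in> O'" for y
  proof -
    obtain \<gamma> where \<gamma>: "\<gamma> \<in> \<G>" "\<s> \<gamma> = x" "\<r> \<gamma> = y" using y unfolding O'_def by blast
    have "k \<eta> = 0" if "\<eta> \<in> \<G>" "\<s> \<eta> = y" for \<eta>
      \<comment> \<open>The product \<eta>\<gamma> leads from \<open>x\<close> to the range of
        \<eta>; its inverse is the required arrow into \<open>x\<close>.\<close>
      by (rule k_zero[OF that(1), of "\<i> (\<m> \<eta> \<gamma>)"]) (use \<gamma> that in auto)
    moreover have "y \<in> \<X>" using \<gamma> by auto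
    ultimately show ?thesis using vanishing_near_fibre[OF k _ finite_src_fibre, of y] by metis
  qed
  then obtain P where P: "\<And>y. y \<in> O' \<Longrightarrow> openin \<T> (P y) \<and> y \<in> P y \<and> P y \<subseteq> \<X> \<and>
      (\<forall>\<eta>\<in>\<G>. \<s> \<eta> \<in> P y \<longrightarrow> k \<eta> = 0)" by metis
  define N' where "N' = \<Union>(P ` O')"
  have N': "openin \<T> N'" "N' \<subseteq> \<X>" unfolding N'_def using P by auto
  have orbit: "\<r> \<gamma> \<in> N'" if "\<gamma> \<in> \<G>" "\<s> \<gamma> = x" for \<gamma>
  proof -
    have "\<r> \<gamma> \<in> O'" unfolding O'_def using that by blast
    then show ?thesis unfolding N'_def using P by blast
  qed
  obtain N where N: "openin \<T> N" "openin \<T> (\<X> - N)" "x \<in> N" "N \<subseteq> N'"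
    "\<forall>\<gamma>\<in>\<G>. \<s> \<gamma> \<in> N \<longleftrightarrow> \<r> \<gamma> \<in> N"
    using invariant_neighbourhood[OF N' x orbit] .
  have "conv (conv f g) f \<eta> = f \<eta>" if \<eta>: "\<eta> \<in> \<G>" "\<s> \<eta> \<in> N" for \<eta>
  proof -
    obtain y where "y \<in> O'" "\<s> \<eta> \<in> P y" using \<eta>(2) N(4) unfolding N'_def by blast
    then have "k \<eta> = 0" using P \<eta>(1) by blast
    then show ?thesis unfolding k_def by simp
  qed
  then have "solvable_over f N" unfolding solvable_over_def using N N'(2) g(1) by blast
  then show ?thesis using N(3) by blast
qed

lemma quasi_compact_regular_algebra:
  assumes regular: "von_neumann_regular (UNIV :: 'r::ring_1 set) (*)"
    and unit: "\<And>x. x \<in> \<X> \<Longrightarrow>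
      invertible_element (of_nat (card {\<gamma> \<in> \<G>. \<s> \<gamma> = x \<and> \<r> \<gamma> = x}) :: 'r)"
  shows "von_neumann_regular (alg :: ('a \<Rightarrow> 'r) set) (conv)"
  unfolding von_neumann_regular_def
proof
  fix f :: "'a \<Rightarrow> 'r" assume f: "f \<in> alg"
  have "\<exists>N. x \<in> N \<and> solvable_over f N" if "x \<in> \<X>" for x
    using solvable_over_nhd[OF regular f that unit[OF that]] .
  then obtain N where N: "\<And>x. x \<in> \<X> \<Longrightarrow> x \<in> N x \<and> solvable_over f (N x)" by metis
  have "compactin \<T> (\<X>)"
    using image_compactin[OF compact_arrows continuous_map_rng] unfolding units_eq_rng_image .
  moreover have "\<forall>V\<in>N ` \<X>. openin \<T> V" using N unfolding solvable_over_def by blast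
  moreover have "\<X> \<subseteq> \<Union>(N ` \<X>)" using N by blast
  ultimately obtain \<F> where \<F>: "finite \<F>" "\<F> \<subseteq> N ` \<X>" "\<X> \<subseteq> \<Union>\<F>"
    unfolding compactin_def by meson
  have "solvable_over f (\<Union>\<F>)" if "\<F> \<noteq> {}"
    using \<F>(1) that \<F>(2)
  proof (induction rule: finite_ne_induct)
    case (singleton V)
    then show ?case using N by auto
  next
    case (insert V \<F>)
    then have "solvable_over f V" using N by auto
    then show ?case using solvable_over_Un insert by simp
  qed
  moreover have "\<F> \<noteq> {}" using \<F>(3) arrows_nonempty rng_unit by blast
  ultimately have "solvable_over f (\<Union>\<F>)" by blast
  then obtain g where g: "g \<in> alg" "\<And>\<eta>. \<eta> \<in> \<G> \<Longrightarrow> \<s> \<eta> \<in> \<Union>\<F> \<Longrightarrow>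
      conv (conv f g) f \<eta> = f \<eta>"
    unfolding solvable_over_def by metis
  have "conv (conv f g) f \<eta> = f \<eta>" for \<eta>
  proof (cases "\<eta> \<in> \<G>")
    case True
    then have "\<s> \<eta> \<in> \<Union>\<F>" using \<F>(3) src_unit by blast
    then show ?thesis by (rule g(2)[OF True])
  next
    case False
    then have "f \<eta> = 0" using fibre_finiteD(1)[OF fibre_finite_algebra[OF f], of \<eta>] by blast
    then show ?thesis using False by (simp add: convolution_outside)
  qed
  then show "\<exists>b\<in>alg. conv (conv f b) f = f" using g(1) by blast
qed

end

section \<open>Isotropy groups and passage to directed unions\<close>

context groupoid
begin

lemma group_isotropy_group:
  assumes "x \<in> \<X>"
  shows "group (isotropy_group G x)"
proof (rule groupI)
  fix \<gamma> assume "\<gamma> \<in> carrier (isotropy_group G x)"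
  then show "\<exists>\<delta>\<in>carrier (isotropy_group G x). \<delta> \<otimes>\<^bsub>isotropy_group G x\<^esub> \<gamma> = \<one>\<^bsub>isotropy_group G x\<^esub>"
    by (intro bexI[of _ "\<i> \<gamma>"]) (auto simp: isotropy_group_def)
next
  fix \<gamma> assume "\<gamma> \<in> carrier (isotropy_group G x)"
  then show "\<one>\<^bsub>isotropy_group G x\<^esub> \<otimes>\<^bsub>isotropy_group G x\<^esub> \<gamma> = \<gamma>"
    using rng_mult_self[of \<gamma>] by (simp add: isotropy_group_def)
qed (use assms in \<open>auto simp: isotropy_group_def arrow_assoc\<close>)

end

text \<open>This passes the condition on orders of finite subgroups down to the isotropy groups of a
  subgroupoid, which are finite when the latter is quasi-compact.\<close>

lemma (in open_subgroupoid) subgroup_isotropy: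
  assumes "x \<in> gunits K"
  shows "subgroup {\<gamma> \<in> S. gsrc G \<gamma> = x \<and> grng G \<gamma> = x} (isotropy_group G x)"
proof -
  have x: "x \<in> gunits G" "x \<in> S" using assms gunits_K by auto
  interpret I: group "isotropy_group G x" using x by (intro group_isotropy_group)
  show ?thesis
  proof (rule I.subgroupI)
    show "{\<gamma> \<in> S. gsrc G \<gamma> = x \<and> grng G \<gamma> = x} \<noteq> {}" using x unitsD by blast
    fix \<gamma> assume \<gamma>: "\<gamma> \<in> {\<gamma> \<in> S. gsrc G \<gamma> = x \<and> grng G \<gamma> = x}"
    have "inv\<^bsub>isotropy_group G x\<^esub> \<gamma> = ginv G \<gamma>"
      using \<gamma> by (intro I.inv_equality) (auto simp: isotropy_group_def)
    then show "inv\<^bsub>isotropy_group G x\<^esub> \<gamma> \<in> {\<gamma> \<in> S. gsrc G \<gamma> = x \<and> grng G \<gamma> = x}"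
      using \<gamma> by simp
  qed (auto simp: isotropy_group_def)
qed

lemma finite_directed_Union:
  assumes "finite \<A>" "\<A> \<subseteq> \<F>" "\<F> \<noteq> {}" "\<forall>S\<in>\<F>. \<forall>T\<in>\<F>. \<exists>W\<in>\<F>. S \<union> T \<subseteq> W"
  shows "\<exists>W\<in>\<F>. \<Union>\<A> \<subseteq> W"
  using assms(1,2)
proof (induction \<A>)
  case empty
  then show ?case using assms(3) by auto
next
  case (insert S \<A>)
  then obtain W where "W \<in> \<F>" "\<Union>\<A> \<subseteq> W" by auto
  moreover obtain W' where "W' \<in> \<F>" "S \<union> W \<subseteq> W'" using assms(4) insert.prems \<open>W \<in> \<F>\<close> by blast
  ultimately show ?case by (intro bexI[of _ W']) auto
qed

context bisection_groupoid
begin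

text \<open>One member \<open>S\<close> of the directed family contains finitely many bisections
  that span \<open>f\<close>, so a quasi-inverse can be found in the algebra of \<open>S\<close>.
  The isotropy groups of \<open>S\<close> lie in finite source fibres, so the hypothesis on orders
  applies to them.\<close>

lemma regular_algebraI:
  assumes regular: "von_neumann_regular (UNIV :: 'r::ring_1 set) (*)"
    and aqc: "approximately_quasi_compact G"
    and unit: "\<And>x K. x \<in> \<X> \<Longrightarrow> subgroup K (isotropy_group G x) \<Longrightarrow> finite K \<Longrightarrow>
      invertible_element (of_nat (card K) :: 'r)"
  shows "von_neumann_regular (alg :: ('a \<Rightarrow> 'r) set) (conv)"
  unfolding von_neumann_regular_def
proof
  fix f :: "'a \<Rightarrow> 'r" assume f: "f \<in> alg"
  obtain \<F> where \<F>: "\<F> \<noteq> {}" "\<forall>S\<in>\<F>. subgroupoid S G \<and> openin \<T> S \<and> compactin \<T> S"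
    "\<forall>S\<in>\<F>. \<forall>T\<in>\<F>. \<exists>W\<in>\<F>. S \<union> T \<subseteq> W" "\<Union>\<F> = \<G>"
    using aqc unfolding approximately_quasi_compact_def by (elim exE conjE)
  obtain \<U> where \<U>: "finite \<U>" "\<U> \<subseteq> \<B>" "f \<in> span_of \<U>" "{\<gamma>. f \<gamma> \<noteq> 0} \<subseteq> \<Union>\<U>"
    using algebra_support[OF f[unfolded groupoid_algebra_def]] .
  have "compactin \<T> (\<Union>\<U>)" using compact_Union_bisections[OF \<U>(1,2)] by blast
  moreover have "\<forall>S\<in>\<F>. openin \<T> S" using \<F>(2) by blast
  moreover have "\<Union>\<U> \<subseteq> \<Union>\<F>" unfolding \<F>(4) using \<U>(2) bisectionsD(5) by blast
  ultimately obtain \<A> where \<A>: "finite \<A>" "\<A> \<subseteq> \<F>" "\<Union>\<U> \<subseteq> \<Union>\<A>"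
    unfolding compactin_def by meson
  obtain S where S: "S \<in> \<F>" "\<Union>\<A> \<subseteq> S"
    using finite_directed_Union[OF \<A>(1,2) \<F>(1,3)] by (elim bexE)
  interpret S: open_subgroupoid G S
    using bspec[OF \<F>(2) S(1)] by unfold_locales auto
  interpret K: bisection_groupoid S.K by (rule S.bisection_groupoid_K)
  interpret K: quasi_compact_groupoid S.K
    using bspec[OF \<F>(2) S(1)] S.compactin_K by unfold_locales auto
  have "von_neumann_regular (groupoid_algebra S.K :: ('a \<Rightarrow> 'r) set) (convolution S.K)"
  proof (rule K.quasi_compact_regular_algebra[OF regular])
    fix x assume x: "x \<in> gunits S.K"
    have "finite {\<gamma> \<in> arrows S.K. gsrc S.K \<gamma> = x \<and> grng S.K \<gamma> = x}"
      by (rule finite_subset[OF _ K.finite_src_fibre[of x]]) blast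
    then show "invertible_element (of_nat (card {\<gamma> \<in> arrows S.K. gsrc S.K \<gamma> = x \<and> grng S.K \<gamma> = x}) :: 'r)"
      using unit[OF _ S.subgroup_isotropy[OF x]] x S.gunits_K by simp
  qed
  moreover have fK: "f \<in> groupoid_algebra S.K"
  proof -
    have "\<U> \<subseteq> {U \<in> \<B>. U \<subseteq> S}" using \<U>(2) \<A>(3) S(2) by blast
    then show ?thesis unfolding S.groupoid_algebra_K using left_span_mono[OF image_mono] \<U>(3) by blast
  qed
  ultimately obtain g where g: "g \<in> groupoid_algebra S.K"
    "convolution S.K (convolution S.K f g) f = f"
    unfolding von_neumann_regular_def by blast
  interpret A: nonunital_ring "groupoid_algebra S.K :: ('a \<Rightarrow> 'r) set" "convolution S.K"
    by (rule K.nonunital_ring_groupoid_algebra)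
  have eq: "convolution S.K f' g' = conv f' g'"
    if "f' \<in> groupoid_algebra S.K" "g' \<in> groupoid_algebra S.K" for f' g' :: "'a \<Rightarrow> 'r"
    using that S.algebra_K_support by (intro S.convolution_K) blast+
  have "conv (conv f g) f = f"
    using g(2) eq[OF fK g(1)] eq[OF A.mult_closed[OF fK g(1)] fK] by simp
  moreover have "g \<in> alg" using g(1) S.groupoid_algebra_K_subset by blast
  ultimately show "\<exists>b\<in>alg. conv (conv f b) f = f" by blast
qed

end

section \<open>Gradings\<close>

locale graded_groupoid = bisection_groupoid +
  fixes H :: "('h, 'm) monoid_scheme" (structure) and c :: "'a \<Rightarrow> 'h"
  assumes group_H: "group H" and cocycle: "continuous_cocycle G H c"
begin

abbreviation fibre ("\<F>") where "\<F> \<equiv> cocycle_fibre G c"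
abbreviation homogeneous ("\<A>") where "\<A> \<equiv> algebra_component G c"

sublocale H: group H by (rule group_H)

lemma cocycle_closed [simp]: "\<gamma> \<in> \<G> \<Longrightarrow> c \<gamma> \<in> carrier H"
  using cocycle continuous_map_image_subset_topspace[of "gtop G" "discrete_topology (carrier H)" c]
  unfolding continuous_cocycle_def arrows_def by auto

lemma cocycle_mult:
  assumes "\<alpha> \<in> \<G>" "\<beta> \<in> \<G>" "\<s> \<alpha> = \<r> \<beta>"
  shows "c (\<m> \<alpha> \<beta>) = c \<alpha> \<otimes> c \<beta>"
  using cocycle assms unfolding continuous_cocycle_def composable_def by blast

lemma cocycle_unit:
  assumes x: "x \<in> \<X>"
  shows "c x = \<one>"
proof -
  have "\<m> x x = x" using x rng_mult_self[of x] by simp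
  then have "c x \<otimes> c x = c x" using cocycle_mult[of x x] x by simp
  then show ?thesis using x by (simp add: H.r_cancel_one)
qed

lemma cocycle_inv:
  assumes "\<gamma> \<in> \<G>"
  shows "c (\<i> \<gamma>) = inv c \<gamma>"
proof -
  have "c (\<i> \<gamma>) \<otimes> c \<gamma> = \<one>"
    using cocycle_mult[of "\<i> \<gamma>" \<gamma>] cocycle_unit[of "\<s> \<gamma>"] assms by simp
  then show ?thesis using assms H.inv_equality by simp
qed

lemma open_cocycle_vimage: "openin \<T> {\<gamma> \<in> \<G>. c \<gamma> \<in> B}"
proof -
  have "openin \<T> {\<gamma> \<in> topspace \<T>. c \<gamma> \<in> B \<inter> carrier H}"
    using cocycle unfolding continuous_cocycle_def
    by (intro openin_continuous_map_preimage[where Y = "discrete_topology (carrier H)"]) auto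
  moreover have "{\<gamma> \<in> topspace \<T>. c \<gamma> \<in> B \<inter> carrier H} = {\<gamma> \<in> \<G>. c \<gamma> \<in> B}"
    using cocycle_closed unfolding arrows_def by auto
  ultimately show ?thesis by simp
qed

lemma open_cocycle_fibre:
  "openin \<T> (\<F> h)" "openin \<T> (\<G> - \<F> h)"
proof -
  have "\<F> h = {\<gamma> \<in> \<G>. c \<gamma> \<in> {h}}"
    "\<G> - \<F> h = {\<gamma> \<in> \<G>. c \<gamma> \<in> - {h}}"
    unfolding cocycle_fibre_def by auto
  then show "openin \<T> (\<F> h)" "openin \<T> (\<G> - \<F> h)"
    using open_cocycle_vimage by metis+
qed

lemma open_subgroupoid_kernel: "open_subgroupoid G (\<F> \<one>)"
proof
  show "openin \<T> (\<F> \<one>)" by (rule open_cocycle_fibre)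
  show "subgroupoid (\<F> \<one>) G"
    unfolding subgroupoid_def
  proof (intro conjI ballI impI)
    obtain \<gamma> where "\<gamma> \<in> \<G>" using arrows_nonempty by blast
    then have "\<r> \<gamma> \<in> \<F> \<one>"
      using cocycle_unit[OF rng_unit] by (simp add: cocycle_fibre_def)
    then show "\<F> \<one> \<noteq> {}" by blast
  qed (auto simp: cocycle_fibre_def cocycle_inv cocycle_mult composable_def)
qed

end

sublocale graded_groupoid \<subseteq> kernel: open_subgroupoid G "cocycle_fibre G c \<one>"
  by (rule open_subgroupoid_kernel)

section \<open>Homogeneous components and the component of degree \<open>\<one>\<close>\<close>

context graded_groupoid
begin

lemma kernel_groupoid_eq: "kernel_groupoid G H c = kernel.K"
  unfolding kernel_groupoid_def ..

lemma kernel_algebra_eq: "groupoid_algebra kernel.K = \<A> \<one>"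
  unfolding kernel.groupoid_algebra_K algebra_component_def ..

lemma component_subset: "\<A> h \<subseteq> alg"
  unfolding algebra_component_def groupoid_algebra_def by (intro left_span_mono) auto

lemma component_fibre_finite: "f \<in> \<A> h \<Longrightarrow> fibre_finite G f"
  using component_subset fibre_finite_algebra by blast

lemma product_fibre:
  assumes "U \<subseteq> \<F> g" "V \<subseteq> \<F> h"
  shows "product_set G U V \<subseteq> \<F> (g \<otimes> h)"
proof
  fix \<gamma> assume "\<gamma> \<in> product_set G U V"
  then obtain \<alpha> \<beta> where "\<alpha> \<in> U" "\<beta> \<in> V" "(\<alpha>, \<beta>) \<in> composable G" "\<gamma> = \<m> \<alpha> \<beta>"
    unfolding product_set_def by blast
  moreover have "c \<alpha> = g" "c \<beta> = h" using calculation assms unfolding cocycle_fibre_def by auto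
  ultimately show "\<gamma> \<in> \<F> (g \<otimes> h)"
    using cocycle_mult[of \<alpha> \<beta>] unfolding cocycle_fibre_def composable_def by auto
qed

lemma component_mult:
  fixes f k :: "'a \<Rightarrow> 'r::ring_1"
  assumes "f \<in> \<A> g" "k \<in> \<A> h"
  shows "conv f k \<in> \<A> (g \<otimes> h)"
  using assms unfolding algebra_component_def
  by (rule convolution_span) (use bisections_mult product_fibre in auto)

lemma nonunital_ring_component:
  "nonunital_ring (\<A> \<one> :: ('a \<Rightarrow> 'r::ring_1) set) (conv)"
  unfolding algebra_component_def
  by (rule nonunital_ring_span) (use bisections_mult product_fibre[of _ \<one> _ \<one>] in auto)

lemma convolution_kernel:
  fixes f g :: "'a \<Rightarrow> 'r::ring_1"
  assumes "f \<in> \<A> \<one>" "g \<in> \<A> \<one>"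
  shows "convolution kernel.K f g = conv f g"
  using assms kernel.algebra_K_support unfolding kernel_algebra_eq[symmetric]
  by (intro kernel.convolution_K) blast+

lemma regular_kernel_iff:
  "von_neumann_regular (groupoid_algebra kernel.K :: ('a \<Rightarrow> 'r::ring_1) set) (convolution kernel.K) \<longleftrightarrow>
   von_neumann_regular (\<A> \<one> :: ('a \<Rightarrow> 'r) set) (conv)"
proof -
  interpret A: nonunital_ring "\<A> \<one> :: ('a \<Rightarrow> 'r) set" "conv"
    by (rule nonunital_ring_component)
  have "convolution kernel.K (convolution kernel.K f g) f = conv (conv f g) f"
    if "f \<in> \<A> \<one>" "g \<in> \<A> \<one>" for f g :: "'a \<Rightarrow> 'r"
    using that A.mult_closed by (simp add: convolution_kernel)
  then show ?thesis unfolding von_neumann_regular_def kernel_algebra_eq by auto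
qed

text \<open>A quasi-inverse in the whole algebra may have parts of several degrees. As
  \<open>f\<close> has degree \<open>\<one>\<close>, only the part of \<open>y\<close> of that
  degree contributes on arrows of degree \<open>\<one>\<close>, and \<open>f\<close> vanishes on all
  others.\<close>

lemma graded_regular_imp_regular_component:
  assumes graded: "graded_von_neumann_regular (alg :: ('a \<Rightarrow> 'r::ring_1) set) (conv)
    (carrier H) (\<A>)"
  shows "von_neumann_regular (\<A> \<one> :: ('a \<Rightarrow> 'r) set) (conv)"
  unfolding von_neumann_regular_def
proof
  let ?S = "\<F> \<one>"
  fix f :: "'a \<Rightarrow> 'r" assume f: "f \<in> \<A> \<one>"
  then obtain y where y: "y \<in> alg" "conv (conv f y) f = f"
    using graded H.one_closed unfolding graded_von_neumann_regular_def by blast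
  define y' where "y' = (\<lambda>\<gamma>. if \<gamma> \<in> ?S then y \<gamma> else 0)"
  have y': "y' \<in> \<A> \<one>"
    unfolding y'_def algebra_component_def by (rule span_restrict_clopen[OF y(1) open_cocycle_fibre])
  have f_supp: "\<gamma> \<in> ?S" if "f \<gamma> \<noteq> 0" for \<gamma>
    using kernel.algebra_K_support f that unfolding kernel_algebra_eq by blast
  \<comment> \<open>Restricted to degree \<open>\<one>\<close>: at other arrows
    \<open>conv f y\<close> and \<open>conv f y'\<close> may differ.\<close>
  have fy: "conv f y \<gamma> = conv f y' \<gamma>" if \<gamma>: "\<gamma> \<in> ?S" for \<gamma>
  proof (rule convolution_cong)
    fix \<alpha> \<beta> assume comp: "(\<alpha>, \<beta>) \<in> composable G" "\<m> \<alpha> \<beta> = \<gamma>"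
    have "y \<beta> = y' \<beta>" if "\<alpha> \<in> ?S"
    proof -
      have "\<beta> = \<m> (\<i> \<alpha>) \<gamma>" "\<r> \<alpha> = \<r> \<gamma>" using comp by (auto simp: composable_def)
      then have "\<beta> \<in> ?S" using kernel.sub_mult[OF kernel.sub_inv[OF that] \<gamma>] that by simp
      then show ?thesis unfolding y'_def by simp
    qed
    then show "f \<alpha> = 0 \<and> f \<alpha> = 0 \<or> y \<beta> = 0 \<and> y' \<beta> = 0 \<or> f \<alpha> = f \<alpha> \<and> y \<beta> = y' \<beta>"
      using f_supp by blast
  qed
  have "conv (conv f y') f \<gamma> = f \<gamma>" for \<gamma>
  proof (cases "\<gamma> \<in> ?S")
    case \<gamma>: True
    have "conv (conv f y) f \<gamma> = conv (conv f y') f \<gamma>"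
    proof (rule convolution_cong)
      fix \<alpha> \<beta> assume comp: "(\<alpha>, \<beta>) \<in> composable G" "\<m> \<alpha> \<beta> = \<gamma>"
      have "conv f y \<alpha> = conv f y' \<alpha>" if "\<beta> \<in> ?S"
      proof -
        have "\<alpha> = \<m> \<gamma> (\<i> \<beta>)" "\<s> \<beta> = \<s> \<gamma>" using comp by (auto simp: composable_def)
        then have "\<alpha> \<in> ?S" using kernel.sub_mult[OF \<gamma> kernel.sub_inv[OF that]] that by simp
        then show ?thesis by (rule fy)
      qed
      then show "conv f y \<alpha> = 0 \<and> conv f y' \<alpha> = 0 \<or> f \<beta> = 0 \<and> f \<beta> = 0 \<or>
          conv f y \<alpha> = conv f y' \<alpha> \<and> f \<beta> = f \<beta>"
        using f_supp by blast
    qed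
    then show ?thesis using y(2) by simp
  next
    case False
    have "conv (conv f y') f \<in> groupoid_algebra kernel.K"
      using component_mult[OF component_mult[OF f y'] f] unfolding kernel_algebra_eq by simp
    then have "conv (conv f y') f \<gamma> = 0"
      using kernel.algebra_K_support False by blast
    then show ?thesis using f_supp False by metis
  qed
  then show "\<exists>b\<in>\<A> \<one>. conv (conv f b) f = f"
    using y' by blast
qed

text \<open>
  The products \<open>z * x\<close> with \<open>z\<close> of degree \<open>inv h\<close> form a left ideal of the component of degree
  \<open>\<one>\<close>. A common right unit \<open>y * x\<close> of the elements \<open>b U * x\<close> satisfies \<open>x * y * x = x\<close>, because
  convolution with \<open>b U\<close> is injective on functions supported over the range of \<open>U\<close>.
\<close>

lemma regular_component_imp_graded_regular:
  assumes regular: "von_neumann_regular (\<A> \<one> :: ('a \<Rightarrow> 'r::ring_1) set) (conv)"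
  shows "graded_von_neumann_regular (alg :: ('a \<Rightarrow> 'r) set) (conv)
    (carrier H) (\<A>)"
  unfolding graded_von_neumann_regular_def
proof (intro ballI)
  fix h and x :: "'a \<Rightarrow> 'r" assume h: "h \<in> carrier H" and x: "x \<in> \<A> h"
  interpret A: nonunital_ring "\<A> \<one> :: ('a \<Rightarrow> 'r) set" "conv"
    by (rule nonunital_ring_component)
  obtain \<U> where \<U>: "finite \<U>" "\<U> \<subseteq> {U \<in> \<B>. U \<subseteq> \<F> h}"
    "x \<in> span_of \<U>" "{\<gamma>. x \<gamma> \<noteq> 0} \<subseteq> \<Union>\<U>"
    using algebra_support[OF x[unfolded algebra_component_def]] .
  \<comment> \<open>Multiplication by the inverse of a bisection of degree \<open>h\<close> moves
    \<open>x\<close> into degree \<open>\<one>\<close>, where regularity is available.\<close>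
  define b :: "'a set \<Rightarrow> 'a \<Rightarrow> 'r" where "b U = indicator (\<i> ` U)" for U
  have U: "U \<in> \<B>" "U \<subseteq> \<F> h" if "U \<in> \<U>" for U
    using that \<U>(2) by auto
  have b: "b U \<in> \<A> (inv h)" if "U \<in> \<U>" for U
  proof -
    have "\<i> ` U \<subseteq> \<F> (inv h)"
    proof (rule image_subsetI)
      fix \<gamma> assume "\<gamma> \<in> U"
      then have "\<gamma> \<in> \<G>" "c \<gamma> = h" using U(2)[OF that] unfolding cocycle_fibre_def by auto
      then show "\<i> \<gamma> \<in> \<F> (inv h)" unfolding cocycle_fibre_def by (simp add: cocycle_inv)
    qed
    then have "\<i> ` U \<in> {U \<in> \<B>. U \<subseteq> \<F> (inv h)}"
      using bisections_inv[OF U(1)[OF that]] by simp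
    then show ?thesis unfolding algebra_component_def b_def by (intro left_span_base imageI)
  qed
  define L where "L = (\<lambda>z. conv z x) ` \<A> (inv h)"
  have ffx: "fibre_finite G x" using component_fibre_finite[OF x] .
  have L_sub: "L \<subseteq> \<A> \<one>"
    unfolding L_def using component_mult[OF _ x, of _ "inv h"] h by auto
  have "\<exists>e\<in>L. \<forall>a\<in>(\<lambda>U. conv (b U) x) ` \<U>. conv a e = a"
  proof (rule A.left_ideal_common_right_unit[OF regular L_sub])
    show "0 \<in> L"
      unfolding L_def
    proof (rule image_eqI)
      show "0 = conv 0 x" using convolution_zero by simp
      show "0 \<in> \<A> (inv h)" unfolding algebra_component_def by (rule left_span_zero)
    qed
    show "y - z \<in> L" if "y \<in> L" "z \<in> L" for y z
    proof -
      obtain y' z' where *: "y' \<in> \<A> (inv h)" "z' \<in> \<A> (inv h)"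
        "y = conv y' x" "z = conv z' x" using \<open>y \<in> L\<close> \<open>z \<in> L\<close> unfolding L_def by auto
      have "y - z = conv (y' - z') x"
        using *(3,4) convolution_diff_left[OF component_fibre_finite[OF *(1)] component_fibre_finite[OF *(2)]]
        by simp
      moreover have "y' - z' \<in> \<A> (inv h)"
        using * unfolding algebra_component_def by (intro left_span_diff)
      ultimately show ?thesis unfolding L_def by blast
    qed
    show "conv y z \<in> L" if "y \<in> \<A> \<one>" "z \<in> L" for y z
    proof -
      obtain z' where *: "z' \<in> \<A> (inv h)" "z = conv z' x"
        using \<open>z \<in> L\<close> unfolding L_def by auto
      have "conv y z = conv (conv y z') x"
        using *(2) convolution_assoc[OF component_fibre_finite[OF that(1)] component_fibre_finite[OF *(1)]]
        by simp
      moreover have "conv y z' \<in> \<A> (inv h)"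
        using component_mult[OF that(1) *(1)] h by simp
      ultimately show ?thesis unfolding L_def by blast
    qed
    show "(\<lambda>U. conv (b U) x) ` \<U> \<subseteq> L" unfolding L_def using b by blast
  qed (use \<U>(1) in simp)
  \<comment> \<open>Membership of the right unit in \<open>L\<close> is what provides the factor
    \<open>y\<close>, the future quasi-inverse of \<open>x\<close>.\<close>
  then obtain y where y: "y \<in> \<A> (inv h)"
    and e: "\<And>U. U \<in> \<U> \<Longrightarrow> conv (conv (b U) x) (conv y x) = conv (b U) x"
    unfolding L_def by auto
  have "conv x (conv y x) \<gamma> = x \<gamma>" for \<gamma>
  proof (cases "\<exists>U\<in>\<U>. \<r> \<gamma> \<in> \<r> ` U")
    case False
    \<comment> \<open>No covering bisection reaches the range of \<gamma>, so \<open>x\<close>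
      vanishes on that whole range fibre and both sides are 0.\<close>
    then have none: "x \<alpha> = 0" if "\<r> \<alpha> = \<r> \<gamma>" for \<alpha>
      using \<U>(4) that by (metis (mono_tags, lifting) UnionE image_eqI mem_Collect_eq subset_iff)
    then have "conv x (conv y x) \<gamma> = conv 0 (conv y x) \<gamma>"
      by (intro convolution_cong) (auto simp: composable_def)
    then show ?thesis using none by (simp add: convolution_zero)
  next
    case True
    show ?thesis
    proof (cases "\<gamma> \<in> \<G>")
      case \<gamma>: True
      obtain U \<alpha> where U\<alpha>: "U \<in> \<U>" "\<alpha> \<in> U" "\<r> \<alpha> = \<r> \<gamma>" using True by auto
      note U' = U(1)[OF U\<alpha>(1)]
      have \<alpha>: "\<alpha> \<in> \<G>" using bisectionsD(5)[OF U'] U\<alpha>(2) by blast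
      let ?\<delta> = "\<m> (\<i> \<alpha>) \<gamma>"
      have \<delta>: "?\<delta> \<in> \<G>" "\<r> (\<i> \<alpha>) = \<r> ?\<delta>" "\<m> (\<i> (\<i> \<alpha>)) ?\<delta> = \<gamma>"
        using \<alpha> \<gamma> U\<alpha>(3) by auto
      \<comment> \<open>Convolution with \<open>b U\<close> moves the value at \<gamma> to
        \<open>?\<delta>\<close>, so an equation between such convolutions can be cancelled at
        \<gamma>.\<close>
      have eval: "conv (b U) z ?\<delta> = z \<gamma>" for z
        unfolding b_def
        using convolution_indicator_left[OF bisectionsD(5,3)[OF bisections_inv[OF U']] imageI[OF U\<alpha>(2)] \<delta>(1,2), of z]
        unfolding \<delta>(3) .
      have "conv (b U) (conv x (conv y x)) = conv (b U) x"
        using e[OF U\<alpha>(1)] convolution_assoc[OF component_fibre_finite[OF b[OF U\<alpha>(1)]] ffx] by simp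
      then show ?thesis using eval by metis
    next
      case False
      then have "x \<gamma> = 0" using fibre_finiteD(1)[OF ffx, of \<gamma>] by blast
      then show ?thesis using False by (simp add: convolution_outside)
    qed
  qed
  then have "conv (conv x y) x = x"
    using convolution_assoc[OF ffx component_fibre_finite[OF y]] by auto
  then show "\<exists>y\<in>alg. conv (conv x y) x = x"
    using y component_subset by blast
qed

end

theorem theorem4p3:
  fixes G :: "'g top_groupoid"
    and H :: "('h, 'm) monoid_scheme"
    and c :: "'g \<Rightarrow> 'h"
  assumes "ample_groupoid G"
    and "group H"
    and "continuous_cocycle G H c"
  shows "graded_von_neumann_regular (groupoid_algebra G :: ('g \<Rightarrow> 'r::ring_1) set) (convolution G)
           (carrier H) (algebra_component G c)
         \<longleftrightarrow>
         von_neumann_regular (UNIV :: 'r set) (*) \<and>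
         approximately_quasi_compact (kernel_groupoid G H c) \<and>
         (\<forall>x \<in> gunits (kernel_groupoid G H c). \<forall>K.
            subgroup K (isotropy_group (kernel_groupoid G H c) x) \<and> finite K \<longrightarrow>
            invertible_element (of_nat (card K) :: 'r))"
proof -
  interpret ample_groupoid G by (rule assms(1))
  interpret graded_groupoid G H c
    by (intro graded_groupoid.intro graded_groupoid_axioms.intro bisection_groupoid_axioms assms(2,3))
  \<comment> \<open>Once the grading is reduced to degree \<open>\<one>\<close>, both implications
    are the ungraded results for the kernel groupoid.\<close>
  interpret K: bisection_groupoid kernel.K by (rule kernel.bisection_groupoid_K)
  have "graded_von_neumann_regular (groupoid_algebra G :: ('g \<Rightarrow> 'r) set) (convolution G)
      (carrier H) (algebra_component G c) \<longleftrightarrow>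
    von_neumann_regular (groupoid_algebra kernel.K :: ('g \<Rightarrow> 'r) set) (convolution kernel.K)"
    unfolding regular_kernel_iff
    using graded_regular_imp_regular_component regular_component_imp_graded_regular by blast
  then show ?thesis
    unfolding kernel_groupoid_eq
    using K.regular_algebra_imp_regular_coefficients K.regular_algebra_imp_approximately_quasi_compact
      K.regular_algebra_imp_isotropy_invertible K.regular_algebraI by blast
qed

end
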